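(* Let $C,g>1$ and let $1<a<m_g$. Then, as $n\to\infty$, $$\inf_G \mathbf E\,T_{oz}=m_g\,n+O(1),\qquad \sup_G\mathbf P[T_{oz}\le an]=e^{-I_g(a)n+o(n)},$$ where the $\inf$ and $\sup$ are over all weighted graphs $G$ with a vertex $o$ and a vertex set $z$ satisfying $n\le\mathrm{dist}(o,z)$ and $w_z/w_o\le Cg^n$. The functions $O(1)$ and $o(n)$ depend on $n,C,g,a$ only.
   Context: A weighted graph $G=(V,w)$ is a set $V$ of vertices with a symmetric function $w:V\times V\to[0,\infty)$; the edges are the pairs on which $w$ is positive. The weight of a vertex is $w_x=\sum_y w(x,y)$ (with $0<w_x<\infty$), and the weight of a vertex set $z$ is $w_z=\sum_{x\in z}w_x$. The random walk on $G$ moves from $x$ to $y$ with probability $w(x,y)/w_x$. $T_{oz}$ is the first time the walk started at $o$ at time $0$ visits $z$, and $\mathrm{dist}$ is graph distance. For $g>1$, $m_g$ and $I_g$ are the mean and the large deviation rate function of the hitting time of $1$ from $0$ for biased simple random walk on $\mathbb Z$ with odds $1$ and $g$ of going left and right: $$m_g=\frac{g+1}{g-1},\qquad e^{-I_g(a)}=\frac{g}{a+1}\Big(\frac{g}{a^2-1}\Big)^{\frac{a-1}{2}}\Big(\frac{2a}{g+1}\Big)^a\quad(a>1).$$ *)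

theory Defs
  imports "HOL-Probability.Probability" "HOL-Library.Landau_Symbols"
begin

section \<open>Weighted graphs\<close>

text \<open>A weighted graph is given by a vertex set \<open>V\<close>, not necessarily countable, and a weight
  function \<open>w\<close>, of which only the values on \<open>V \<times> V\<close> matter.  Loops are allowed.\<close>

definition vertex_weight :: "'v set \<Rightarrow> ('v \<Rightarrow> 'v \<Rightarrow> real) \<Rightarrow> 'v \<Rightarrow> ennreal" where
  "vertex_weight V w x = (\<Sum>\<^sub>\<infinity>y\<in>V. ennreal (w x y))"

definition weighted_graph :: "'v set \<Rightarrow> ('v \<Rightarrow> 'v \<Rightarrow> real) \<Rightarrow> bool" where
  "weighted_graph V w \<longleftrightarrow>
     (\<forall>x\<in>V. \<forall>y\<in>V. 0 \<le> w x y \<and> w x y = w y x) \<and>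
     (\<forall>x\<in>V. 0 < vertex_weight V w x \<and> vertex_weight V w x < \<infinity>)"

definition set_weight :: "'v set \<Rightarrow> ('v \<Rightarrow> 'v \<Rightarrow> real) \<Rightarrow> 'v set \<Rightarrow> ennreal" where
  "set_weight V w z = (\<Sum>\<^sub>\<infinity>x\<in>z. vertex_weight V w x)"

definition edges :: "'v set \<Rightarrow> ('v \<Rightarrow> 'v \<Rightarrow> real) \<Rightarrow> ('v \<times> 'v) set" where
  "edges V w = {(x, y). x \<in> V \<and> y \<in> V \<and> 0 < w x y}"

text \<open>The distance is \<open>\<infinity>\<close> when no vertex of \<open>z\<close> can be reached from \<open>u\<close>.\<close>

definition graph_dist :: "'v set \<Rightarrow> ('v \<Rightarrow> 'v \<Rightarrow> real) \<Rightarrow> 'v \<Rightarrow> 'v set \<Rightarrow> enat" where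
  "graph_dist V w u z = (INF k \<in> {k. \<exists>y\<in>z. (u, y) \<in> edges V w ^^ k}. enat k)"

section \<open>The random walk\<close>

definition walk_step :: "'v set \<Rightarrow> ('v \<Rightarrow> 'v \<Rightarrow> real) \<Rightarrow> 'v \<Rightarrow> 'v pmf" where
  "walk_step V w x =
     embed_pmf (\<lambda>y. if y \<in> V then w x y / enn2real (vertex_weight V w x) else 0)"

lemma nn_integral_count_space_eq_infsum:
  fixes f :: "'v \<Rightarrow> ennreal"
  assumes fin: "infsum f A < \<infinity>"
  shows "(\<integral>\<^sup>+ x. f x \<partial>count_space A) = infsum f A"
proof (rule antisym)
  have S: "infsum f A = (SUP F\<in>{F. finite F \<and> F \<subseteq> A}. sum f F)"
    by (rule nonneg_infsum_complete) simp
  have le: "sum f F \<le> infsum f A" if "finite F" "F \<subseteq> A" for F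
    unfolding S using that by (intro SUP_upper) auto
  show "infsum f A \<le> (\<integral>\<^sup>+ x. f x \<partial>count_space A)"
    unfolding S
  proof (rule SUP_least)
    fix F assume "F \<in> {F. finite F \<and> F \<subseteq> A}"
    then have F: "finite F" "F \<subseteq> A" by auto
    then have "sum f F = (\<integral>\<^sup>+ x. f x * indicator F x \<partial>count_space A)"
      by (subst nn_integral_count_space'[of F]) auto
    also have "\<dots> \<le> (\<integral>\<^sup>+ x. f x \<partial>count_space A)"
      by (intro nn_integral_mono) (auto split: split_indicator)
    finally show "sum f F \<le> (\<integral>\<^sup>+ x. f x \<partial>count_space A)" .
  qed
  have inv: "1 / of_nat (Suc n) = ennreal (1 / real (Suc n))" for n
    by (simp add: divide_ennreal[symmetric] ennreal_of_nat_eq_real_of_nat)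
  define B where "B n = {x \<in> A. 1 / of_nat (Suc n) \<le> f x}" for n :: nat
  have finB: "finite (B n)" for n
  proof (rule ccontr)
    assume inf: "infinite (B n)"
    obtain r where r: "infsum f A = ennreal r" "0 \<le> r"
      using fin by (cases "infsum f A") auto
    obtain m :: nat where m: "r * real (Suc n) < real m"
      using reals_Archimedean2 by blast
    obtain F where F: "F \<subseteq> B n" "finite F" "card F = m"
      using infinite_arbitrarily_large[OF inf] by blast
    have "ennreal (real m / real (Suc n)) = of_nat m * (1 / of_nat (Suc n))"
      by (simp add: divide_ennreal[symmetric] ennreal_of_nat_eq_real_of_nat
          ennreal_times_divide)
    also have "\<dots> = (\<Sum>x\<in>F. 1 / of_nat (Suc n))"
      using F by simp
    also have "\<dots> \<le> sum f F"
      using F by (intro sum_mono) (auto simp: B_def)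
    also have "\<dots> \<le> ennreal r"
      unfolding r(1)[symmetric] using F by (intro le) (auto simp: B_def)
    finally have "real m / real (Suc n) \<le> r"
      using r(2) by simp
    then show False
      using m by (simp add: field_simps)
  qed
  have eq: "f x = (SUP n. f x * indicator (B n) x)" if "x \<in> A" for x
  proof (cases "f x = 0")
    case False
    then have "0 < f x" by (simp add: less_le)
    obtain q where q: "0 < q" "q < f x"
      using \<open>0 < f x\<close> dense by blast
    obtain s where s: "q = ennreal s" "0 \<le> s"
      using q(2) by (cases q) auto
    obtain n where n: "1 / real (Suc n) < s"
      using reals_Archimedean[of s] q(1) s by (auto simp: inverse_eq_divide)
    have "1 / of_nat (Suc n) = ennreal (1 / real (Suc n))"
      by (simp add: divide_ennreal[symmetric] ennreal_of_nat_eq_real_of_nat)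
    also have "\<dots> \<le> f x"
      using n q s by (metis ennreal_leI less_imp_le order_trans)
    finally have "x \<in> B n"
      using that by (simp add: B_def)
    then have "f x = f x * indicator (B n) x" by simp
    also have "\<dots> \<le> (SUP n. f x * indicator (B n) x)"
      by (rule SUP_upper) simp
    finally show ?thesis
      by (intro antisym SUP_least) (auto split: split_indicator)
  qed simp
  have incB: "B m \<subseteq> B n" if "m \<le> n" for m n
  proof -
    have "1 / of_nat (Suc n) \<le> (1 / of_nat (Suc m) :: ennreal)"
      unfolding inv using that by (intro ennreal_leI) (simp add: frac_le)
    then show ?thesis
      by (auto simp: B_def)
  qed
  have "(\<integral>\<^sup>+ x. f x \<partial>count_space A) =
      (\<integral>\<^sup>+ x. (SUP n. f x * indicator (B n) x) \<partial>count_space A)"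
    by (intro nn_integral_cong eq) simp
  also have "\<dots> = (SUP n. (\<integral>\<^sup>+ x. f x * indicator (B n) x \<partial>count_space A))"
    using incB by (intro nn_integral_monotone_convergence_SUP)
      (auto simp: incseq_def le_fun_def split: split_indicator)
  also have "\<dots> = (SUP n. sum f (B n))"
  proof (intro SUP_cong refl)
    fix n
    show "(\<integral>\<^sup>+ x. f x * indicator (B n) x \<partial>count_space A) = sum f (B n)"
      using finB[of n]
      by (subst nn_integral_count_space'[of "B n"]) (auto simp: B_def intro!: sum.cong)
  qed
  also have "\<dots> \<le> infsum f A"
    by (intro SUP_least le finB) (auto simp: B_def)
  finally show "(\<integral>\<^sup>+ x. f x \<partial>count_space A) \<le> infsum f A" .
qed

lemma pmf_walk_step:
  assumes "weighted_graph V w" "x \<in> V"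
  shows "pmf (walk_step V w x) y =
    (if y \<in> V then w x y / enn2real (vertex_weight V w x) else 0)"
proof -
  define c where "c = vertex_weight V w x"
  have c: "0 < c" "c < \<infinity>" and nn: "\<And>y. y \<in> V \<Longrightarrow> 0 \<le> w x y"
    using assms by (auto simp: weighted_graph_def c_def)
  have cr: "ennreal (enn2real c) = c" "0 < enn2real c"
    using c by (auto simp: enn2real_positive_iff less_top)
  let ?f = "\<lambda>y. if y \<in> V then w x y / enn2real c else 0"
  have "(\<integral>\<^sup>+ y. ennreal (?f y) \<partial>count_space UNIV) =
        (\<integral>\<^sup>+ y. ennreal (w x y) / c * indicator V y \<partial>count_space UNIV)"
    using cr nn by (intro nn_integral_cong) (auto simp: divide_ennreal[symmetric])
  also have "\<dots> = (\<integral>\<^sup>+ y. ennreal (w x y) / c \<partial>count_space V)"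
    by (simp add: nn_integral_count_space_indicator)
  also have "\<dots> = (\<integral>\<^sup>+ y. ennreal (w x y) \<partial>count_space V) / c"
    by (rule nn_integral_divide) auto
  also have "(\<integral>\<^sup>+ y. ennreal (w x y) \<partial>count_space V) = c"
    using c(2) unfolding c_def vertex_weight_def by (rule nn_integral_count_space_eq_infsum)
  also have "c / c = 1"
    using c by (intro ennreal_divide_self) (auto simp: less_top)
  finally show ?thesis
    unfolding walk_step_def c_def[symmetric] using cr nn by (subst pmf_embed_pmf) auto
qed

text \<open>The law of the walk on trajectories is built with the Ionescu-Tulcea theorem.  The kernel at
  time \<open>i\<close> is given the trajectory before time \<open>i\<close>.\<close>

definition walk_kernel ::
    "'v set \<Rightarrow> ('v \<Rightarrow> 'v \<Rightarrow> real) \<Rightarrow> 'v \<Rightarrow> nat \<Rightarrow> (nat \<Rightarrow> 'v) \<Rightarrow> 'v measure" where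
  "walk_kernel V w u i \<omega> =
     measure_pmf (case i of 0 \<Rightarrow> return_pmf u | Suc j \<Rightarrow> walk_step V w (\<omega> j))"

interpretation walk: Ionescu_Tulcea "walk_kernel V w u" "\<lambda>_. count_space UNIV" for V w u
proof (rule Ionescu_Tulcea.intro)
  fix i :: nat
  show "walk_kernel V w u i \<in>
    Pi\<^sub>M {0..<i} (\<lambda>_. count_space UNIV) \<rightarrow>\<^sub>M subprob_algebra (count_space UNIV)"
  proof (cases i)
    case 0
    then show ?thesis
      by (auto simp: walk_kernel_def[abs_def] space_subprob_algebra
          intro!: prob_space_imp_subprob_space prob_space_measure_pmf)
  next
    case (Suc j)
    have "(\<lambda>\<omega>. \<omega> j) \<in> Pi\<^sub>M {0..<i} (\<lambda>_. count_space UNIV) \<rightarrow>\<^sub>M count_space UNIV"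
      using Suc by (intro measurable_component_singleton) auto
    then have "(\<lambda>\<omega>. measure_pmf (walk_step V w (\<omega> j))) \<in>
        Pi\<^sub>M {0..<i} (\<lambda>_. count_space UNIV) \<rightarrow>\<^sub>M subprob_algebra (count_space UNIV)"
      by (rule measurable_compose)
        (auto simp: space_subprob_algebra
          intro!: prob_space_imp_subprob_space prob_space_measure_pmf)
    then show ?thesis
      using Suc by (simp add: walk_kernel_def[abs_def])
  qed
qed (simp_all add: walk_kernel_def prob_space_measure_pmf)

definition walk_law :: "'v set \<Rightarrow> ('v \<Rightarrow> 'v \<Rightarrow> real) \<Rightarrow> 'v \<Rightarrow> (nat \<Rightarrow> 'v) measure" where
  "walk_law V w u = walk.PF.lim V w u"

definition hitting_time :: "'v set \<Rightarrow> (nat \<Rightarrow> 'v) \<Rightarrow> enat" where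
  "hitting_time z \<omega> = (INF k \<in> {k. \<omega> k \<in> z}. enat k)"

definition mean_hitting_time ::
    "'v set \<Rightarrow> ('v \<Rightarrow> 'v \<Rightarrow> real) \<Rightarrow> 'v \<Rightarrow> 'v set \<Rightarrow> ennreal" where
  "mean_hitting_time V w u z = (\<integral>\<^sup>+ \<omega>. ennreal_of_enat (hitting_time z \<omega>) \<partial>walk_law V w u)"

definition prob_hit_by ::
    "real \<Rightarrow> 'v set \<Rightarrow> ('v \<Rightarrow> 'v \<Rightarrow> real) \<Rightarrow> 'v \<Rightarrow> 'v set \<Rightarrow> ennreal" where
  "prob_hit_by t V w u z = emeasure (walk_law V w u)
     {\<omega> \<in> space (walk_law V w u). ennreal_of_enat (hitting_time z \<omega>) \<le> ennreal t}"

section \<open>The extremal problem\<close>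

text \<open>The vertex type \<open>'v\<close> plays the role of the universe from which vertex sets are drawn.  A
  bound uniform over all graphs is expressed by using the same error terms for an arbitrary infinite
  type \<open>'v\<close> and for the fixed type \<open>nat\<close>: the latter determines them independently of
  \<open>'v\<close>.  Finite graphs are included, since \<open>V\<close> may be any subset.\<close>

definition admissible ::
    "real \<Rightarrow> real \<Rightarrow> nat \<Rightarrow> ('v set \<times> ('v \<Rightarrow> 'v \<Rightarrow> real) \<times> 'v \<times> 'v set) set" where
  "admissible C g n = {(V, w, u, z). weighted_graph V w \<and> u \<in> V \<and> z \<subseteq> V \<and>
     enat n \<le> graph_dist V w u z \<and>
     set_weight V w z / vertex_weight V w u \<le> ennreal (C * g ^ n)}"

definition biased_mean :: "real \<Rightarrow> real" where
  "biased_mean g = (g + 1) / (g - 1)"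

text \<open>Logarithmic form of
  \<open>e\<^bsup>-I(a)\<^esup> = g/(a+1) (g/(a\<^sup>2-1))\<^bsup>(a-1)/2\<^esup> (2a/(g+1))\<^sup>a\<close>; the right side is positive for
  \<open>a > 1\<close>.\<close>

definition biased_rate :: "real \<Rightarrow> real \<Rightarrow> real" where
  "biased_rate g a =
     - ln (g / (a + 1) * (g / (a\<^sup>2 - 1)) powr ((a - 1) / 2) * (2 * a / (g + 1)) powr a)"

end

theory Submission
  imports Defs "HOL-Real_Asymp.Real_Asymp"
begin

text \<open>Let \<open>T\<close> be the hitting time of \<open>z\<close> from \<open>u\<close>.  Both estimates of \<open>T\<close> from below come from one
  flow.  Fix \<open>0 < s < 1\<close>, put \<open>h(x) = E\<^sub>x s\<^sup>T\<close>, and let \<open>v(x)\<close> be the expected number of visits to \<open>x\<close>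
  before \<open>T\<close>, discounted by \<open>s\<close> per step and divided by the weight of \<open>x\<close>.  Reversibility makes
  \<open>v\<close> and \<open>h\<close> solutions of the same symmetric equation \<open>w\<^sub>x f(x) = s \<Sum>\<^sub>y w(x,y) f(y)\<close> away from \<open>u\<close>
  and \<open>z\<close>, so that \<open>j(x,y) = s w(x,y) (v(x) h(y) - v(y) h(x)) / h(u)\<close> is a unit flow from \<open>u\<close> to
  \<open>z\<close>: it is the net current of the walk reweighted by \<open>s\<^sup>T\<close>.  Summation by parts against this flow
  evaluates three gradients.  That of \<open>ln h\<close> gives \<open>- ln h(u)\<close>, the quantity to bound below; that of
  \<open>ln v\<close> is bounded through Jensen's inequality by \<open>ln (w\<^sub>z / w\<^sub>u) \<le> ln C + n ln g\<close>, up to \<open>- ln h(u)\<close> and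
  the logarithm of the number of visits to \<open>u\<close>; that of the graph distance is at least \<open>n - 1\<close>.
  Multiplying the equation of \<open>h\<close> by \<open>v\<close> and summing gives one further sum over edges that is bounded
  by a constant.  In all these sums the contribution of an edge, relative to the flow through it,
  depends only on the two ratios \<open>h(y)/h(x)\<close> and \<open>v(x)/v(y)\<close>.  The problem is therefore a convex
  inequality in two variables, whose extremal point is the biased walk.

  For \<open>s = cosh (ln g / 2) / cosh (ln G / 2)\<close> with \<open>G > g\<close> this gives
  \<open>E s\<^sup>T \<le> K (g/G)\<^bsup>n/2\<^esup>\<close> (\<open>hit_gen_upper_bound\<close>), and Chernoff's bound with
  \<open>G = (a+1)/(a-1)\<close> is exactly \<open>K e\<^bsup>-I(a)n\<^esup>\<close> (\<open>hit_prob_upper\<close>).  As \<open>s\<close> tends to \<open>1\<close>, a version of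
  the inequality with constants that are exact to first order in \<open>1 - s\<close> gives
  \<open>E T \<ge> m\<^sub>g n - K\<close> (\<open>mean_lower_bound\<close>).  Here the walk can spend a long time at \<open>u\<close>; the edges
  at \<open>u\<close> then contribute the number of visits \<open>N\<close> to \<open>u\<close>, which outweighs the loss of order \<open>ln N\<close>.
  To keep all sums finite, the walk is killed outside a finite set of vertices; the loss of mass
  preserves the direction of the inequalities, and the finite sets exhaust the graph in the limit.

  Both bounds are attained, up to the error terms, by the path \<open>0, ..., n\<close> with conductances \<open>g\<^sup>k\<close>, on
  which the walk is biased with odds \<open>g\<close> and reflected at \<open>0\<close>: the linear function \<open>m\<^sub>g (n - x)\<close> is
  superharmonic for the mean (\<open>path_mean_le\<close>), and the powers \<open>\<phi>\<^bsup>n-x\<^esup>\<close> are subharmonic for the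
  generating function (\<open>path_hit_gen_ge\<close>).  Since the generating function is thereby known up to
  constants for every \<open>s < 1\<close>, exponential tilting shows that \<open>T\<close>, tilted by a suitable \<open>s\<close>, concentrates
  just below \<open>a n\<close>; this is the lower bound for the probability (\<open>path_hit_prob_lower\<close>).

  Finally, the walk stays in the connected component of \<open>u\<close>, which is countable, so every admissible
  graph can be replaced by one whose vertices lie in any given infinite type
  (\<open>admissible_transfer\<close>); the extrema do not depend on the type.\<close>

section \<open>The hitting time in terms of survival probabilities\<close>

text \<open>The probability that a walk from \<open>x\<close> avoids \<open>z\<close> at the times \<open>1, ..., m\<close>.  The start is not tested,
  so that the recursion is the same at every vertex.\<close>

primrec survival :: "('v \<Rightarrow> 'v pmf) \<Rightarrow> 'v set \<Rightarrow> nat \<Rightarrow> 'v \<Rightarrow> real" where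
  "survival K z 0 x = 1"
| "survival K z (Suc m) x =
     measure_pmf.expectation (K x) (\<lambda>y. if y \<in> z then 0 else survival K z m y)"

lemma integrable_pmf_bounded:
  fixes f :: "'v \<Rightarrow> real"
  assumes "\<And>y. \<bar>f y\<bar> \<le> B"
  shows "integrable (measure_pmf p) f"
  using assms by (intro measure_pmf.integrable_const_bound[where B=B]) auto

lemma expectation_pmf_bounds:
  fixes f :: "'v \<Rightarrow> real"
  assumes "\<And>y. 0 \<le> f y" "\<And>y. f y \<le> 1"
  shows "0 \<le> measure_pmf.expectation p f" "measure_pmf.expectation p f \<le> 1"
proof -
  show "0 \<le> measure_pmf.expectation p f"
    using assms(1) by (intro Bochner_Integration.integral_nonneg)
  have "measure_pmf.expectation p f \<le> measure_pmf.expectation p (\<lambda>_. 1)"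
    using assms by (intro integral_mono integrable_pmf_bounded[where B=1]) auto
  then show "measure_pmf.expectation p f \<le> 1" by simp
qed

lemma survival_bounds: "0 \<le> survival K z m x" "survival K z m x \<le> 1"
proof -
  have "0 \<le> survival K z m x \<and> survival K z m x \<le> 1"
  proof (induction m arbitrary: x)
    case (Suc m)
    show ?case
      using Suc by (auto intro!: expectation_pmf_bounds)
  qed simp
  then show "0 \<le> survival K z m x" "survival K z m x \<le> 1" by auto
qed

lemma integrable_survival:
  "integrable (measure_pmf p) (\<lambda>y. if y \<in> z then 0 else survival K z m y)"
proof (rule integrable_pmf_bounded[where B=1])
  show "\<bar>if y \<in> z then 0 else survival K z m y\<bar> \<le> 1" for y
    using survival_bounds[of K z m y] by simp
qed

lemma survival_decreasing: "survival K z (Suc m) x \<le> survival K z m x"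
proof (induction m arbitrary: x)
  case 0
  show ?case using survival_bounds(2)[of K z 1 x] by simp
next
  case (Suc m)
  have "measure_pmf.expectation (K x) (\<lambda>y. if y \<in> z then 0 else survival K z (Suc m) y)
    \<le> measure_pmf.expectation (K x) (\<lambda>y. if y \<in> z then 0 else survival K z m y)"
    using Suc by (intro integral_mono integrable_survival) (simp del: survival.simps)
  then show ?case by simp
qed

text \<open>The vertex type may be uncountable, so the product space is not discrete; events that depend on finitely
  many coordinates are measurable nevertheless.\<close>

lemma avoid_sets:
  fixes z :: "'v set" and m :: nat
  assumes "{..m} \<subseteq> J"
  shows "{\<omega> \<in> space (Pi\<^sub>M J (\<lambda>_. count_space UNIV)). \<forall>i\<le>m. \<omega> i \<notin> z} \<in> sets (Pi\<^sub>M J (\<lambda>_. count_space UNIV))"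
proof -
  let ?M = "Pi\<^sub>M J (\<lambda>_. count_space (UNIV :: 'v set))"
  have "{\<omega> \<in> space ?M. \<omega> i \<notin> z} \<in> sets ?M" if "i \<le> m" for i
  proof -
    have "(\<lambda>\<omega>. \<omega> i) \<in> measurable ?M (count_space UNIV)"
      using that assms by (intro measurable_component_singleton) auto
    from measurable_sets[OF this, of "- z"] show ?thesis
      by (simp add: vimage_def Collect_conj_eq Int_commute)
  qed
  then have "(\<Inter>i\<in>{..m}. {\<omega> \<in> space ?M. \<omega> i \<notin> z}) \<in> sets ?M"
    by (intro sets.finite_INT) auto
  also have "(\<Inter>i\<in>{..m}. {\<omega> \<in> space ?M. \<omega> i \<notin> z}) = {\<omega> \<in> space ?M. \<forall>i\<le>m. \<omega> i \<notin> z}"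
    by auto
  finally show ?thesis .
qed

text \<open>The Ionescu-Tulcea measure appends the last step of a path, whereas the recursion for the survival
  probability splits off the first one.  For a general final payoff \<open>f\<close> the two agree: integrating out
  the last step replaces \<open>f\<close> by its image under the killed transition operator.\<close>

lemma nn_integral_avoiding_path:
  fixes f :: "'v \<Rightarrow> ennreal"
  shows "(\<integral>\<^sup>+ \<omega>. (if \<forall>i\<le>m. \<omega> i \<notin> z then f (\<omega> m) else 0) \<partial>walk.C V w u 0 (Suc m) (\<lambda>_. undefined)) =
    (if u \<in> z then 0 else
      ((\<lambda>g x. \<integral>\<^sup>+ y. (if y \<in> z then 0 else g y) \<partial>measure_pmf (walk_step V w x)) ^^ m) f u)"
proof (induction m arbitrary: f)
  case 0
  have un: "(\<lambda>_. undefined) \<in> space (Pi\<^sub>M {0..<0::nat} (\<lambda>_. count_space (UNIV::'v set)))"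
    by (simp add: space_PiM)
  have fm: "(\<lambda>\<omega>. \<omega> 0) \<in> measurable (Pi\<^sub>M {0..<Suc 0} (\<lambda>_. count_space (UNIV::'v set))) (count_space UNIV)"
    by (intro measurable_component_singleton) auto
  have meas: "(\<lambda>\<omega>. if \<omega> 0 \<notin> z then f (\<omega> 0) else 0)
      \<in> borel_measurable (Pi\<^sub>M {0..<Suc 0} (\<lambda>_. count_space (UNIV::'v set)))"
    by (rule measurable_compose[OF fm, of "\<lambda>y. if y \<notin> z then f y else 0"]) simp
  have "(\<integral>\<^sup>+ \<omega>. (if \<forall>i\<le>0. \<omega> i \<notin> z then f (\<omega> 0) else 0) \<partial>walk.C V w u 0 (Suc 0) (\<lambda>_. undefined))
    = (\<integral>\<^sup>+ \<omega>. (if \<omega> 0 \<notin> z then f (\<omega> 0) else 0) \<partial>walk.eP V w u 0 (\<lambda>_. undefined))"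
    using bind_return[OF walk.measurable_eP[of V w u 0] un] by (simp add: walk.C.simps)
  also have "\<dots> = (\<integral>\<^sup>+ y. (if y \<notin> z then f y else 0) \<partial>walk_kernel V w u 0 (\<lambda>_. undefined))"
    by (subst walk.nn_integral_eP[OF un meas]) (simp cong: if_cong)
  also have "\<dots> = (if u \<in> z then 0 else f u)"
    by (simp add: walk_kernel_def)
  finally show ?case by simp
next
  case (Suc m)
  let ?M = "\<lambda>n. Pi\<^sub>M {0..<n::nat} (\<lambda>_. count_space (UNIV::'v set))"
  let ?K = "\<lambda>g x. \<integral>\<^sup>+ y. (if y \<in> z then 0 else g y) \<partial>measure_pmf (walk_step V w x)"
  have un: "(\<lambda>_. undefined) \<in> space (?M 0)"
    by (simp add: space_PiM)
  have comp: "(\<lambda>\<omega>. \<omega> i) \<in> measurable (?M n) (count_space UNIV)" if "i < n" for i n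
    using that by (intro measurable_component_singleton) auto
  have meas: "(\<lambda>\<omega>. if \<forall>i\<le>m. \<omega> i \<notin> z then g (\<omega> m) else 0) \<in> borel_measurable (?M (Suc m))"
    for m and g :: "'v \<Rightarrow> ennreal"
  proof (rule measurable_If)
    show "(\<lambda>\<omega>. g (\<omega> m)) \<in> borel_measurable (?M (Suc m))"
      by (rule measurable_compose[OF comp]) simp_all
    show "{\<omega> \<in> space (?M (Suc m)). \<forall>i\<le>m. \<omega> i \<notin> z} \<in> sets (?M (Suc m))"
      by (rule avoid_sets) auto
  qed simp
  have pull_if: "(\<integral>\<^sup>+ y. (if P then g y else 0) \<partial>N) = (if P then \<integral>\<^sup>+ y. g y \<partial>N else 0)"
    for P and g :: "'v \<Rightarrow> ennreal" and N
    by simp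
  have inner: "(\<integral>\<^sup>+ \<omega>'. (if \<forall>i\<le>Suc m. \<omega>' i \<notin> z then f (\<omega>' (Suc m)) else 0) \<partial>walk.eP V w u (Suc m) \<omega>)
      = (if \<forall>i\<le>m. \<omega> i \<notin> z then ?K f (\<omega> m) else 0)" if "\<omega> \<in> space (?M (Suc m))" for \<omega>
  proof -
    have "(\<integral>\<^sup>+ \<omega>'. (if \<forall>i\<le>Suc m. \<omega>' i \<notin> z then f (\<omega>' (Suc m)) else 0) \<partial>walk.eP V w u (Suc m) \<omega>)
      = (\<integral>\<^sup>+ y. (if \<forall>i\<le>Suc m. (fun_upd \<omega> (Suc m) y) i \<notin> z then f ((fun_upd \<omega> (Suc m) y) (Suc m)) else 0)
          \<partial>walk_kernel V w u (Suc m) \<omega>)"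
      by (rule walk.nn_integral_eP[OF that meas])
    also have "\<dots> = (\<integral>\<^sup>+ y. (if \<forall>i\<le>m. \<omega> i \<notin> z then if y \<in> z then 0 else f y else 0)
          \<partial>measure_pmf (walk_step V w (\<omega> m)))"
      by (simp add: walk_kernel_def le_Suc_eq all_conj_distrib cong: if_cong)
        (auto intro!: nn_integral_cong simp: le_Suc_eq)
    also have "\<dots> = (if \<forall>i\<le>m. \<omega> i \<notin> z then ?K f (\<omega> m) else 0)"
      by (rule pull_if)
    finally show ?thesis .
  qed
  have "(\<integral>\<^sup>+ \<omega>. (if \<forall>i\<le>Suc m. \<omega> i \<notin> z then f (\<omega> (Suc m)) else 0)
        \<partial>walk.C V w u 0 (Suc (Suc m)) (\<lambda>_. undefined))
      = (\<integral>\<^sup>+ \<omega>. \<integral>\<^sup>+ \<omega>'. (if \<forall>i\<le>Suc m. \<omega>' i \<notin> z then f (\<omega>' (Suc m)) else 0)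
          \<partial>walk.eP V w u (Suc m) \<omega> \<partial>walk.C V w u 0 (Suc m) (\<lambda>_. undefined))"
    using walk.measurable_eP[of V w u "Suc m"] walk.sets_C[OF un, of V w u "Suc m"]
    by (subst walk.C.simps(2), subst nn_integral_bind[where B="?M (Suc (Suc m))"])
      (use meas[of "Suc m" f] in \<open>simp_all add: measurable_cong_sets[OF walk.sets_C[OF un, of V w u "Suc m"] refl] del: walk.C.simps\<close>)
  also have "\<dots> = (\<integral>\<^sup>+ \<omega>. (if \<forall>i\<le>m. \<omega> i \<notin> z then ?K f (\<omega> m) else 0) \<partial>walk.C V w u 0 (Suc m) (\<lambda>_. undefined))"
    using walk.space_C[OF un, of V w u "Suc m"]
    by (intro nn_integral_cong inner) (simp del: walk.C.simps)
  also have "\<dots> = (if u \<in> z then 0 else (?K ^^ m) (?K f) u)"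
    by (rule Suc.IH)
  finally show ?case
    by (simp only: funpow_Suc_right o_apply)
qed

lemma ennreal_survival:
  "((\<lambda>g x. \<integral>\<^sup>+ y. (if y \<in> z then 0 else g y) \<partial>measure_pmf (K x)) ^^ m) (\<lambda>_. 1) x =
    ennreal (survival K z m x)"
proof (induction m arbitrary: x)
  case (Suc m)
  have "((\<lambda>g x. \<integral>\<^sup>+ y. (if y \<in> z then 0 else g y) \<partial>measure_pmf (K x)) ^^ Suc m) (\<lambda>_. 1) x =
      (\<integral>\<^sup>+ y. ennreal (if y \<in> z then 0 else survival K z m y) \<partial>measure_pmf (K x))"
    by (auto simp: Suc intro!: nn_integral_cong)
  also have "\<dots> = ennreal (survival K z (Suc m) x)"
    unfolding survival.simps
    by (rule nn_integral_eq_integral[OF integrable_survival]) (simp add: survival_bounds)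
  finally show ?case .
qed simp

lemma enat_less_hitting_time_iff: "enat m < hitting_time z \<omega> \<longleftrightarrow> (\<forall>i\<le>m. \<omega> i \<notin> z)"
proof
  assume *: "enat m < hitting_time z \<omega>"
  show "\<forall>i\<le>m. \<omega> i \<notin> z"
  proof (intro allI impI notI)
    fix i assume "i \<le> m" "\<omega> i \<in> z"
    then have "hitting_time z \<omega> \<le> enat i"
      unfolding hitting_time_def by (intro INF_lower) simp
    with * have "enat m < enat i" by (rule less_le_trans)
    with \<open>i \<le> m\<close> show False by simp
  qed
next
  assume *: "\<forall>i\<le>m. \<omega> i \<notin> z"
  have "enat (Suc m) \<le> hitting_time z \<omega>"
    unfolding hitting_time_def
  proof (rule INF_greatest)
    fix k assume "k \<in> {k. \<omega> k \<in> z}"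
    then have "\<not> k \<le> m" using * by auto
    then show "enat (Suc m) \<le> enat k" by simp
  qed
  then show "enat m < hitting_time z \<omega>"
    by (metis Suc_ile_eq)
qed

lemma space_walk_law: "space (walk_law V w u) = UNIV"
  by (simp add: walk_law_def space_PiM)

lemma sets_walk_law: "sets (walk_law V w u) = sets (Pi\<^sub>M UNIV (\<lambda>_. count_space UNIV))"
  by (simp add: walk_law_def)

lemma prob_hitting_time_gt:
  "emeasure (walk_law V w u) {\<omega> \<in> space (walk_law V w u). enat m < hitting_time z \<omega>} =
    (if u \<in> z then 0 else ennreal (survival (walk_step V w) z m u))"
proof -
  let ?M = "Pi\<^sub>M {0..<Suc m} (\<lambda>_. count_space (UNIV::'a set))"
  let ?X = "{\<omega> \<in> space ?M. \<forall>i\<le>m. \<omega> i \<notin> z}"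
  have X: "?X \<in> sets ?M"
    by (rule avoid_sets) auto
  have un: "(\<lambda>_. undefined) \<in> space (Pi\<^sub>M {0..<0::nat} (\<lambda>_. count_space (UNIV::'a set)))"
    by (simp add: space_PiM)
  have "{\<omega> \<in> space (walk_law V w u). enat m < hitting_time z \<omega>} =
      prod_emb UNIV (\<lambda>_. count_space UNIV) {0..<Suc m} ?X"
    by (auto simp: prod_emb_def space_walk_law enat_less_hitting_time_iff space_PiM)
  then have "emeasure (walk_law V w u) {\<omega> \<in> space (walk_law V w u). enat m < hitting_time z \<omega>}
      = emeasure (walk.CI V w u {0..<Suc m}) ?X"
    unfolding walk_law_def using X by (simp only: walk.lim finite_atLeastLessThan)
  also have "\<dots> = emeasure (walk.C V w u 0 (Suc m) (\<lambda>_. undefined)) ?X"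
    using walk.emeasure_CI[OF order_refl X, of V w u] sets.sets_into_space[OF X]
    by (simp add: prod_emb_id space_PiM del: walk.C.simps)
  also have "\<dots> = (\<integral>\<^sup>+ \<omega>. (if \<forall>i\<le>m. \<omega> i \<notin> z then 1 else 0) \<partial>walk.C V w u 0 (Suc m) (\<lambda>_. undefined))"
  proof -
    let ?C = "walk.C V w u 0 (Suc m) (\<lambda>_. undefined)"
    have "?X \<in> sets ?C"
      using X walk.sets_C[OF un, of V w u "Suc m"] by (simp only: add_0)
    then have "emeasure ?C ?X = (\<integral>\<^sup>+ \<omega>. indicator ?X \<omega> \<partial>?C)"
      by (rule nn_integral_indicator[symmetric])
    also have "\<dots> = (\<integral>\<^sup>+ \<omega>. (if \<forall>i\<le>m. \<omega> i \<notin> z then 1 else 0) \<partial>?C)"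
    proof (rule nn_integral_cong)
      fix \<omega> assume "\<omega> \<in> space ?C"
      then have "\<omega> \<in> space ?M"
        using walk.space_C[OF un, of V w u "Suc m"] by (simp only: add_0)
      then show "indicator ?X \<omega> = (if \<forall>i\<le>m. \<omega> i \<notin> z then 1 else 0 :: ennreal)"
        by (simp add: indicator_def)
    qed
    finally show ?thesis .
  qed
  also have "\<dots> = (if u \<in> z then 0 else ennreal (survival (walk_step V w) z m u))"
    using nn_integral_avoiding_path[where m=m and z=z and f="\<lambda>_. 1" and V=V and w=w and u=u] by (simp add: ennreal_survival)
  finally show ?thesis .
qed

lemma hitting_time_gt_sets:
  "{\<omega> \<in> space (walk_law V w u). enat m < hitting_time z \<omega>} \<in> sets (walk_law V w u)"
  using avoid_sets[where m=m and J=UNIV and z=z] unfolding sets_walk_law enat_less_hitting_time_iff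
  by (simp add: space_walk_law space_PiM)

text \<open>The value of the hitting time is determined by the countably many events \<open>T > m\<close>.\<close>

lemma measurable_hitting_time: "hitting_time z \<in> measurable (walk_law V w u) (count_space UNIV)"
proof -
  have "{\<omega> \<in> space (walk_law V w u). enat m < hitting_time z \<omega>} \<in> sets (walk_law V w u)" for m
    by (rule hitting_time_gt_sets)
  then have *: "(if enat m < a then {\<omega> \<in> space (walk_law V w u). enat m < hitting_time z \<omega>}
      else space (walk_law V w u) - {\<omega> \<in> space (walk_law V w u). enat m < hitting_time z \<omega>})
      \<in> sets (walk_law V w u)" (is "?D m a \<in> _") for m a
    by auto
  have le: "a \<le> b" if "\<And>m. enat m < b \<longleftrightarrow> enat m < a" for a b :: enat
    using that by (cases b) (auto simp: not_less[symmetric])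
  have eqI: "b = a" if "\<And>m. enat m < b \<longleftrightarrow> enat m < a" for a b :: enat
    using le[of a b] le[of b a] that by (intro antisym) blast+
  have "hitting_time z -` {a} \<inter> space (walk_law V w u) \<in> sets (walk_law V w u)" for a
  proof -
    have "hitting_time z -` {a} \<inter> space (walk_law V w u) = (\<Inter>m\<in>UNIV. ?D m a)"
    proof -
      have "\<omega> \<in> ?D m a \<longleftrightarrow>
          \<omega> \<in> space (walk_law V w u) \<and> (enat m < hitting_time z \<omega> \<longleftrightarrow> enat m < a)" for \<omega> m
        by auto
      note D = this
      show ?thesis
      proof (intro set_eqI iffI)
        fix \<omega> assume "\<omega> \<in> hitting_time z -` {a} \<inter> space (walk_law V w u)"
        then have "\<omega> \<in> space (walk_law V w u)" "hitting_time z \<omega> = a" by simp_all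
        then show "\<omega> \<in> (\<Inter>m\<in>UNIV. ?D m a)" unfolding INT_iff D by simp
      next
        fix \<omega> assume "\<omega> \<in> (\<Inter>m\<in>UNIV. ?D m a)"
        then have "\<omega> \<in> space (walk_law V w u)" "hitting_time z \<omega> = a"
          unfolding INT_iff D by (simp_all add: eqI)
        then show "\<omega> \<in> hitting_time z -` {a} \<inter> space (walk_law V w u)" by simp
      qed
    qed
    also have "\<dots> \<in> sets (walk_law V w u)"
      by (rule sets.countable_INT) (rule image_subsetI, rule *, simp)
    finally show ?thesis .
  qed
  then show ?thesis
    by (subst measurable_count_space_eq2_countable) simp_all
qed

text \<open>With an empty target the survival probabilities are all \<open>1\<close>, which gives the total mass.\<close>

lemma prob_space_walk_law: "prob_space (walk_law V w u)"
proof
  have "survival (walk_step V w) {} m x = 1" for m x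
    by (induction m arbitrary: x) simp_all
  moreover have "hitting_time {} \<omega> = \<infinity>" for \<omega> :: "nat \<Rightarrow> 'a"
    by (simp add: hitting_time_def top_enat_def)
  ultimately show "emeasure (walk_law V w u) (space (walk_law V w u)) = 1"
    using prob_hitting_time_gt[of V w u 0 "{}"] by simp
qed

lemma mean_hitting_time_eq:
  "mean_hitting_time V w u z =
    (if u \<in> z then 0 else (\<Sum>m. ennreal (survival (walk_step V w) z m u)))"
  unfolding mean_hitting_time_def nn_integral_enat_function[OF measurable_hitting_time]
    prob_hitting_time_gt
  by (cases "u \<in> z") (simp_all only: if_True if_False suminf_zero)

lemma prob_hit_by_eq:
  assumes "0 \<le> t"
  shows "prob_hit_by t V w u z =
    (if u \<in> z then 1 else ennreal (1 - survival (walk_step V w) z (nat \<lfloor>t\<rfloor>) u))"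
proof -
  interpret prob_space "walk_law V w u"
    by (rule prob_space_walk_law)
  let ?m = "nat \<lfloor>t\<rfloor>"
  have "ennreal_of_enat (hitting_time z \<omega>) \<le> ennreal t \<longleftrightarrow> \<not> enat ?m < hitting_time z \<omega>" for \<omega>
  proof (cases "hitting_time z \<omega>")
    case (enat k)
    then show ?thesis
      using assms by (simp add: ennreal_of_nat_eq_real_of_nat le_nat_floor) linarith
  qed (simp add: top_unique)
  then have "{\<omega> \<in> space (walk_law V w u). ennreal_of_enat (hitting_time z \<omega>) \<le> ennreal t} =
      space (walk_law V w u) - {\<omega> \<in> space (walk_law V w u). enat ?m < hitting_time z \<omega>}"
    by auto
  moreover have "{\<omega> \<in> space (walk_law V w u). enat ?m < hitting_time z \<omega>} \<in> sets (walk_law V w u)"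
    by (rule hitting_time_gt_sets)
  ultimately have "prob_hit_by t V w u z = 1 - (if u \<in> z then 0 else ennreal (survival (walk_step V w) z ?m u))"
    unfolding prob_hit_by_def by (simp add: emeasure_compl emeasure_space_1 prob_hitting_time_gt del: not_less)
  then show ?thesis
    using survival_bounds[of "walk_step V w" z ?m u] by (simp add: ennreal_minus[symmetric])
qed

section \<open>Convex inequalities for a single edge\<close>

text \<open>The right side is a convex function of \<open>(\<sigma>, d)\<close>, stationary at \<open>(\<sigma>0, d0)\<close>, where its last term vanishes
  by the choice of \<open>s\<close>.  For an edge, \<open>\<sigma>\<close> and \<open>d\<close> will be half the sum and half the difference of
  \<open>ln (v(x)/v(y))\<close> and \<open>ln (h(y)/h(x))\<close>.  Rather than a Hessian, the proof minimises over \<open>d\<close> first: the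
  minimiser \<open>D\<close> satisfies \<open>sinh D = r sinh \<sigma>\<close>, and the minimum \<open>f\<close> is a function of \<open>\<sigma>\<close> alone.\<close>

lemma tilted_tangent:
  fixes \<sigma>0 d0 \<sigma> d :: real
  defines "s \<equiv> cosh d0 / cosh \<sigma>0" and "r \<equiv> sinh d0 / sinh \<sigma>0"
  assumes "0 < d0" "d0 < \<sigma>0" "0 < \<sigma>"
  shows "s * \<sigma>0 - r * d0 \<le> s * \<sigma> - r * d + (cosh d - s * cosh \<sigma>) / sinh \<sigma>"
proof -
  define D where "D t = arsinh (r * sinh t)" for t :: real
  define f where "f t = s * t - r * D t + (cosh (D t) - s * cosh t) / sinh t" for t :: real
  have pos: "0 < sinh d0" "0 < sinh \<sigma>0" "0 < sinh \<sigma>"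
    using assms by auto
  have r: "0 < r" unfolding r_def using pos by simp
  have s: "0 < s" unfolding s_def by (simp add: cosh_real_pos)
  have sinhD: "sinh (D t) = r * sinh t" for t
    by (simp add: D_def)
  have coshD2: "(cosh (D t))\<^sup>2 = 1 + (r * sinh t)\<^sup>2" for t
    using cosh_square_eq[of "D t"] by (simp add: sinhD)
  have tangent: "cosh y + sinh y * (x - y) \<le> cosh x" for x y :: real
  proof -
    have "exp y * (x - y + 1) \<le> exp x"
      using mult_left_mono[OF exp_ge_add_one_self[of "x - y"], of "exp y"]
      by (simp add: mult_exp_exp add.commute)
    moreover have "exp (-y) * (y - x + 1) \<le> exp (-x)"
      using mult_left_mono[OF exp_ge_add_one_self[of "y - x"], of "exp (-y)"]
      by (simp add: mult_exp_exp add.commute)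
    ultimately show ?thesis
      by (simp add: cosh_def sinh_def field_simps)
  qed
  have "f \<sigma> \<le> s * \<sigma> - r * d + (cosh d - s * cosh \<sigma>) / sinh \<sigma>"
  proof -
    have "(cosh (D \<sigma>) + r * sinh \<sigma> * (d - D \<sigma>) - s * cosh \<sigma>) / sinh \<sigma> \<le> (cosh d - s * cosh \<sigma>) / sinh \<sigma>"
      using tangent[of "D \<sigma>" d] pos by (intro divide_right_mono) (auto simp: sinhD)
    then show ?thesis
      using pos by (simp add: f_def field_simps)
  qed
  moreover have D0: "D \<sigma>0 = d0"
    using pos by (simp add: D_def r_def arsinh_sinh_real)
  have f0: "f \<sigma>0 = s * \<sigma>0 - r * d0"
    using pos by (simp add: f_def D0) (simp add: s_def)
  \<comment> \<open>By the choice of \<open>D\<close> the terms with \<open>D'\<close> cancel.\<close>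
  have deriv: "(f has_real_derivative (cosh t * (s * cosh t - cosh (D t)) / (sinh t)\<^sup>2)) (at t)"
    if "0 < t" for t
  proof -
    have st: "0 < sinh t" using that by simp
    have cD: "0 < cosh (D t)" by (rule cosh_real_pos)
    have dD: "(D has_real_derivative (r * cosh t / cosh (D t))) (at t)"
    proof -
      have inner: "((\<lambda>t. r * sinh t) has_real_derivative r * cosh t) (at t)"
        by (auto intro!: derivative_eq_intros)
      have "sqrt ((r * sinh t)\<^sup>2 + 1) = cosh (D t)"
        using coshD2[of t] cD by (intro real_sqrt_unique) auto
      then show ?thesis
        using DERIV_chain2[OF arsinh_real_has_field_derivative inner]
        unfolding D_def[abs_def] by simp
    qed
    show ?thesis
      unfolding f_def[abs_def]
      using st cD
      apply (auto intro!: derivative_eq_intros dD)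
      apply (simp add: sinhD)
      apply (simp add: field_simps power2_eq_square)
      done
  qed
  have r_le_s: "r \<le> s"
  proof -
    have "0 \<le> sinh (\<sigma>0 - d0)" using assms by simp
    then show ?thesis
      using pos by (simp add: sinh_diff r_def s_def field_simps cosh_real_pos)
  qed
  \<comment> \<open>The sign of \<open>f'\<close> is that of this difference of squares, which vanishes at \<open>\<sigma>0\<close>.\<close>
  have sq: "(s * cosh t)\<^sup>2 - (cosh (D t))\<^sup>2 = (s\<^sup>2 - r\<^sup>2) * ((cosh t)\<^sup>2 - (cosh \<sigma>0)\<^sup>2)" for t
  proof -
    have "(s * cosh \<sigma>0)\<^sup>2 = 1 + (r * sinh \<sigma>0)\<^sup>2"
      using pos cosh_square_eq[of d0] by (simp add: s_def r_def)
    then have "s\<^sup>2 * (cosh \<sigma>0)\<^sup>2 = 1 + r\<^sup>2 * ((cosh \<sigma>0)\<^sup>2 - 1)"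
      by (simp only: power_mult_distrib sinh_square_eq)
    moreover have "s\<^sup>2 * (cosh t)\<^sup>2 - (1 + r\<^sup>2 * ((cosh t)\<^sup>2 - 1)) =
        (s\<^sup>2 - r\<^sup>2) * ((cosh t)\<^sup>2 - (cosh \<sigma>0)\<^sup>2) +
        (s\<^sup>2 * (cosh \<sigma>0)\<^sup>2 - (1 + r\<^sup>2 * ((cosh \<sigma>0)\<^sup>2 - 1)))"
      by algebra
    ultimately show ?thesis
      unfolding coshD2 power_mult_distrib sinh_square_eq by simp
  qed
  have rs2: "0 \<le> s\<^sup>2 - r\<^sup>2" using r r_le_s by (simp add: power_mono)
  have "f \<sigma>0 \<le> f \<sigma>"
  proof (cases "\<sigma> \<le> \<sigma>0")
    case True
    show ?thesis
    proof (rule DERIV_nonpos_imp_nonincreasing[where f=f, OF True])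
      fix t assume t: "\<sigma> \<le> t" "t \<le> \<sigma>0"
      then have "0 < t" "cosh t \<le> cosh \<sigma>0" using assms by (auto simp: cosh_real_nonneg_le_iff)
      then have "(cosh t)\<^sup>2 - (cosh \<sigma>0)\<^sup>2 \<le> 0" by (simp add: power_mono)
      then have "(s * cosh t)\<^sup>2 - (cosh (D t))\<^sup>2 \<le> 0"
        unfolding sq using rs2 by (rule mult_nonneg_nonpos[rotated])
      then have "s * cosh t \<le> cosh (D t)"
        unfolding diff_le_0_iff_le by (rule power2_le_imp_le) (rule cosh_real_nonneg)
      then have "cosh t * (s * cosh t - cosh (D t)) / (sinh t)\<^sup>2 \<le> 0"
        by (intro divide_nonpos_nonneg mult_nonneg_nonpos) auto
      with deriv[OF \<open>0 < t\<close>] show "\<exists>y. (f has_real_derivative y) (at t) \<and> y \<le> 0" by blast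
    qed
  next
    case False
    show ?thesis
    proof (rule DERIV_nonneg_imp_nondecreasing[where f=f])
      show "\<sigma>0 \<le> \<sigma>" using False by simp
      fix t assume t: "\<sigma>0 \<le> t" "t \<le> \<sigma>"
      then have "0 < t" "cosh \<sigma>0 \<le> cosh t" using assms by (auto simp: cosh_real_nonneg_le_iff)
      then have "0 \<le> (cosh t)\<^sup>2 - (cosh \<sigma>0)\<^sup>2" by (simp add: power_mono)
      then have "0 \<le> (s * cosh t)\<^sup>2 - (cosh (D t))\<^sup>2"
        unfolding sq using rs2 by simp
      then have "cosh (D t) \<le> s * cosh t"
        unfolding diff_ge_0_iff_ge
        by (rule power2_le_imp_le) (intro mult_nonneg_nonneg cosh_real_nonneg less_imp_le[OF s])
      then have "0 \<le> cosh t * (s * cosh t - cosh (D t)) / (sinh t)\<^sup>2"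
        by (intro divide_nonneg_nonneg mult_nonneg_nonneg) auto
      with deriv[OF \<open>0 < t\<close>] show "\<exists>y. (f has_real_derivative y) (at t) \<and> y \<ge> 0" by blast
    qed
  qed
  ultimately show ?thesis using f0 by simp
qed

lemma sinh_cosh_half_ln:
  fixes A B :: real
  assumes "0 < A" "0 < B"
  shows "sinh (ln (A / B) / 2) = (A - B) / (2 * sqrt (A * B))"
    and "cosh (ln (A / B) / 2) = (A + B) / (2 * sqrt (A * B))"
proof -
  have e: "exp (ln (A / B) / 2) = sqrt A / sqrt B"
    using assms by (simp add: ln_sqrt[symmetric] real_sqrt_divide)
  have sq: "sqrt A * sqrt A = A" "sqrt B * sqrt B = B" using assms by auto
  have pos: "0 < sqrt A" "0 < sqrt B" using assms by auto
  have "sinh (ln (A / B) / 2) = (sqrt A / sqrt B - sqrt B / sqrt A) / 2"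
    using e by (simp add: sinh_def exp_minus)
  also have "\<dots> = (sqrt A * sqrt A - sqrt B * sqrt B) / (2 * (sqrt A * sqrt B))"
    using pos by (simp add: field_simps)
  finally show "sinh (ln (A / B) / 2) = (A - B) / (2 * sqrt (A * B))"
    unfolding sq by (simp only: real_sqrt_mult)
  have "cosh (ln (A / B) / 2) = (sqrt A / sqrt B + sqrt B / sqrt A) / 2"
    using e by (simp add: cosh_def exp_minus)
  also have "\<dots> = (sqrt A * sqrt A + sqrt B * sqrt B) / (2 * (sqrt A * sqrt B))"
    using pos by (simp add: field_simps)
  finally show "cosh (ln (A / B) / 2) = (A + B) / (2 * sqrt (A * B))"
    unfolding sq by (simp only: real_sqrt_mult)
qed

text \<open>If the walk on the integers with odds \<open>g\<close> is weighted by \<open>s\<^sup>T\<close>, where \<open>T\<close> hits a point to the right, the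
  result is the walk with some larger odds \<open>G\<close>.  This is the value of \<open>s\<close> that belongs to \<open>G\<close>; at
  this \<open>s\<close> the generating function of the passage time to the right neighbour is \<open>(g/G)\<^bsup>1/2\<^esup>\<close>.\<close>

definition tilt_factor :: "real \<Rightarrow> real \<Rightarrow> real" where
  "tilt_factor g G = cosh (ln g / 2) / cosh (ln G / 2)"

text \<open>The second coefficient of the supporting plane in \<open>tilted_tangent\<close>; the first one is \<open>tilt_factor\<close>.\<close>

definition tilt_skew :: "real \<Rightarrow> real \<Rightarrow> real" where
  "tilt_skew g G = sinh (ln g / 2) / sinh (ln G / 2)"

lemma tilt_factor_pos: "0 < tilt_factor g G"
  by (simp add: tilt_factor_def cosh_real_pos)

lemma tilt_factor_less: "1 < g \<Longrightarrow> g \<le> G1 \<Longrightarrow> G1 < G2 \<Longrightarrow> tilt_factor g G2 < tilt_factor g G1"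
  unfolding tilt_factor_def
  using cosh_real_nonneg_less_iff[of "ln G1 / 2" "ln G2 / 2"]
  by (intro divide_strict_left_mono) (auto simp: cosh_real_pos)

lemma tilt_factor_less_1: "1 < g \<Longrightarrow> g < G \<Longrightarrow> tilt_factor g G < 1"
  using tilt_factor_less[of g g G] by (simp add: tilt_factor_def cosh_real_pos less_imp_neq[symmetric])

lemma tilt_skew_pos: "1 < g \<Longrightarrow> g < G \<Longrightarrow> 0 < tilt_skew g G"
  by (simp add: tilt_skew_def)

lemma tilt_skew_le_factor:
  assumes "1 < g" "g < G"
  shows "tilt_skew g G \<le> tilt_factor g G"
proof -
  have "0 \<le> sinh (ln G / 2 - ln g / 2)" using assms by simp
  then have "cosh (ln G / 2) * sinh (ln g / 2) \<le> cosh (ln g / 2) * sinh (ln G / 2)"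
    unfolding sinh_diff by (simp add: mult.commute)
  then show ?thesis
    using assms by (simp add: tilt_skew_def tilt_factor_def field_simps cosh_real_pos)
qed

text \<open>The tangent inequality in the variables of an edge \<open>(x, y)\<close> with \<open>vx = v(x)\<close> and so on.  Multiplied by
  \<open>s w(x,y) / h(u)\<close>, the factor \<open>vx * hy - vy * hx\<close> becomes the flow through the edge.\<close>

lemma tilted_pair_inequality:
  fixes g G vx vy hx hy :: real
  assumes "1 < g" "g < G" and pos: "0 < vx" "0 < vy" "0 < hx" "0 < hy"
  defines "s \<equiv> tilt_factor g G" and "r \<equiv> tilt_skew g G"
  shows "(s * ln G - r * ln g) / 2 * \<bar>vx * hy - vy * hx\<bar> \<le>
    (vx * hy - vy * hx) * ((s + r) / 2 * (ln hy - ln hx) + (s - r) / 2 * (ln vx - ln vy)) +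
    (vx * hx + vy * hy - s * (vx * hy + vy * hx))"
proof -
  have g: "0 < ln g / 2" "ln g / 2 < ln G / 2" using assms by auto
  have s1: "s \<le> 1"
    unfolding s_def using tilt_factor_less_1[OF assms(1,2)] by simp
  \<comment> \<open>Exchanging the endpoints preserves the statement, so the flow may be taken positive.\<close>
  have main: "(s * ln G - r * ln g) / 2 * (vx * hy - vy * hx) \<le>
    (vx * hy - vy * hx) * ((s + r) / 2 * (ln hy - ln hx) + (s - r) / 2 * (ln vx - ln vy)) +
    (vx * hx + vy * hy - s * (vx * hy + vy * hx))"
    if pos: "0 < vx" "0 < vy" "0 < hx" "0 < hy" and gt: "vy * hx < vx * hy" for vx vy hx hy :: real
  proof -
    define \<sigma> where "\<sigma> = ln ((vx * hy) / (vy * hx)) / 2"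
    define d where "d = ln ((vx * hx) / (vy * hy)) / 2"
    define Q where "Q = 2 * sqrt (vx * vy * hx * hy)"
    have Q: "0 < Q" using pos by (simp add: Q_def)
    have A: "sinh \<sigma> = (vx * hy - vy * hx) / Q" "cosh \<sigma> = (vx * hy + vy * hx) / Q"
      "cosh d = (vx * hx + vy * hy) / Q"
      unfolding \<sigma>_def d_def Q_def using pos by (simp_all add: sinh_cosh_half_ln mult_ac)
    have lns: "\<sigma> - d = ln hy - ln hx" "\<sigma> + d = ln vx - ln vy"
      unfolding \<sigma>_def d_def using pos by (simp_all add: ln_div ln_mult field_simps)
    have \<sigma>: "0 < \<sigma>"
      unfolding \<sigma>_def using gt pos by simp
    have "s * (ln G / 2) - r * (ln g / 2) \<le> s * \<sigma> - r * d + (cosh d - s * cosh \<sigma>) / sinh \<sigma>"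
      unfolding s_def r_def tilt_factor_def tilt_skew_def by (rule tilted_tangent[OF g \<sigma>])
    also have "(cosh d - s * cosh \<sigma>) / sinh \<sigma> =
        (vx * hx + vy * hy - s * (vx * hy + vy * hx)) / (vx * hy - vy * hx)"
    proof -
      have "(X / Q - s * (Y / Q)) / (Z / Q) = (X - s * Y) / Z" for X Y Z
        using Q by (simp add: diff_divide_distrib[symmetric])
      then show ?thesis unfolding A .
    qed
    also have "s * \<sigma> - r * d = (s + r) / 2 * (\<sigma> - d) + (s - r) / 2 * (\<sigma> + d)"
      by (simp add: field_simps)
    finally have "(s * (ln G / 2) - r * (ln g / 2)) * (vx * hy - vy * hx) \<le>
       ((s + r) / 2 * (ln hy - ln hx) + (s - r) / 2 * (ln vx - ln vy) +
        (vx * hx + vy * hy - s * (vx * hy + vy * hx)) / (vx * hy - vy * hx)) * (vx * hy - vy * hx)"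
      unfolding lns using gt by (intro mult_right_mono) auto
    also have "\<dots> = (vx * hy - vy * hx) * ((s + r) / 2 * (ln hy - ln hx) + (s - r) / 2 * (ln vx - ln vy)) +
        (vx * hx + vy * hy - s * (vx * hy + vy * hx))"
    proof -
      have "(Y + X / Z) * Z = Z * Y + X" if "Z \<noteq> 0" for X Y Z :: real
        using that by (simp add: distrib_right)
      then show ?thesis using gt by simp
    qed
    finally show ?thesis by (simp add: diff_divide_distrib)
  qed
  consider "vy * hx < vx * hy" | "vx * hy < vy * hx" | "vx * hy = vy * hx" by linarith
  then show ?thesis
  proof cases
    case 1
    with main[OF pos] show ?thesis by simp
  next
    case 2
    with main[of vy vx hy hx] pos show ?thesis by (simp add: algebra_simps)
  next
    case 3
    \<comment> \<open>Without flow \<open>v\<close> and \<open>h\<close> are proportional on the edge, hence ordered alike.\<close>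
    have "0 \<le> (vx - vy) * (hx - hy)"
    proof -
      have "(vx - vy) * (hx - hy) * (vy * hy) = (vy * hx - vy * hy) * (vx * hy - vy * hy)"
        by (simp add: algebra_simps)
      also have "\<dots> = (vx * hy - vy * hy)\<^sup>2" using 3 by (simp add: power2_eq_square)
      finally have "0 \<le> (vx - vy) * (hx - hy) * (vy * hy)" by simp
      moreover have "0 < vy * hy" using pos by simp
      ultimately show ?thesis by (metis mult_le_cancel_right_pos mult_zero_left)
    qed
    then have "vx * hy + vy * hx \<le> vx * hx + vy * hy" by (simp add: algebra_simps)
    moreover have "s * (vx * hy + vy * hx) \<le> 1 * (vx * hy + vy * hx)"
      using s1 pos by (intro mult_right_mono) auto
    ultimately show ?thesis using 3 by simp
  qed
qed

text \<open>The function \<open>(t+1)/(t-1)\<close> is convex in \<open>ln t\<close>; this is its tangent at \<open>t = g\<close>, where its value \<open>m\<^sub>g\<close>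
  is the mean time in which the biased walk passes to the right neighbour.\<close>

lemma coth_tangent:
  fixes g t :: real
  assumes "1 < g" "1 < t"
  defines "\<kappa> \<equiv> 2 * g / (g - 1)\<^sup>2"
  shows "(g + 1) / (g - 1) + \<kappa> * ln g \<le> (t + 1) / (t - 1) + \<kappa> * ln t"
proof -
  define k where "k t = (t + 1) / (t - 1) + \<kappa> * ln t" for t :: real
  have deriv: "(k has_real_derivative (2 * (t - g) * (g * t - 1) / (t * (t - 1)\<^sup>2 * (g - 1)\<^sup>2))) (at t)"
    if "1 < t" for t
  proof -
    have 1: "(k has_real_derivative (\<kappa> / t - 2 / (t - 1)\<^sup>2)) (at t)"
      unfolding k_def[abs_def] using that
      by (auto intro!: derivative_eq_intros simp: power2_eq_square field_simps)
    have 2: "\<kappa> / t - 2 / (t - 1)\<^sup>2 = 2 * (t - g) * (g * t - 1) / (t * (t - 1)\<^sup>2 * (g - 1)\<^sup>2)"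
    proof -
      have "t \<noteq> 0" "t - 1 \<noteq> 0" "g - 1 \<noteq> 0" using that assms by auto
      then show ?thesis
        unfolding \<kappa>_def by (simp add: divide_simps) (simp add: power2_eq_square algebra_simps)
    qed
    show ?thesis using 1 unfolding 2 .
  qed
  have "k g \<le> k t"
  proof (cases "t \<le> g")
    case True
    have "k g \<le> k t"
    proof (rule DERIV_nonpos_imp_nonincreasing[where f=k, OF True])
      fix x assume x: "t \<le> x" "x \<le> g"
      then have "1 < x" "x - g \<le> 0" using assms by auto
      moreover have "0 \<le> g * x - 1" using assms \<open>1 < x\<close> mult_mono[of 1 g 1 x] by auto
      ultimately have "2 * (x - g) * (g * x - 1) / (x * (x - 1)\<^sup>2 * (g - 1)\<^sup>2) \<le> 0"
        using \<open>1 < x\<close> by (intro divide_nonpos_nonneg mult_nonpos_nonneg[of "2 * (x - g)"]) auto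
      with deriv[OF \<open>1 < x\<close>] show "\<exists>y. (k has_real_derivative y) (at x) \<and> y \<le> 0" by blast
    qed
    then show ?thesis .
  next
    case False
    show ?thesis
    proof (rule DERIV_nonneg_imp_nondecreasing[where f=k])
      show "g \<le> t" using False by simp
      fix x assume x: "g \<le> x" "x \<le> t"
      then have "0 \<le> g * x - 1" "0 \<le> x - g" "1 < x" using assms mult_mono[of 1 g 1 x] by auto
      then have "2 * (x - g) * (g * x - 1) / (x * (x - 1)\<^sup>2 * (g - 1)\<^sup>2) \<ge> 0"
        by (intro divide_nonneg_nonneg mult_nonneg_nonneg) auto
      with deriv[OF \<open>1 < x\<close>] show "\<exists>y. (k has_real_derivative y) (at x) \<and> y \<ge> 0" by blast
    qed
  qed
  then show ?thesis by (simp add: k_def)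
qed

lemma coth_pair_inequality:
  fixes g a b :: real
  assumes "1 < g" "0 < a" "0 < b"
  defines "\<kappa> \<equiv> 2 * g / (g - 1)\<^sup>2"
  shows "((g + 1) / (g - 1) + \<kappa> * ln g) * \<bar>a - b\<bar> \<le> a + b + \<kappa> * ((a - b) * (ln a - ln b))"
proof -
  have main: "((g + 1) / (g - 1) + \<kappa> * ln g) * (a - b) \<le> a + b + \<kappa> * ((a - b) * (ln a - ln b))"
    if "0 < b" "b < a" for a b
  proof -
    have "(g + 1) / (g - 1) + \<kappa> * ln g \<le> (a / b + 1) / (a / b - 1) + \<kappa> * ln (a / b)"
      unfolding \<kappa>_def using that \<open>1 < g\<close> by (intro coth_tangent) auto
    also have "(a / b + 1) / (a / b - 1) = (a + b) / (a - b)"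
      using that by (simp add: field_simps)
    finally have "((g + 1) / (g - 1) + \<kappa> * ln g) * (a - b) \<le> ((a + b) / (a - b) + \<kappa> * ln (a / b)) * (a - b)"
      using that by (intro mult_right_mono) auto
    also have "\<dots> = a + b + \<kappa> * ((a - b) * (ln a - ln b))"
    proof -
      have "(X / Z + Y) * Z = X + Y * Z" if "Z \<noteq> 0" for X Y Z :: real
        using that by (simp add: distrib_right)
      from this[of "a - b" "a + b"] show ?thesis
        using that by (simp add: ln_div)
    qed
    finally show ?thesis .
  qed
  consider "b < a" | "a < b" | "a = b" by linarith
  then show ?thesis
  proof cases
    case 1 with main[of b a] assms show ?thesis by simp
  next
    case 2 with main[of a b] assms show ?thesis by (simp add: algebra_simps)
  next
    case 3 with assms show ?thesis by simp
  qed
qed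

text \<open>The inequality for \<open>s\<close> near \<open>1\<close>.  For the extremal walk both sides are of order \<open>1 - s\<close> and agree to
  first order.  The proof uses \<open>1 - 1/t \<le> ln t \<le> t - 1\<close> for \<open>t = hy / hx\<close>, the lower bound in the term
  with \<open>vx * hy\<close> and the upper one in the term with \<open>vy * hx\<close>.\<close>

lemma untilted_pair_inequality:
  fixes vx vy hx hy s :: real
  assumes pos: "0 < vx" "0 < vy" "0 < hx" "0 < hy"
  shows "(1 - s) * (vx * hy + vy * hx) \<le>
    (vx * hy - vy * hx) * (ln hy - ln hx) + (vx * hx + vy * hy - s * (vx * hy + vy * hx))"
proof -
  have "vx * (hy - hx) \<le> vx * hy * (ln hy - ln hx)"
  proof -
    have "ln (hx / hy) \<le> hx / hy - 1" using pos by (intro ln_le_minus_one) auto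
    then have "hy * (1 - hx / hy) \<le> hy * (ln hy - ln hx)"
      using pos by (intro mult_left_mono) (auto simp: ln_div)
    also have "hy * (1 - hx / hy) = hy - hx" using pos by (simp add: field_simps)
    finally show ?thesis using pos by (simp add: mult.assoc)
  qed
  moreover have "vy * hx * (ln hy - ln hx) \<le> vy * (hy - hx)"
  proof -
    have "ln (hy / hx) \<le> hy / hx - 1" using pos by (intro ln_le_minus_one) auto
    then have "hx * (ln hy - ln hx) \<le> hx * (hy / hx - 1)"
      using pos by (intro mult_left_mono) (auto simp: ln_div)
    also have "hx * (hy / hx - 1) = hy - hx" using pos by (simp add: field_simps)
    finally show ?thesis using pos by (simp add: mult.assoc)
  qed
  ultimately show ?thesis by (simp add: algebra_simps)
qed

section \<open>Unit flows in finite killed networks\<close>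

text \<open>The discounted walk on a finite set \<open>F\<close>: it exits from \<open>x\<close> into the target with weight \<open>b x\<close>, and is lost
  with the remaining weight \<open>tot x - \<Sum>\<^sub>y w x y - b x\<close>.  The function \<open>h\<close> is the expectation of
  \<open>s\<^sup>T\<close> on the event of an exit, and \<open>v\<close> the discounted Green function of \<open>u\<close> divided by \<open>tot\<close>.\<close>

locale killed_network =
  fixes F :: "'v set" and w :: "'v \<Rightarrow> 'v \<Rightarrow> real" and tot b :: "'v \<Rightarrow> real"
    and s :: real and u :: 'v and h v :: "'v \<Rightarrow> real"
  assumes finite_F: "finite F" and u_in: "u \<in> F"
    and w_nonneg: "\<And>x y. x \<in> F \<Longrightarrow> y \<in> F \<Longrightarrow> 0 \<le> w x y"
    and w_sym: "\<And>x y. x \<in> F \<Longrightarrow> y \<in> F \<Longrightarrow> w x y = w y x"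
    and b_nonneg: "\<And>x. x \<in> F \<Longrightarrow> 0 \<le> b x"
    and tot_pos: "\<And>x. x \<in> F \<Longrightarrow> 0 < tot x"
    and tot_ge: "\<And>x. x \<in> F \<Longrightarrow> (\<Sum>y\<in>F. w x y) + b x \<le> tot x"
    and s_pos: "0 < s" and s_less: "s < 1"
    and h_pos: "\<And>x. x \<in> F \<Longrightarrow> 0 < h x" and v_pos: "\<And>x. x \<in> F \<Longrightarrow> 0 < v x"
    and h_eq: "\<And>x. x \<in> F \<Longrightarrow> tot x * h x = s * ((\<Sum>y\<in>F. w x y * h y) + b x)"
    and v_eq: "\<And>x. x \<in> F \<Longrightarrow> tot x * v x = (if x = u then 1 else 0) + s * (\<Sum>y\<in>F. w x y * v y)"
begin

definition flow :: "'v \<Rightarrow> 'v \<Rightarrow> real" where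
  "flow x y = s * w x y * (v x * h y - v y * h x) / h u"

text \<open>The law of the last vertex before the exit, for the walk reweighted by \<open>s\<^sup>T\<close>.\<close>

definition exit_prob :: "'v \<Rightarrow> real" where
  "exit_prob x = s * v x * b x / h u"

text \<open>The contribution of an edge to the relation obtained by summing \<open>v\<close> times the equation of \<open>h\<close>.  For the
  biased walk on the integers it vanishes on the edges between the start and the target.\<close>

definition excess :: "'v \<Rightarrow> 'v \<Rightarrow> real" where
  "excess x y = s * w x y * (v x * h x + v y * h y - s * (v x * h y + v y * h x)) / h u"

lemma flow_antisym: "x \<in> F \<Longrightarrow> y \<in> F \<Longrightarrow> flow y x = - flow x y"
  by (simp add: flow_def w_sym[of y x] right_diff_distrib diff_divide_distrib)

lemma exit_prob_nonneg: "x \<in> F \<Longrightarrow> 0 \<le> exit_prob x"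
  unfolding exit_prob_def using s_pos v_pos[of x] b_nonneg[of x] h_pos[OF u_in] by simp

text \<open>The term \<open>tot x * v x * h x\<close> appears once with each sign and cancels, because \<open>h\<close> and \<open>v\<close> solve
  the same equation up to their sources.\<close>

lemma divergence_flow:
  assumes "x \<in> F"
  shows "(\<Sum>y\<in>F. flow x y) = (if x = u then 1 else 0) - exit_prob x"
proof -
  have hu: "h u \<noteq> 0" using h_pos[OF u_in] by simp
  have "(\<Sum>y\<in>F. flow x y) = (v x * (s * (\<Sum>y\<in>F. w x y * h y)) - h x * (s * (\<Sum>y\<in>F. w x y * v y))) / h u"
    unfolding flow_def sum_distrib_left sum_subtractf[symmetric] sum_divide_distrib
    by (intro sum.cong refl) (simp add: algebra_simps)
  also have "s * (\<Sum>y\<in>F. w x y * h y) = tot x * h x - s * b x"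
    using h_eq[OF assms] by (simp add: algebra_simps)
  also have "s * (\<Sum>y\<in>F. w x y * v y) = tot x * v x - (if x = u then 1 else 0)"
    using v_eq[OF assms] by simp
  also have "(v x * (tot x * h x - s * b x) - h x * (tot x * v x - (if x = u then 1 else 0))) / h u
      = (if x = u then 1 else 0) - exit_prob x"
    unfolding exit_prob_def using hu by (simp add: field_simps)
  finally show ?thesis .
qed

lemma flow_sum_by_parts:
  fixes f :: "'v \<Rightarrow> real"
  shows "(\<Sum>x\<in>F. \<Sum>y\<in>F. flow x y * (f y - f x)) = 2 * ((\<Sum>x\<in>F. exit_prob x * f x) - f u)"
proof -
  have "(\<Sum>x\<in>F. \<Sum>y\<in>F. flow x y * f x) = (\<Sum>x\<in>F. ((if x = u then 1 else 0) - exit_prob x) * f x)"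
    by (intro sum.cong refl) (simp add: sum_distrib_right[symmetric] divergence_flow)
  also have "\<dots> = f u - (\<Sum>x\<in>F. exit_prob x * f x)"
  proof -
    have "(\<Sum>x\<in>F. (if x = u then 1 else 0) * f x) = f u"
    proof -
      have "(\<Sum>x\<in>F. (if x = u then 1 else 0) * f x) = (\<Sum>x\<in>F. if x = u then f x else 0)"
        by (intro sum.cong) auto
      then show ?thesis using finite_F u_in by simp
    qed
    then show ?thesis
      by (simp add: left_diff_distrib sum_subtractf)
  qed
  finally have 1: "(\<Sum>x\<in>F. \<Sum>y\<in>F. flow x y * f x) = f u - (\<Sum>x\<in>F. exit_prob x * f x)" .
  have "(\<Sum>x\<in>F. \<Sum>y\<in>F. flow x y * f y) = (\<Sum>x\<in>F. \<Sum>y\<in>F. flow y x * f x)"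
    by (rule sum.swap)
  also have "\<dots> = (\<Sum>x\<in>F. \<Sum>y\<in>F. - (flow x y * f x))"
  proof (intro sum.cong refl)
    fix x y assume "x \<in> F" "y \<in> F"
    from flow_antisym[OF this] show "flow y x * f x = - (flow x y * f x)" by simp
  qed
  finally have "(\<Sum>x\<in>F. \<Sum>y\<in>F. flow x y * f y) = - (\<Sum>x\<in>F. \<Sum>y\<in>F. flow x y * f x)"
    by (simp add: sum_negf)
  with 1 show ?thesis
    by (simp add: right_diff_distrib sum_subtractf)
qed

lemma sum_exit_prob: "(\<Sum>x\<in>F. exit_prob x) = 1"
  using flow_sum_by_parts[of "\<lambda>_. 1"] by simp

text \<open>The equation of \<open>h\<close> turns the double sum into a sum over exits.  Loss of mass outside \<open>F\<close> only decreases
  it, hence the inequality.\<close>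

lemma sum_excess_le: "(\<Sum>x\<in>F. \<Sum>y\<in>F. excess x y) \<le> 2 * (\<Sum>x\<in>F. exit_prob x * (s - h x))"
proof -
  have hu: "0 < h u" using h_pos[OF u_in] .
  have swap: "(\<Sum>x\<in>F. \<Sum>y\<in>F. w x y * (a y * c x)) = (\<Sum>x\<in>F. \<Sum>y\<in>F. w x y * (a x * c y))" for a c :: "'v \<Rightarrow> real"
    by (subst sum.swap) (intro sum.cong refl, simp add: w_sym)
  have "(\<Sum>x\<in>F. \<Sum>y\<in>F. excess x y) =
      s / h u * ((\<Sum>x\<in>F. \<Sum>y\<in>F. w x y * (v x * h x)) + (\<Sum>x\<in>F. \<Sum>y\<in>F. w x y * (v y * h y))
        - s * ((\<Sum>x\<in>F. \<Sum>y\<in>F. w x y * (v x * h y)) + (\<Sum>x\<in>F. \<Sum>y\<in>F. w x y * (v y * h x))))"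
    unfolding excess_def sum_distrib_left sum.distrib[symmetric] sum_subtractf[symmetric]
    by (intro sum.cong refl) (simp add: algebra_simps diff_divide_distrib add_divide_distrib)
  also have "(\<Sum>x\<in>F. \<Sum>y\<in>F. w x y * (v y * h y)) = (\<Sum>x\<in>F. \<Sum>y\<in>F. w x y * (v x * h x))"
    by (subst sum.swap) (intro sum.cong refl, simp add: w_sym)
  also have "(\<Sum>x\<in>F. \<Sum>y\<in>F. w x y * (v y * h x)) = (\<Sum>x\<in>F. \<Sum>y\<in>F. w x y * (v x * h y))"
    by (rule swap)
  also have "s / h u * ((\<Sum>x\<in>F. \<Sum>y\<in>F. w x y * (v x * h x)) + (\<Sum>x\<in>F. \<Sum>y\<in>F. w x y * (v x * h x))
        - s * ((\<Sum>x\<in>F. \<Sum>y\<in>F. w x y * (v x * h y)) + (\<Sum>x\<in>F. \<Sum>y\<in>F. w x y * (v x * h y))))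
      = 2 * (s / h u * (\<Sum>x\<in>F. v x * ((\<Sum>y\<in>F. w x y) * h x - s * (\<Sum>y\<in>F. w x y * h y))))"
    by (simp add: sum_distrib_left sum_distrib_right sum_subtractf right_diff_distrib mult_ac)
  also have "\<dots> \<le> 2 * (s / h u * (\<Sum>x\<in>F. v x * ((tot x - b x) * h x - (tot x * h x - s * b x))))"
  proof -
    have "v x * ((\<Sum>y\<in>F. w x y) * h x - s * (\<Sum>y\<in>F. w x y * h y))
        \<le> v x * ((tot x - b x) * h x - (tot x * h x - s * b x))" if "x \<in> F" for x
    proof -
      have "(\<Sum>y\<in>F. w x y) * h x \<le> (tot x - b x) * h x"
        using tot_ge[OF that] h_pos[OF that] by (intro mult_right_mono) auto
      moreover have "s * (\<Sum>y\<in>F. w x y * h y) = tot x * h x - s * b x"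
        using h_eq[OF that] by (simp add: algebra_simps)
      ultimately show ?thesis
        using v_pos[OF that] by (intro mult_left_mono) auto
    qed
    then show ?thesis
      using s_pos hu by (intro mult_left_mono[OF sum_mono] mult_left_mono[OF mult_left_mono[OF sum_mono]]) auto
  qed
  also have "\<dots> = 2 * (\<Sum>x\<in>F. exit_prob x * (s - h x))"
    unfolding exit_prob_def sum_distrib_left
    by (intro sum.cong refl) (simp add: algebra_simps diff_divide_distrib)
  finally show ?thesis .
qed

lemma escape_weight_pos: "0 < (\<Sum>x\<in>F. b x)"
proof (rule ccontr)
  assume "\<not> 0 < (\<Sum>x\<in>F. b x)"
  then have "(\<Sum>x\<in>F. b x) = 0"
    using sum_nonneg[of F b] b_nonneg by force
  then have "\<forall>x\<in>F. b x = 0"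
    using finite_F b_nonneg by (simp add: sum_nonneg_eq_0_iff)
  then have "(\<Sum>x\<in>F. exit_prob x) = 0"
    by (simp add: exit_prob_def)
  then show False using sum_exit_prob by simp
qed

text \<open>Jensen's inequality for the concave logarithm: under \<open>exit_prob\<close> the mean of \<open>1 / v\<close> is a multiple of the
  total weight of the edges into the target.\<close>

lemma exit_entropy:
  "- (\<Sum>x\<in>F. exit_prob x * ln (v x)) \<le> ln (\<Sum>x\<in>F. b x) - ln (h u)"
proof -
  define c where "c = (\<Sum>x\<in>F. b x) / h u"
  have hu: "0 < h u" using h_pos[OF u_in] .
  have c: "0 < c" using escape_weight_pos hu by (simp add: c_def)
  have "- (\<Sum>x\<in>F. exit_prob x * ln (v x)) = (\<Sum>x\<in>F. exit_prob x * (- ln (v x)))"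
    by (simp add: sum_negf)
  also have "\<dots> \<le> (\<Sum>x\<in>F. exit_prob x * (ln c + 1 / (v x * c) - 1))"
  proof (intro sum_mono mult_left_mono exit_prob_nonneg)
    fix x assume x: "x \<in> F"
    have "ln (1 / (v x * c)) \<le> 1 / (v x * c) - 1"
      using v_pos[OF x] c by (intro ln_le_minus_one) auto
    moreover have "ln (1 / (v x * c)) = - ln (v x) - ln c"
      using v_pos[OF x] c by (simp add: ln_div ln_mult)
    ultimately show "- ln (v x) \<le> ln c + 1 / (v x * c) - 1" by simp
  qed
  also have "\<dots> = (ln c - 1) * (\<Sum>x\<in>F. exit_prob x) + (\<Sum>x\<in>F. exit_prob x / v x) / c"
    by (simp add: sum_distrib_left sum_distrib_right sum_divide_distrib sum.distrib[symmetric] algebra_simps)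
  also have "(\<Sum>x\<in>F. exit_prob x / v x) = (\<Sum>x\<in>F. s * b x / h u)"
  proof (intro sum.cong refl)
    fix x assume "x \<in> F"
    from v_pos[OF this] show "exit_prob x / v x = s * b x / h u"
      by (simp add: exit_prob_def)
  qed
  also have "\<dots> = s * c"
    by (simp add: c_def sum_distrib_left sum_divide_distrib)
  also have "(ln c - 1) * (\<Sum>x\<in>F. exit_prob x) + s * c / c \<le> ln c"
    using c s_less by (simp add: sum_exit_prob)
  also have "ln c = ln (\<Sum>x\<in>F. b x) - ln (h u)"
    using escape_weight_pos hu by (simp add: c_def ln_div)
  finally show ?thesis .
qed

lemma exit_prob_average_le:
  assumes "\<And>x. x \<in> F \<Longrightarrow> f x \<le> c"
  shows "(\<Sum>x\<in>F. exit_prob x * f x) \<le> c"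
proof -
  have "(\<Sum>x\<in>F. exit_prob x * f x) \<le> (\<Sum>x\<in>F. exit_prob x * c)"
    using assms by (intro sum_mono mult_left_mono exit_prob_nonneg)
  also have "\<dots> = c"
    by (simp add: sum_distrib_right[symmetric] sum_exit_prob)
  finally show ?thesis .
qed

lemma exit_prob_average_ge:
  assumes "\<And>x. x \<in> F \<Longrightarrow> 0 < b x \<Longrightarrow> c \<le> f x"
  shows "c \<le> (\<Sum>x\<in>F. exit_prob x * f x)"
proof -
  have "c = (\<Sum>x\<in>F. exit_prob x * c)"
    by (simp add: sum_distrib_right[symmetric] sum_exit_prob)
  also have "\<dots> \<le> (\<Sum>x\<in>F. exit_prob x * f x)"
  proof (rule sum_mono)
    fix x assume x: "x \<in> F"
    show "exit_prob x * c \<le> exit_prob x * f x"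
    proof (cases "b x = 0")
      case False
      with x b_nonneg[OF x] show ?thesis
        by (intro mult_left_mono assms exit_prob_nonneg) auto
    qed (simp add: exit_prob_def)
  qed
  finally show ?thesis .
qed

text \<open>The edge inequality \<open>tilted_pair_inequality\<close> is summed over all edges.  The coefficients \<open>\<theta>\<close> and \<open>\<mu>\<close> belong to
  the gradients of \<open>ln h\<close> and \<open>- ln v\<close>; since \<open>\<theta> + \<mu> = s\<close>, the multiples of \<open>ln (h u)\<close> from the first and
  from \<open>exit_entropy\<close> combine to the right side.\<close>

theorem laplace_bound:
  fixes lev :: "'v \<Rightarrow> real" and g G n :: real
  assumes "1 < g" "g < G"
    and s: "s = tilt_factor g G"
    and lip: "\<And>x y. x \<in> F \<Longrightarrow> y \<in> F \<Longrightarrow> 0 < w x y \<Longrightarrow> \<bar>lev y - lev x\<bar> \<le> 1"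
    and start: "lev u = 0"
    and exit: "\<And>x. x \<in> F \<Longrightarrow> 0 < b x \<Longrightarrow> n - 1 \<le> lev x"
  defines "r \<equiv> tilt_skew g G"
  defines "\<theta> \<equiv> (s + r) / 2" and "\<mu> \<equiv> (s - r) / 2"
  shows "s * (ln G - ln g) / 2 * n + \<mu> * (n * ln g) - (s * ln G - r * ln g) / 2 
       - \<mu> * ln (v u * (\<Sum>x\<in>F. b x)) - s + \<theta> - \<theta> * ln \<theta> \<le> s * (- ln (h u))"
proof -
  let ?\<alpha> = "(s * ln G - r * ln g) / 2"
  let ?E = "\<lambda>f. \<Sum>x\<in>F. exit_prob x * f x"
  have hu: "0 < h u" using h_pos[OF u_in] .
  have g: "0 < ln g / 2" "ln g / 2 < ln G / 2" using assms by auto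
  have r: "0 < r" unfolding r_def by (rule tilt_skew_pos[OF assms(1,2)])
  have r_le_s: "r \<le> s" unfolding r_def s by (rule tilt_skew_le_factor[OF assms(1,2)])
  have \<alpha>: "0 \<le> ?\<alpha>"
    using mult_mono[OF r_le_s, of "ln g" "ln G"] g s_pos by simp
  have \<theta>: "0 < \<theta>" using r s_pos by (simp add: \<theta>_def)
  have \<mu>: "0 \<le> \<mu>" using r_le_s by (simp add: \<mu>_def)
  have pair: "?\<alpha> * (flow x y * (lev y - lev x)) \<le>
      \<theta> * (flow x y * (ln (h y) - ln (h x))) - \<mu> * (flow x y * (ln (v y) - ln (v x))) + excess x y"
    if xy: "x \<in> F" "y \<in> F" for x y
  proof (cases "w x y = 0")
    case True
    then show ?thesis by (simp add: flow_def excess_def)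
  next
    case False
    then have w: "0 < w x y" using w_nonneg[OF xy] by simp
    define c where "c = s * w x y / h u"
    have c: "0 < c" using w s_pos hu by (simp add: c_def)
    have fl: "flow x y = c * (v x * h y - v y * h x)"
      "excess x y = c * (v x * h x + v y * h y - s * (v x * h y + v y * h x))"
      by (simp_all add: c_def flow_def excess_def)
    have "?\<alpha> * (flow x y * (lev y - lev x)) \<le> ?\<alpha> * \<bar>flow x y\<bar>"
    proof (rule mult_left_mono[OF _ \<alpha>])
      have "flow x y * (lev y - lev x) \<le> \<bar>flow x y\<bar> * \<bar>lev y - lev x\<bar>"
        by (metis abs_ge_self abs_mult)
      also have "\<dots> \<le> \<bar>flow x y\<bar> * 1"
        using lip[OF xy w] by (intro mult_left_mono) auto
      finally show "flow x y * (lev y - lev x) \<le> \<bar>flow x y\<bar>" by simp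
    qed
    also have "?\<alpha> * \<bar>flow x y\<bar> = c * (?\<alpha> * \<bar>v x * h y - v y * h x\<bar>)"
      using c by (simp add: fl abs_mult)
    also have "\<dots> \<le> c * ((v x * h y - v y * h x) * (\<theta> * (ln (h y) - ln (h x)) + \<mu> * (ln (v x) - ln (v y))) +
        (v x * h x + v y * h y - s * (v x * h y + v y * h x)))"
      unfolding r_def \<theta>_def \<mu>_def s using c assms xy
      by (intro mult_left_mono tilted_pair_inequality h_pos v_pos) auto
    also have "\<dots> = \<theta> * (flow x y * (ln (h y) - ln (h x))) - \<mu> * (flow x y * (ln (v y) - ln (v x))) + excess x y"
      unfolding fl by (simp add: algebra_simps)
    finally show ?thesis .
  qed
  have "2 * (?\<alpha> * (?E lev - lev u)) = (\<Sum>x\<in>F. \<Sum>y\<in>F. ?\<alpha> * (flow x y * (lev y - lev x)))"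
    unfolding sum_distrib_left[symmetric] flow_sum_by_parts by simp
  also have "\<dots> \<le> (\<Sum>x\<in>F. \<Sum>y\<in>F. \<theta> * (flow x y * (ln (h y) - ln (h x)))
      - \<mu> * (flow x y * (ln (v y) - ln (v x))) + excess x y)"
    by (intro sum_mono pair)
  also have "\<dots> = \<theta> * (\<Sum>x\<in>F. \<Sum>y\<in>F. flow x y * (ln (h y) - ln (h x)))
      - \<mu> * (\<Sum>x\<in>F. \<Sum>y\<in>F. flow x y * (ln (v y) - ln (v x))) + (\<Sum>x\<in>F. \<Sum>y\<in>F. excess x y)"
    by (simp add: sum.distrib sum_subtractf sum_distrib_left)
  also have "\<dots> \<le> \<theta> * (2 * (?E (\<lambda>x. ln (h x)) - ln (h u)))
      - \<mu> * (2 * (?E (\<lambda>x. ln (v x)) - ln (v u))) + 2 * ?E (\<lambda>x. s - h x)"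
    unfolding flow_sum_by_parts using sum_excess_le by simp
  finally have "2 * (?\<alpha> * (?E lev - lev u)) \<le> \<theta> * (2 * (?E (\<lambda>x. ln (h x)) - ln (h u)))
      - \<mu> * (2 * (?E (\<lambda>x. ln (v x)) - ln (v u))) + 2 * ?E (\<lambda>x. s - h x)" .
  note sums = this[unfolded start]
  have main: "?\<alpha> * ?E lev \<le> ?E (\<lambda>x. \<theta> * ln (h x) + (s - h x)) - \<theta> * ln (h u)
      + \<mu> * (ln (v u) - ?E (\<lambda>x. ln (v x)))"
  proof -
    have split: "?E (\<lambda>x. \<theta> * ln (h x) + (s - h x)) = \<theta> * ?E (\<lambda>x. ln (h x)) + ?E (\<lambda>x. s - h x)"
      by (simp add: distrib_left sum.distrib sum_distrib_left mult.left_commute)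
    have lin: "a * E \<le> t * H + S - t * hh + m * (vv - V)"
      if "2 * (a * (E - 0)) \<le> t * (2 * (H - hh)) - m * (2 * (V - vv)) + 2 * S"
      for a E t H S hh m vv V :: real
      using that by (simp add: algebra_simps)
    show ?thesis
      unfolding split by (rule lin[OF sums])
  qed
  \<comment> \<open>What remains are boundary terms at the exit; concavity of \<open>ln\<close> bounds them by a constant.\<close>
  have "?\<alpha> * (n - 1) \<le> ?\<alpha> * ?E lev"
    using \<alpha> exit by (intro mult_left_mono exit_prob_average_ge)
  moreover have "?E (\<lambda>x. \<theta> * ln (h x) + (s - h x)) \<le> \<theta> * ln \<theta> - \<theta> + s"
  proof (rule exit_prob_average_le)
    fix x assume x: "x \<in> F"
    have "ln (h x / \<theta>) \<le> h x / \<theta> - 1"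
      using h_pos[OF x] \<theta> by (intro ln_le_minus_one) auto
    then have "\<theta> * (ln (h x) - ln \<theta>) \<le> \<theta> * (h x / \<theta> - 1)"
      using h_pos[OF x] \<theta> by (intro mult_left_mono) (auto simp: ln_div)
    then show "\<theta> * ln (h x) + (s - h x) \<le> \<theta> * ln \<theta> - \<theta> + s"
      using \<theta> by (simp add: algebra_simps)
  qed
  moreover have "\<mu> * (ln (v u) - ?E (\<lambda>x. ln (v x))) \<le> \<mu> * (ln (v u * (\<Sum>x\<in>F. b x)) - ln (h u))"
    using exit_entropy v_pos[OF u_in] escape_weight_pos \<mu>
    by (intro mult_left_mono) (auto simp: ln_mult)
  ultimately have "?\<alpha> * (n - 1) \<le> \<theta> * ln \<theta> - \<theta> + s - \<theta> * ln (h u) + \<mu> * (ln (v u * (\<Sum>x\<in>F. b x)) - ln (h u))"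
    using main by linarith
  moreover have "?\<alpha> * (n - 1) = s * (ln G - ln g) / 2 * n + \<mu> * (n * ln g) - ?\<alpha>"
    by (simp add: \<mu>_def field_simps)
  moreover have "\<theta> * ln \<theta> - \<theta> + s - \<theta> * ln (h u) + \<mu> * (ln (v u * (\<Sum>x\<in>F. b x)) - ln (h u))
      = \<theta> * ln \<theta> - \<theta> + s + \<mu> * ln (v u * (\<Sum>x\<in>F. b x)) + s * (- ln (h u))"
    by (simp add: \<theta>_def \<mu>_def field_simps)
  ultimately show ?thesis
    by linarith
qed

text \<open>Here \<open>untilted_pair_inequality\<close> bounds \<open>- ln (h u)\<close> below by \<open>1 - s\<close> times the sum over edges of
  \<open>R x y\<close>, and \<open>coth_pair_inequality\<close> bounds \<open>R x y\<close> below by a multiple of the flow minus a gradient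
  term (\<open>R\<close> and \<open>\<rho>\<close> are defined in the proof).  The
  edges at \<open>u\<close> are treated apart: there \<open>R\<close> is bounded below by \<open>\<rho>\<close>, whose sum is essentially the discounted
  number \<open>N\<close> of visits to \<open>u\<close>.  This absorbs the term \<open>\<kappa> ln N\<close> that comes from comparing \<open>v u\<close> with
  \<open>1 / tot u\<close>, so the bound does not depend on \<open>N\<close>.\<close>

theorem mean_bound:
  fixes lev :: "'v \<Rightarrow> real" and g n W :: real
  assumes "1 < g"
    and lip: "\<And>x y. x \<in> F \<Longrightarrow> y \<in> F \<Longrightarrow> 0 < w x y \<Longrightarrow> \<bar>lev y - lev x\<bar> \<le> 1"
    and start: "lev u = 0"
    and exit: "\<And>x. x \<in> F \<Longrightarrow> 0 < b x \<Longrightarrow> n - 1 \<le> lev x"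
    and h_le: "\<And>x. x \<in> F \<Longrightarrow> h x \<le> 1"
    and W: "(\<Sum>x\<in>F. b x) \<le> W * tot u"
  defines "\<kappa> \<equiv> 2 * g / (g - 1)\<^sup>2"
  defines "A \<equiv> (g + 1) / (g - 1) + \<kappa> * ln g"
  shows "(1 - s) * (A * (n - 2) - 1 + \<kappa> - \<kappa> * ln \<kappa> - \<kappa> * ln W) \<le> (1 + 2 * \<kappa> * (1 - s)) * (- ln (h u))"
proof -
  let ?E = "\<lambda>f. \<Sum>x\<in>F. exit_prob x * f x"
  have hu: "0 < h u" using h_pos[OF u_in] .
  have \<kappa>: "0 < \<kappa>" using assms by (simp add: \<kappa>_def)
  have A: "0 \<le> A" using assms \<kappa> by (simp add: A_def)
  \<comment> \<open>The truncated level is constant on \<open>u\<close> and its neighbours, so the edges at \<open>u\<close> are not needed for the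
    distance; this costs one unit of \<open>n\<close>.\<close>
  define m where "m x = max (lev x) 1" for x
  define R where "R x y = s * w x y * (v x * h y + v y * h x) / h u" for x y
  define \<rho> where "\<rho> x y = (if x = u then s * w x y * (v x * h y) / h u else 0) +
      (if y = u then s * w x y * (v y * h x) / h u else 0)" for x y
  have R_le: "(1 - s) * R x y \<le> flow x y * (ln (h y) - ln (h x)) + excess x y"
    if xy: "x \<in> F" "y \<in> F" for x y
  proof -
    define c where "c = s * w x y / h u"
    have c: "0 \<le> c" using w_nonneg[OF xy] s_pos hu by (simp add: c_def)
    have "c * ((1 - s) * (v x * h y + v y * h x)) \<le>
       c * ((v x * h y - v y * h x) * (ln (h y) - ln (h x)) + (v x * h x + v y * h y - s * (v x * h y + v y * h x)))"
      using c xy by (intro mult_left_mono untilted_pair_inequality h_pos v_pos)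
    then show ?thesis
      by (simp add: R_def flow_def excess_def c_def mult_ac distrib_left add_divide_distrib)
  qed
  have R_ge: "\<rho> x y + A * (flow x y * (m y - m x))
       - \<kappa> * (flow x y * (ln (h y) - ln (h x))) + \<kappa> * (flow x y * (ln (v y) - ln (v x))) \<le> R x y"
    if xy: "x \<in> F" "y \<in> F" for x y
  proof (cases "w x y = 0")
    case True
    then show ?thesis by (auto simp: flow_def R_def \<rho>_def)
  next
    case False
    then have w: "0 < w x y" using w_nonneg[OF xy] by simp
    define c where "c = s * w x y / h u"
    have c: "0 < c" using w s_pos hu by (simp add: c_def)
    define p where "p = v x * h y"
    define q where "q = v y * h x"
    have pq: "0 < p" "0 < q" using xy by (simp_all add: p_def q_def h_pos v_pos)
    have fl: "flow x y = c * (p - q)" "R x y = c * (p + q)"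
      by (simp_all add: c_def p_def q_def flow_def R_def)
    have \<rho>: "\<rho> x y = (if x = u then c * p else 0) + (if y = u then c * q else 0)"
      by (simp add: \<rho>_def c_def p_def q_def)
    have lns: "(ln (h y) - ln (h x)) - (ln (v y) - ln (v x)) = ln p - ln q"
      using h_pos[OF xy(1)] h_pos[OF xy(2)] v_pos[OF xy(1)] v_pos[OF xy(2)]
      by (simp add: p_def q_def ln_mult)
    have lns': "- \<kappa> * (flow x y * (ln (h y) - ln (h x))) + \<kappa> * (flow x y * (ln (v y) - ln (v x)))
        = - (c * (\<kappa> * ((p - q) * (ln p - ln q))))"
      unfolding fl lns[symmetric] by (simp add: algebra_simps)
    have mono: "0 \<le> (p - q) * (ln p - ln q)"
      using pq by (cases "p \<le> q") (auto intro: mult_nonpos_nonpos)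
    show ?thesis
    proof (cases "x = u \<or> y = u")
      case True
      have "m x = m y"
      proof (cases "x = u")
        case True
        then show ?thesis using lip[OF xy w] start by (simp add: m_def max_def)
      next
        case False
        with \<open>x = u \<or> y = u\<close> have "y = u" by simp
        then show ?thesis using lip[OF xy w] start by (simp add: m_def max_def)
      qed
      moreover have "\<rho> x y \<le> R x y"
        unfolding \<rho> fl using c pq by (auto simp: distrib_left)
      moreover have "0 \<le> c * (\<kappa> * ((p - q) * (ln p - ln q)))"
        using c \<kappa> mono by simp
      ultimately show ?thesis using lns' by simp
    next
      case False
      have "flow x y * (m y - m x) \<le> \<bar>flow x y\<bar> * \<bar>m y - m x\<bar>"
        by (metis abs_ge_self abs_mult)
      also have "\<dots> \<le> \<bar>flow x y\<bar> * 1"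
        using lip[OF xy w] by (intro mult_left_mono) (auto simp: m_def max_def)
      finally have "A * (flow x y * (m y - m x)) \<le> A * \<bar>flow x y\<bar>"
        using A by (intro mult_left_mono) auto
      also have "\<dots> = c * (A * \<bar>p - q\<bar>)"
        using c by (simp add: fl abs_mult)
      also have "\<dots> \<le> c * (p + q + \<kappa> * ((p - q) * (ln p - ln q)))"
        unfolding A_def \<kappa>_def using c pq assms by (intro mult_left_mono coth_pair_inequality) auto
      finally show ?thesis
        using lns' False by (simp add: \<rho> fl distrib_left)
    qed
  qed
  define N where "N = v u * tot u"
  have N: "0 < N" using v_pos[OF u_in] tot_pos[OF u_in] by (simp add: N_def)
  have sum_\<rho>: "(\<Sum>x\<in>F. \<Sum>y\<in>F. \<rho> x y) = 2 * (N - exit_prob u)"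
  proof -
    have row: "(\<Sum>y\<in>F. s * w u y * (v u * h y) / h u) = N - exit_prob u"
    proof -
      have "(\<Sum>y\<in>F. s * w u y * (v u * h y) / h u) = v u * (s * (\<Sum>y\<in>F. w u y * h y)) / h u"
        unfolding sum_distrib_left sum_divide_distrib by (intro sum.cong refl) (simp add: mult_ac)
      also have "s * (\<Sum>y\<in>F. w u y * h y) = tot u * h u - s * b u"
        using h_eq[OF u_in] by (simp add: algebra_simps)
      finally show ?thesis
        using hu by (simp add: N_def exit_prob_def field_simps)
    qed
    have "(\<Sum>x\<in>F. \<Sum>y\<in>F. (if x = u then s * w x y * (v x * h y) / h u else 0)) = N - exit_prob u"
    proof -
      have "(\<Sum>x\<in>F. \<Sum>y\<in>F. (if x = u then s * w x y * (v x * h y) / h u else 0)) =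
          (\<Sum>x\<in>F. if x = u then \<Sum>y\<in>F. s * w x y * (v x * h y) / h u else 0)"
        by (intro sum.cong) auto
      then show ?thesis using finite_F u_in row by simp
    qed
    moreover have "(\<Sum>x\<in>F. \<Sum>y\<in>F. (if y = u then s * w x y * (v y * h x) / h u else 0)) = N - exit_prob u"
    proof -
      have "(\<Sum>x\<in>F. \<Sum>y\<in>F. (if y = u then s * w x y * (v y * h x) / h u else 0)) =
          (\<Sum>x\<in>F. s * w x u * (v u * h x) / h u)"
        using finite_F u_in by (simp add: )
      also have "\<dots> = N - exit_prob u"
        using row u_in by (simp add: w_sym[of _ u] cong: sum.cong)
      finally show ?thesis .
    qed
    ultimately show ?thesis by (simp add: \<rho>_def sum.distrib)
  qed
  have sumR_le: "(1 - s) * (\<Sum>x\<in>F. \<Sum>y\<in>F. R x y) \<le> 2 * (?E (\<lambda>x. ln (h x)) - ln (h u)) + 2 * ?E (\<lambda>x. s - h x)"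
  proof -
    have "(1 - s) * (\<Sum>x\<in>F. \<Sum>y\<in>F. R x y) = (\<Sum>x\<in>F. \<Sum>y\<in>F. (1 - s) * R x y)"
      by (simp add: sum_distrib_left)
    also have "\<dots> \<le> (\<Sum>x\<in>F. \<Sum>y\<in>F. flow x y * (ln (h y) - ln (h x)) + excess x y)"
      by (intro sum_mono R_le)
    also have "\<dots> = (\<Sum>x\<in>F. \<Sum>y\<in>F. flow x y * (ln (h y) - ln (h x))) + (\<Sum>x\<in>F. \<Sum>y\<in>F. excess x y)"
      by (simp add: sum.distrib)
    finally show ?thesis
      unfolding flow_sum_by_parts using sum_excess_le by linarith
  qed
  have sumR_ge: "2 * (N - exit_prob u) + A * (2 * (?E m - m u))
      - \<kappa> * (2 * (?E (\<lambda>x. ln (h x)) - ln (h u))) + \<kappa> * (2 * (?E (\<lambda>x. ln (v x)) - ln (v u)))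
      \<le> (\<Sum>x\<in>F. \<Sum>y\<in>F. R x y)"
  proof -
    have "(\<Sum>x\<in>F. \<Sum>y\<in>F. \<rho> x y + A * (flow x y * (m y - m x)) - \<kappa> * (flow x y * (ln (h y) - ln (h x)))
        + \<kappa> * (flow x y * (ln (v y) - ln (v x)))) \<le> (\<Sum>x\<in>F. \<Sum>y\<in>F. R x y)"
      by (intro sum_mono R_ge)
    then show ?thesis
      unfolding sum.distrib sum_subtractf sum_distrib_left[symmetric] sum_\<rho> flow_sum_by_parts .
  qed
  have E_m: "n - 1 \<le> ?E m"
    by (rule exit_prob_average_ge) (use exit in \<open>force simp: m_def\<close>)
  have mu: "m u = 1" by (simp add: m_def start)
  have eu: "exit_prob u \<le> 1"
    using member_le_sum[OF u_in, of exit_prob] exit_prob_nonneg finite_F sum_exit_prob by auto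
  have Elnh: "?E (\<lambda>x. ln (h x)) \<le> 0"
    by (rule exit_prob_average_le) (use h_le h_pos in auto)
  have Eh: "?E (\<lambda>x. ln (h x)) + ?E (\<lambda>x. s - h x) \<le> 0"
  proof -
    have "?E (\<lambda>x. ln (h x) + (s - h x)) \<le> 0"
    proof (rule exit_prob_average_le)
      fix x assume "x \<in> F"
      from ln_le_minus_one[OF h_pos[OF this]] s_less show "ln (h x) + (s - h x) \<le> 0" by simp
    qed
    then show ?thesis by (simp add: distrib_left sum.distrib)
  qed
  have Elnv: "ln (v u) - ?E (\<lambda>x. ln (v x)) \<le> ln N + ln W - ln (h u)"
  proof -
    have "ln (\<Sum>x\<in>F. b x) \<le> ln (W * tot u)"
      using W escape_weight_pos by (subst ln_le_cancel_iff) auto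
    moreover have "0 < W"
      using W escape_weight_pos tot_pos[OF u_in] by (smt (verit) zero_less_mult_pos2)
    ultimately show ?thesis
      using exit_entropy v_pos[OF u_in] tot_pos[OF u_in] by (simp add: N_def ln_mult)
  qed
  have lnN: "\<kappa> * ln N \<le> N + \<kappa> * ln \<kappa> - \<kappa>"
  proof -
    have "ln (N / \<kappa>) \<le> N / \<kappa> - 1" using N \<kappa> by (intro ln_le_minus_one) auto
    then have "\<kappa> * (ln N - ln \<kappa>) \<le> \<kappa> * (N / \<kappa> - 1)"
      using N \<kappa> by (intro mult_left_mono) (auto simp: ln_div)
    then show ?thesis using \<kappa> by (simp add: algebra_simps)
  qed
  have "A * (n - 2) - 1 + \<kappa> - \<kappa> * ln \<kappa> - \<kappa> * ln W + 2 * \<kappa> * ln (h u) \<le>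
      N - exit_prob u + A * (?E m - m u) - \<kappa> * (?E (\<lambda>x. ln (h x)) - ln (h u)) + \<kappa> * (?E (\<lambda>x. ln (v x)) - ln (v u))"
  proof -
    have "A * (n - 2) \<le> A * (?E m - m u)"
      using E_m mu A by (intro mult_left_mono) auto
    moreover have "\<kappa> * ?E (\<lambda>x. ln (h x)) \<le> 0"
      using \<kappa> Elnh by (intro mult_nonneg_nonpos) auto
    moreover have "\<kappa> * (ln (v u) - ?E (\<lambda>x. ln (v x))) \<le> \<kappa> * (ln N + ln W - ln (h u))"
      using Elnv \<kappa> by (intro mult_left_mono) auto
    ultimately show ?thesis using lnN eu by (simp add: algebra_simps)
  qed
  also have "\<dots> \<le> (\<Sum>x\<in>F. \<Sum>y\<in>F. R x y) / 2"
    using sumR_ge by (simp add: algebra_simps)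
  finally have "(1 - s) * (A * (n - 2) - 1 + \<kappa> - \<kappa> * ln \<kappa> - \<kappa> * ln W + 2 * \<kappa> * ln (h u))
      \<le> (1 - s) * ((\<Sum>x\<in>F. \<Sum>y\<in>F. R x y) / 2)"
    using s_less by (intro mult_left_mono) auto
  also have "\<dots> \<le> - ln (h u)"
    using sumR_le Eh by simp
  finally show ?thesis by (simp add: algebra_simps)
qed

end

section \<open>The generating function of the hitting time\<close>

text \<open>The expectation of \<open>s\<^sup>T\<close> on the event \<open>T \<le> m\<close>, where \<open>T\<close> is the first positive time in \<open>z\<close>.  Truncation at \<open>m\<close>
  keeps the sum finite and allows induction.\<close>

definition hit_gen :: "real \<Rightarrow> ('v \<Rightarrow> 'v pmf) \<Rightarrow> 'v set \<Rightarrow> nat \<Rightarrow> 'v \<Rightarrow> real" where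
  "hit_gen s K z m x = (\<Sum>k<m. s ^ Suc k * (survival K z k x - survival K z (Suc k) x))"

lemma hit_gen_Suc:
  "hit_gen s K z (Suc m) x = s * measure_pmf.expectation (K x) (\<lambda>y. if y \<in> z then 1 else hit_gen s K z m y)"
proof -
  let ?E = "measure_pmf.expectation (K x)"
  let ?S = "\<lambda>k y. if y \<in> z then 0 else survival K z k y"
  have int: "integrable (measure_pmf (K x)) (?S k)" for k
    by (rule integrable_survival)
  have "?E (\<lambda>y. if y \<in> z then 1 else hit_gen s K z m y)
      = ?E (\<lambda>y. (1 - ?S 0 y) + (\<Sum>k<m. s ^ Suc k * (?S k y - ?S (Suc k) y)))"
    by (intro Bochner_Integration.integral_cong refl) (auto simp: hit_gen_def simp del: survival.simps(2))
  also have "\<dots> = (1 - ?E (?S 0)) + (\<Sum>k<m. s ^ Suc k * (?E (?S k) - ?E (?S (Suc k))))"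
    using int by (subst Bochner_Integration.integral_add) (auto simp del: survival.simps)
  also have "s * \<dots> = s * (survival K z 0 x - survival K z 1 x) +
      (\<Sum>k<m. s ^ Suc (Suc k) * (survival K z (Suc k) x - survival K z (Suc (Suc k)) x))"
    by (simp add: distrib_left sum_distrib_left mult.assoc)
  also have "\<dots> = hit_gen s K z (Suc m) x"
    unfolding hit_gen_def by (subst sum.lessThan_Suc_shift) (simp del: survival.simps)
  finally show ?thesis by simp
qed

lemma hit_gen_nonneg: "0 \<le> s \<Longrightarrow> 0 \<le> hit_gen s K z m x"
  unfolding hit_gen_def
  by (intro sum_nonneg mult_nonneg_nonneg zero_le_power) (auto simp: survival_decreasing simp del: survival.simps)

lemma sum_survival_differences: "(\<Sum>k<m. survival K z k x - survival K z (Suc k) x) = 1 - survival K z m x"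
  using sum_lessThan_telescope'[of "\<lambda>k. survival K z k x" m] by (simp del: survival.simps(2))

lemma hit_gen_le_1: "0 \<le> s \<Longrightarrow> s \<le> 1 \<Longrightarrow> hit_gen s K z m x \<le> 1"
proof -
  assume s: "0 \<le> s" "s \<le> 1"
  have "hit_gen s K z m x \<le> (\<Sum>k<m. 1 * (survival K z k x - survival K z (Suc k) x))"
    unfolding hit_gen_def using s
    by (intro sum_mono mult_right_mono power_le_one) (auto simp: survival_decreasing simp del: survival.simps)
  also have "\<dots> \<le> 1"
    using sum_survival_differences[of K z x m] survival_bounds(1)[of K z m x] by (simp del: survival.simps)
  finally show ?thesis .
qed

lemma hit_gen_ge_power:
  assumes "0 \<le> s" "s \<le> 1"
  shows "s ^ m * (1 - survival K z m x) \<le> hit_gen s K z m x"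
proof -
  have "s ^ m * (1 - survival K z m x) = (\<Sum>k<m. s ^ m * (survival K z k x - survival K z (Suc k) x))"
    unfolding sum_distrib_left[symmetric] sum_survival_differences ..
  also have "\<dots> \<le> hit_gen s K z m x"
    unfolding hit_gen_def using assms
    by (intro sum_mono mult_right_mono power_decreasing) (auto simp: survival_decreasing simp del: survival.simps)
  finally show ?thesis .
qed

text \<open>The truncated form of \<open>1 - E s\<^sup>T \<le> (1 - s) E T\<close>.\<close>

lemma hit_gen_ge_mean:
  assumes "0 \<le> s" "s \<le> 1"
  shows "1 - hit_gen s K z m x \<le> (1 - s) * (\<Sum>k<m. survival K z k x) + s ^ m * survival K z m x"
proof (induction m)
  case 0
  show ?case by (simp add: hit_gen_def)
next
  case (Suc m)
  have "0 \<le> (1 - s) * (1 - s ^ m) * survival K z m x"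
    using assms by (intro mult_nonneg_nonneg survival_bounds) (auto simp: power_le_one)
  with Suc show ?case
    by (simp add: hit_gen_def algebra_simps del: survival.simps)
qed

section \<open>Approximation of a graph by finite networks\<close>

lemma pmf_finite_mass:
  fixes p :: "'v pmf"
  assumes "0 < \<eta>"
  obtains Y where "finite Y" "Y \<subseteq> set_pmf p" "1 - \<eta> < (\<Sum>y\<in>Y. pmf p y)"
proof -
  have S: "infsum (\<lambda>y. ennreal (pmf p y)) UNIV = (SUP F\<in>{F. finite F \<and> F \<subseteq> UNIV}. \<Sum>y\<in>F. ennreal (pmf p y))"
    by (rule nonneg_infsum_complete) simp
  have "infsum (\<lambda>y. ennreal (pmf p y)) UNIV \<le> 1"
    unfolding S
  proof (rule SUP_least)
    fix F :: "'v set" assume "F \<in> {F. finite F \<and> F \<subseteq> UNIV}"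
    then have "(\<Sum>y\<in>F. ennreal (pmf p y)) = ennreal (measure p F)"
      by (simp add: measure_measure_pmf_finite sum_nonneg)
    also have "\<dots> \<le> 1" by simp
    finally show "(\<Sum>y\<in>F. ennreal (pmf p y)) \<le> 1" .
  qed
  then have fin: "infsum (\<lambda>y. ennreal (pmf p y)) UNIV < \<infinity>"
    by (rule order.strict_trans1) simp
  have "infsum (\<lambda>y. ennreal (pmf p y)) UNIV = 1"
    using nn_integral_count_space_eq_infsum[OF fin] nn_integral_pmf[of UNIV p] by simp
  then have "ennreal (1 - \<eta>) < (SUP F\<in>{F. finite F \<and> F \<subseteq> UNIV}. \<Sum>y\<in>F. ennreal (pmf p y))"
    unfolding S[symmetric] using assms by (simp add: ennreal_less_one_iff)
  then obtain F where F: "finite F" "ennreal (1 - \<eta>) < (\<Sum>y\<in>F. ennreal (pmf p y))"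
    by (auto simp: less_SUP_iff)
  have "ennreal (1 - \<eta>) < ennreal (\<Sum>y\<in>F. pmf p y)"
    using F(2) by (simp add: sum_nonneg)
  then have "1 - \<eta> < (\<Sum>y\<in>F. pmf p y)"
    by (metis ennreal_leI linorder_not_less)
  also have "\<dots> = (\<Sum>y\<in>F \<inter> set_pmf p. pmf p y)"
    using F(1) by (intro sum.mono_neutral_right) (auto simp: set_pmf_iff)
  finally show ?thesis
    using F(1) by (intro that[of "F \<inter> set_pmf p"]) auto
qed

lemma expectation_finite_approx:
  fixes f :: "'v \<Rightarrow> real"
  assumes "finite Y" "Y \<inter> z = {}" and f: "\<And>y. 0 \<le> f y" "\<And>y. f y \<le> 1"
    and Y: "1 - \<eta> \<le> measure (measure_pmf p) (Y \<union> z)"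
  shows "measure_pmf.expectation p (\<lambda>y. if y \<in> z then 1 else f y) \<le>
    measure (measure_pmf p) z + (\<Sum>y\<in>Y. pmf p y * f y) + \<eta>"
proof -
  let ?E = "measure_pmf.expectation p"
  have int: "integrable p (indicator A :: _ \<Rightarrow> real)" for A
    by (rule integrable_pmf_bounded[where B=1]) (simp add: indicator_def)
  have intY: "integrable p (\<lambda>y. if y \<in> Y then f y else 0)"
    by (rule integrable_pmf_bounded[where B=1]) (use f in simp)
  have "?E (\<lambda>y. if y \<in> z then 1 else f y) \<le>
     ?E (\<lambda>y. indicator z y + ((if y \<in> Y then f y else 0) + indicator (- (Y \<union> z)) y))"
    using f assms(2)
    by (intro integral_mono Bochner_Integration.integrable_add int intY integrable_pmf_bounded[where B=1])
      (auto simp: indicator_def)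
  also have "\<dots> = measure p z + (?E (\<lambda>y. if y \<in> Y then f y else 0) + measure p (- (Y \<union> z)))"
    using int intY by simp
  also have "?E (\<lambda>y. if y \<in> Y then f y else 0) = (\<Sum>y\<in>Y. pmf p y * f y)"
    using assms(1) by (subst integral_measure_pmf[where A=Y]) (auto split: if_splits)
  also have "measure p (- (Y \<union> z)) = 1 - measure p (Y \<union> z)"
    using measure_pmf.prob_compl[of "Y \<union> z" p] by (simp add: Compl_eq_Diff_UNIV)
  finally show ?thesis using Y by simp
qed

text \<open>Iteration from \<open>0\<close> increases and stays below the constant supersolution \<open>B\<close>; its limit solves the
  equation.\<close>

lemma linear_fixpoint_exists:
  fixes w :: "'v \<Rightarrow> 'v \<Rightarrow> real" and tot src :: "'v \<Rightarrow> real" and s B :: real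
  assumes "finite F" "\<And>x y. x \<in> F \<Longrightarrow> y \<in> F \<Longrightarrow> 0 \<le> w x y" "\<And>x. x \<in> F \<Longrightarrow> 0 < tot x"
    "0 \<le> s" "\<And>x. x \<in> F \<Longrightarrow> 0 \<le> src x" "0 \<le> B"
    and super: "\<And>x. x \<in> F \<Longrightarrow> src x + s * (\<Sum>y\<in>F. w x y * B) \<le> tot x * B"
  shows "\<exists>f. \<forall>x\<in>F. tot x * f x = src x + s * (\<Sum>y\<in>F. w x y * f y) \<and> 0 \<le> f x \<and> f x \<le> B"
proof -
  define T where "T f x = (src x + s * (\<Sum>y\<in>F. w x y * f y)) / tot x" for f x
  define it where "it m = (T ^^ m) (\<lambda>_. 0)" for m
  have it_Suc: "it (Suc m) = T (it m)" for m by (simp add: it_def)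
  have T_mono: "T f x \<le> T f' x" if "x \<in> F" "\<And>y. y \<in> F \<Longrightarrow> f y \<le> f' y" for f f' x
    unfolding T_def using that assms(2)[OF that(1)] assms(3)[OF that(1)] assms(4)
    by (intro divide_right_mono add_left_mono mult_left_mono sum_mono) auto
  have inc: "it m x \<le> it (Suc m) x" if "x \<in> F" for m x
    using that
  proof (induction m arbitrary: x)
    case 0
    then show ?case using assms by (simp add: it_def T_def less_imp_le)
  next
    case (Suc m)
    then show ?case unfolding it_Suc by (intro T_mono) (auto simp: it_Suc)
  qed
  have le: "it m x \<le> B" if "x \<in> F" for m x
    using that
  proof (induction m arbitrary: x)
    case 0
    then show ?case using assms by (simp add: it_def)
  next
    case (Suc m)
    have "it (Suc m) x \<le> T (\<lambda>_. B) x"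
      unfolding it_Suc using Suc by (intro T_mono) auto
    also have "\<dots> \<le> B"
      using super[OF Suc.prems] assms(3)[OF Suc.prems] by (simp add: T_def divide_le_eq mult.commute)
    finally show ?case .
  qed
  have incs: "incseq (\<lambda>m. it m x)" if "x \<in> F" for x
    using inc[OF that] by (rule incseq_SucI)
  have ex: "\<exists>l. (\<lambda>m. it m x) \<longlonglongrightarrow> l" if "x \<in> F" for x
    using incseq_convergent[OF incs[OF that], of B] le[OF that] by blast
  then obtain f where f: "\<And>x. x \<in> F \<Longrightarrow> (\<lambda>m. it m x) \<longlonglongrightarrow> f x"
    by metis
  show ?thesis
  proof (intro exI[of _ f] ballI conjI)
    fix x assume x: "x \<in> F"
    have "(\<lambda>m. T (it m) x) \<longlonglongrightarrow> T f x"
      unfolding T_def using assms(3)[OF x] by (intro tendsto_intros f) auto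
    moreover have "(\<lambda>m. T (it m) x) \<longlonglongrightarrow> f x"
      using LIMSEQ_Suc[OF f[OF x]] by (simp add: it_Suc)
    ultimately have "T f x = f x" by (rule LIMSEQ_unique)
    then show "tot x * f x = src x + s * (\<Sum>y\<in>F. w x y * f y)"
      using assms(3)[OF x] by (simp add: T_def field_simps)
    show "f x \<le> B"
      by (rule LIMSEQ_le_const2[OF f[OF x]]) (use le[OF x] in auto)
    show "0 \<le> f x"
      using incseq_le[OF incs[OF x] f[OF x], of 0] by (simp add: it_def)
  qed
qed

definition tot_weight :: "'v set \<Rightarrow> ('v \<Rightarrow> 'v \<Rightarrow> real) \<Rightarrow> 'v \<Rightarrow> real" where
  "tot_weight V w x = enn2real (vertex_weight V w x)"

text \<open>The total weight of the edges from \<open>x\<close> to \<open>z\<close>.  It is written as a probability because \<open>z\<close> may be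
  infinite.\<close>

definition weight_into :: "'v set \<Rightarrow> ('v \<Rightarrow> 'v \<Rightarrow> real) \<Rightarrow> 'v set \<Rightarrow> 'v \<Rightarrow> real" where
  "weight_into V w z x = tot_weight V w x * measure (measure_pmf (walk_step V w x)) z"

context
  fixes V :: "'v set" and w :: "'v \<Rightarrow> 'v \<Rightarrow> real" and z :: "'v set"
  assumes G: "weighted_graph V w" and zV: "z \<subseteq> V"
begin

lemma tot_weight_pos: "x \<in> V \<Longrightarrow> 0 < tot_weight V w x"
  using G by (auto simp: weighted_graph_def tot_weight_def enn2real_positive_iff less_top)

lemma ennreal_tot_weight: "x \<in> V \<Longrightarrow> ennreal (tot_weight V w x) = vertex_weight V w x"
  using G by (auto simp: weighted_graph_def tot_weight_def less_top)

lemma weight_nonneg: "x \<in> V \<Longrightarrow> y \<in> V \<Longrightarrow> 0 \<le> w x y"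
  using G by (auto simp: weighted_graph_def)

lemma weight_sym: "x \<in> V \<Longrightarrow> y \<in> V \<Longrightarrow> w x y = w y x"
  using G by (auto simp: weighted_graph_def)

lemma weight_eq_pmf: "x \<in> V \<Longrightarrow> y \<in> V \<Longrightarrow> w x y = tot_weight V w x * pmf (walk_step V w x) y"
  using tot_weight_pos[of x] by (simp add: pmf_walk_step[OF G] tot_weight_def)

lemma set_pmf_walk_step: "x \<in> V \<Longrightarrow> set_pmf (walk_step V w x) = {y \<in> V. 0 < w x y}"
  using tot_weight_pos[of x] weight_nonneg[of x]
  by (auto simp: set_pmf_eq pmf_walk_step[OF G] tot_weight_def order.strict_iff_order)

lemma sum_weight_le: "x \<in> V \<Longrightarrow> finite F \<Longrightarrow> F \<subseteq> V \<Longrightarrow> (\<Sum>y\<in>F. ennreal (w x y)) \<le> vertex_weight V w x"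
  unfolding vertex_weight_def by (subst nonneg_infsum_complete) (auto intro: SUP_upper)

lemma sum_weight_into_le:
  assumes x: "x \<in> V" and "finite F" "F \<subseteq> V - z"
  shows "(\<Sum>y\<in>F. w x y) + weight_into V w z x \<le> tot_weight V w x"
proof -
  let ?p = "measure_pmf (walk_step V w x)"
  have "(\<Sum>y\<in>F. w x y) = tot_weight V w x * measure ?p F"
    using assms by (simp add: measure_measure_pmf_finite sum_distrib_left weight_eq_pmf subset_iff)
  moreover have "measure ?p F + measure ?p z = measure ?p (F \<union> z)"
    using assms by (intro measure_pmf.finite_measure_Union[symmetric]) auto
  moreover have "measure ?p (F \<union> z) \<le> 1" by simp
  ultimately have "measure ?p F + measure ?p z \<le> 1"
    and F: "(\<Sum>y\<in>F. w x y) = tot_weight V w x * measure ?p F" by simp_all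
  then have "tot_weight V w x * (measure ?p F + measure ?p z) \<le> tot_weight V w x * 1"
    using tot_weight_pos[OF x] by (intro mult_left_mono) auto
  then show ?thesis
    by (simp add: F weight_into_def distrib_left)
qed

text \<open>An edge between \<open>F\<close> and \<open>z\<close> is counted in the weight of its endpoint in \<open>z\<close>.  Exchanging the sums is done with
  integrals, as \<open>z\<close> need not be countable.\<close>

lemma sum_weight_into_le_set_weight:
  assumes "finite F" "F \<subseteq> V"
  shows "ennreal (\<Sum>x\<in>F. weight_into V w z x) \<le> set_weight V w z"
proof (cases "set_weight V w z = \<infinity>")
  case False
  then have fin: "infsum (vertex_weight V w) z < \<infinity>"
    by (simp add: set_weight_def less_top)
  have into: "ennreal (weight_into V w z x) = (\<integral>\<^sup>+ y. ennreal (w x y) \<partial>count_space z)" if x: "x \<in> V" for x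
  proof -
    have "ennreal (weight_into V w z x) = ennreal (tot_weight V w x) * emeasure (walk_step V w x) z"
      using tot_weight_pos[OF x]
      by (simp add: weight_into_def ennreal_mult measure_pmf.emeasure_eq_measure)
    also have "\<dots> = (\<integral>\<^sup>+ y. ennreal (tot_weight V w x) * ennreal (pmf (walk_step V w x) y) \<partial>count_space z)"
      by (simp add: nn_integral_cmult nn_integral_pmf)
    also have "\<dots> = (\<integral>\<^sup>+ y. ennreal (w x y) \<partial>count_space z)"
      using x zV tot_weight_pos[OF x]
      by (intro nn_integral_cong) (auto simp: weight_eq_pmf[of x] ennreal_mult subset_iff)
    finally show ?thesis .
  qed
  have nn: "0 \<le> weight_into V w z x" if "x \<in> V" for x
    using tot_weight_pos[OF that] by (simp add: weight_into_def)
  have "ennreal (\<Sum>x\<in>F. weight_into V w z x) = (\<Sum>x\<in>F. ennreal (weight_into V w z x))"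
    using nn assms by (subst sum_ennreal) auto
  also have "\<dots> = (\<Sum>x\<in>F. \<integral>\<^sup>+ y. ennreal (w x y) \<partial>count_space z)"
    using assms by (intro sum.cong refl into) auto
  also have "\<dots> = (\<integral>\<^sup>+ y. (\<Sum>x\<in>F. ennreal (w x y)) \<partial>count_space z)"
    by (rule nn_integral_sum[symmetric]) simp
  also have "\<dots> \<le> (\<integral>\<^sup>+ y. vertex_weight V w y \<partial>count_space z)"
  proof (rule nn_integral_mono)
    fix y assume "y \<in> space (count_space z)"
    then have y: "y \<in> V" using zV by auto
    have "(\<Sum>x\<in>F. ennreal (w x y)) = (\<Sum>x\<in>F. ennreal (w y x))"
      using y assms by (intro sum.cong refl) (auto simp: weight_sym[of _ y])
    also have "\<dots> \<le> vertex_weight V w y"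
      using y assms by (rule sum_weight_le)
    finally show "(\<Sum>x\<in>F. ennreal (w x y)) \<le> vertex_weight V w y" .
  qed
  also have "\<dots> = set_weight V w z"
    unfolding set_weight_def by (rule nn_integral_count_space_eq_infsum[OF fin])
  finally show ?thesis .
qed simp

text \<open>Within \<open>m\<close> steps the walk leaves a large finite set with small probability, so killing it there changes
  little.  Every nonnegative solution \<open>f\<close> of the equation of the killed network dominates the truncated generating
  function of that network.\<close>

lemma hit_gen_le_finite_network:
  assumes "0 \<le> s" "s \<le> 1" "x \<in> V" "0 < \<eta>"
  shows "\<exists>F0. finite F0 \<and> F0 \<subseteq> V - z \<and> (\<forall>F f. finite F \<longrightarrow> F0 \<subseteq> F \<longrightarrow> F \<subseteq> V - z \<longrightarrow>
    (\<forall>y\<in>F. 0 \<le> f y) \<longrightarrow>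
    (\<forall>y\<in>F. tot_weight V w y * f y = s * ((\<Sum>y'\<in>F. w y y' * f y') + weight_into V w z y)) \<longrightarrow>
    x \<in> F \<longrightarrow> hit_gen s (walk_step V w) z m x \<le> f x + \<eta>)"
  using assms(3,4)
proof (induction m arbitrary: x \<eta>)
  case 0
  show ?case
  proof (intro exI[of _ "{}"] conjI allI impI)
    fix F and f :: "'v \<Rightarrow> real" assume "\<forall>y\<in>F. 0 \<le> f y" "x \<in> F"
    then have "0 \<le> f x" by blast
    then show "hit_gen s (walk_step V w) z 0 x \<le> f x + \<eta>"
      using 0 by (simp add: hit_gen_def)
  qed auto
next
  case (Suc m)
  let ?p = "walk_step V w x"
  let ?H = "hit_gen s (walk_step V w) z m"
  obtain Y0 where Y0: "finite Y0" "Y0 \<subseteq> set_pmf ?p" "1 - \<eta> / 2 < (\<Sum>y\<in>Y0. pmf ?p y)"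
    using pmf_finite_mass[of "\<eta> / 2" ?p] Suc.prems by auto
  define Y where "Y = Y0 - z"
  have Y: "finite Y" "Y \<subseteq> V - z"
    using Y0 set_pmf_walk_step[OF Suc.prems(1)] by (auto simp: Y_def)
  let ?P = "\<lambda>y A F f. finite F \<longrightarrow> A \<subseteq> F \<longrightarrow> F \<subseteq> V - z \<longrightarrow> (\<forall>y\<in>F. 0 \<le> f y) \<longrightarrow>
    (\<forall>y\<in>F. tot_weight V w y * f y = s * ((\<Sum>y'\<in>F. w y y' * f y') + weight_into V w z y)) \<longrightarrow>
    y \<in> F \<longrightarrow> ?H y \<le> f y + \<eta> / 2"
  have "\<forall>y\<in>Y. \<exists>A. finite A \<and> A \<subseteq> V - z \<and> (\<forall>F f. ?P y A F f)"
  proof (intro ballI)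
    fix y assume "y \<in> Y"
    then have "y \<in> V" using Y by auto
    moreover have "0 < \<eta> / 2" using Suc.prems by simp
    ultimately show "\<exists>A. finite A \<and> A \<subseteq> V - z \<and> (\<forall>F f. ?P y A F f)"
      by (rule Suc.IH)
  qed
  from bchoice[OF this] obtain A where A': "\<forall>y\<in>Y. finite (A y) \<and> A y \<subseteq> V - z \<and> (\<forall>F f. ?P y (A y) F f)"
    by (elim exE)
  have A: "finite (A y)" "A y \<subseteq> V - z" "\<forall>F f. ?P y (A y) F f" if "y \<in> Y" for y
  proof -
    note A_y = bspec[OF A' that]
    show "finite (A y)" "A y \<subseteq> V - z" by (rule conjunct1[OF A_y], rule conjunct1[OF conjunct2[OF A_y]])
    show "\<forall>F f. ?P y (A y) F f" by (rule conjunct2[OF conjunct2[OF A_y]])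
  qed
  show ?case
  proof (intro exI[of _ "Y \<union> (\<Union>y\<in>Y. A y)"] conjI allI impI)
    show "finite (Y \<union> (\<Union>y\<in>Y. A y))" using A Y by auto
    show "Y \<union> (\<Union>y\<in>Y. A y) \<subseteq> V - z" using A Y by auto
    fix F f
    assume F: "finite F" "Y \<union> (\<Union>y\<in>Y. A y) \<subseteq> F" "F \<subseteq> V - z" and f: "\<forall>y\<in>F. 0 \<le> f y"
      and feq: "\<forall>y\<in>F. tot_weight V w y * f y = s * ((\<Sum>y'\<in>F. w y y' * f y') + weight_into V w z y)"
      and x: "x \<in> F"
    have H: "?H y \<le> f y + \<eta> / 2" if "y \<in> Y" for y
    proof (rule A(3)[OF that, rule_format, OF F(1) _ F(3)])
      show "A y \<subseteq> F" "y \<in> F" using F(2) that by auto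
    qed (use f feq in blast)+
    have H01: "0 \<le> ?H y" "?H y \<le> 1" for y
      by (rule hit_gen_nonneg[OF assms(1)], rule hit_gen_le_1[OF assms(1,2)])
    have tp: "0 < tot_weight V w x" using tot_weight_pos[OF Suc.prems(1)] .
    have mass: "1 - \<eta> / 2 \<le> measure ?p (Y \<union> z)"
    proof -
      have "(\<Sum>y\<in>Y0. pmf ?p y) = measure ?p Y0"
        using Y0 by (simp add: measure_measure_pmf_finite)
      also have "\<dots> \<le> measure ?p (Y \<union> z)"
        by (intro measure_pmf.finite_measure_mono) (auto simp: Y_def)
      finally show ?thesis using Y0(3) by simp
    qed
    have "hit_gen s (walk_step V w) z (Suc m) x \<le>
        s * (measure ?p z + (\<Sum>y\<in>Y. pmf ?p y * ?H y) + \<eta> / 2)"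
      unfolding hit_gen_Suc using Y H01 mass assms
      by (intro mult_left_mono expectation_finite_approx) auto
    also have "(\<Sum>y\<in>Y. pmf ?p y * ?H y) \<le> (\<Sum>y\<in>Y. pmf ?p y * f y) + \<eta> / 2"
    proof -
      have "(\<Sum>y\<in>Y. pmf ?p y * ?H y) \<le> (\<Sum>y\<in>Y. pmf ?p y * (f y + \<eta> / 2))"
        by (intro sum_mono mult_left_mono H) auto
      also have "\<dots> = (\<Sum>y\<in>Y. pmf ?p y * f y) + measure ?p Y * (\<eta> / 2)"
        using Y by (simp add: distrib_left sum.distrib sum_distrib_right measure_measure_pmf_finite)
      also have "measure ?p Y * (\<eta> / 2) \<le> 1 * (\<eta> / 2)"
        using Suc.prems by (intro mult_right_mono) auto
      finally show ?thesis by simp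
    qed
    also have "(\<Sum>y\<in>Y. pmf ?p y * f y) \<le> (\<Sum>y\<in>F. pmf ?p y * f y)"
      using F f by (intro sum_mono2) auto
    also have "s * (measure ?p z + ((\<Sum>y\<in>F. pmf ?p y * f y) + \<eta> / 2) + \<eta> / 2)
        = s * (measure ?p z + (\<Sum>y\<in>F. pmf ?p y * f y)) + s * \<eta>"
      by (simp add: algebra_simps)
    also have "s * (measure ?p z + (\<Sum>y\<in>F. pmf ?p y * f y)) = f x"
    proof -
      have "tot_weight V w x * f x = tot_weight V w x * (s * (measure ?p z + (\<Sum>y\<in>F. pmf ?p y * f y)))"
      proof -
        have "(\<Sum>y\<in>F. w x y * f y) = tot_weight V w x * (\<Sum>y\<in>F. pmf ?p y * f y)"
          unfolding sum_distrib_left using F Suc.prems(1)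
          by (intro sum.cong refl) (auto simp: weight_eq_pmf[of x])
        then show ?thesis
          unfolding bspec[OF feq x] weight_into_def by (simp add: algebra_simps)
      qed
      then show ?thesis using tp by simp
    qed
    also have "f x + s * \<eta> \<le> f x + \<eta>"
      using assms Suc.prems by (simp add: mult_left_le_one_le)
    finally show "hit_gen s (walk_step V w) z (Suc m) x \<le> f x + \<eta>"
      using assms by (simp add: mult_left_mono)
  qed
qed

text \<open>A finite network whose function \<open>h\<close> at \<open>u\<close> is at least the truncated generating function up to \<open>\<eta>\<close>.  The bound on
  \<open>v u\<close> holds since the expected discounted number of visits is at most \<open>1 / (1 - s)\<close>.\<close>

lemma killed_network_exists:
  assumes u: "u \<in> V - z" and s: "0 < s" "s < 1" and eta: "0 < \<eta>" "\<eta> < hit_gen s (walk_step V w) z m u"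
  shows "\<exists>F h v. killed_network F w (tot_weight V w) (weight_into V w z) s u h v \<and> F \<subseteq> V - z \<and>
    hit_gen s (walk_step V w) z m u \<le> h u + \<eta> \<and> (\<forall>x\<in>F. h x \<le> 1) \<and>
    v u \<le> 1 / ((1 - s) * tot_weight V w u)"
proof -
  let ?t = "tot_weight V w" and ?b = "weight_into V w z"
  have uV: "u \<in> V" using u by simp
  obtain F0 where F0: "finite F0" "F0 \<subseteq> V - z" and F0': "\<forall>F f. finite F \<longrightarrow> F0 \<subseteq> F \<longrightarrow> F \<subseteq> V - z \<longrightarrow>
    (\<forall>y\<in>F. 0 \<le> f y) \<longrightarrow> (\<forall>y\<in>F. ?t y * f y = s * ((\<Sum>y'\<in>F. w y y' * f y') + ?b y)) \<longrightarrow>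
    u \<in> F \<longrightarrow> hit_gen s (walk_step V w) z m u \<le> f u + \<eta>"
    using hit_gen_le_finite_network[of s u \<eta> m, OF less_imp_le[OF s(1)] less_imp_le[OF s(2)] uV eta(1)]
    by (elim exE conjE)
  define F where "F = insert u F0"
  have F: "finite F" "F0 \<subseteq> F" "F \<subseteq> V - z" "u \<in> F" using F0 u by (auto simp: F_def)
  have FV: "x \<in> V" if "x \<in> F" for x using F that by auto
  have wn: "0 \<le> w x y" if "x \<in> F" "y \<in> F" for x y using weight_nonneg FV that by blast
  have tp: "0 < ?t x" if "x \<in> F" for x using tot_weight_pos FV that by blast
  have bn: "0 \<le> ?b x" if "x \<in> F" for x
    using tp[OF that] by (simp add: weight_into_def)
  have tg: "(\<Sum>y\<in>F. w x y) + ?b x \<le> ?t x" if "x \<in> F" for x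
    using sum_weight_into_le[OF FV[OF that] F(1,3)] .
  have sw: "s * a \<le> a" if "0 \<le> a" for a using that s by (simp add: mult_left_le_one_le)
  have "\<exists>h. \<forall>x\<in>F. ?t x * h x = s * ?b x + s * (\<Sum>y\<in>F. w x y * h y) \<and> 0 \<le> h x \<and> h x \<le> 1"
  proof (rule linear_fixpoint_exists[of F w ?t s "\<lambda>x. s * ?b x" 1, OF F(1) wn tp])
    show "0 \<le> s" "(0::real) \<le> 1" using s by simp_all
    show "0 \<le> s * ?b x" if "x \<in> F" for x using bn[OF that] s by simp
    fix x assume x: "x \<in> F"
    have "s * ?b x + s * (\<Sum>y\<in>F. w x y) \<le> ?b x + (\<Sum>y\<in>F. w x y)"
      using bn[OF x] wn[OF x] by (intro add_mono sw sum_nonneg)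
    with tg[OF x] show "s * ?b x + s * (\<Sum>y\<in>F. w x y * 1) \<le> ?t x * 1" by simp
  qed
  then obtain h where h: "\<And>x. x \<in> F \<Longrightarrow> ?t x * h x = s * ?b x + s * (\<Sum>y\<in>F. w x y * h y)"
    "\<And>x. x \<in> F \<Longrightarrow> 0 \<le> h x" "\<And>x. x \<in> F \<Longrightarrow> h x \<le> 1"
    by blast
  define B where "B = 1 / ((1 - s) * ?t u)"
  have B: "0 < B" using s tp[OF F(4)] by (simp add: B_def)
  have "\<exists>v. \<forall>x\<in>F. ?t x * v x = (if x = u then 1 else 0) + s * (\<Sum>y\<in>F. w x y * v y) \<and> 0 \<le> v x \<and> v x \<le> B"
  proof (rule linear_fixpoint_exists[of F w ?t s "\<lambda>x. if x = u then 1 else 0" B, OF F(1) wn tp])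
    show "0 \<le> s" "0 \<le> B" using s B by simp_all
    show "0 \<le> (if x = u then 1 else 0 :: real)" for x by simp
    fix x assume x: "x \<in> F"
    have "s * (\<Sum>y\<in>F. w x y * B) \<le> s * (?t x * B)"
      using tg[OF x] bn[OF x] s B
      by (intro mult_left_mono) (auto simp: sum_distrib_right[symmetric])
    moreover have "(if x = u then 1 else 0) \<le> (1 - s) * (?t x * B)"
      using s tp[OF x] tp[OF F(4)] B by (auto simp: B_def)
    ultimately show "(if x = u then 1 else 0) + s * (\<Sum>y\<in>F. w x y * B) \<le> ?t x * B"
      by (simp add: algebra_simps)
  qed
  then obtain v where v: "\<And>x. x \<in> F \<Longrightarrow> ?t x * v x = (if x = u then 1 else 0) + s * (\<Sum>y\<in>F. w x y * v y)"
    "\<And>x. x \<in> F \<Longrightarrow> 0 \<le> v x" "\<And>x. x \<in> F \<Longrightarrow> v x \<le> B"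
    by blast
  have hu: "hit_gen s (walk_step V w) z m u \<le> h u + \<eta>"
  proof (rule F0'[rule_format, OF F(1,2,3) _ _ F(4)])
    fix y assume "y \<in> F"
    then show "0 \<le> h y" "?t y * h y = s * ((\<Sum>y'\<in>F. w y y' * h y') + ?b y)"
      using h by (simp_all add: distrib_left)
  qed
  then have hu_pos: "0 < h u" using eta by simp
  have vu_pos: "0 < v u"
  proof -
    have "0 \<le> s * (\<Sum>y\<in>F. w u y * v y)"
      using s wn F v by (intro mult_nonneg_nonneg sum_nonneg) auto
    then have "0 < ?t u * v u" using v(1)[OF F(4)] by simp
    then show ?thesis using tp[OF F(4)] by (simp add: zero_less_mult_iff)
  qed
  \<comment> \<open>The logarithms of \<open>h\<close> and \<open>v\<close> are needed, so the network is restricted to the vertices where both are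
    positive.  No edge leaves this set, so the equations persist.\<close>
  define S where "S = {x \<in> F. 0 < h x \<and> 0 < v x}"
  have S: "finite S" "S \<subseteq> F" "u \<in> S" using F hu_pos vu_pos by (auto simp: S_def)
  have closed: "w x y = 0" if "x \<in> S" "y \<in> F - S" for x y
  proof (rule ccontr)
    assume "w x y \<noteq> 0"
    have xF: "x \<in> F" and yF: "y \<in> F" using that S by auto
    have wyx: "0 < w y x"
      using \<open>w x y \<noteq> 0\<close> wn[OF xF yF] weight_sym[of x y] FV xF yF by simp
    have "s * (w y x * h x) \<le> s * (\<Sum>y'\<in>F. w y y' * h y')"
      using s wn[OF yF] h xF F by (intro mult_left_mono member_le_sum) auto
    then have "s * (w y x * h x) \<le> ?t y * h y"
      using h(1)[OF yF] bn[OF yF] s by (simp add: add_increasing)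
    moreover have "0 < s * (w y x * h x)" using s wyx that by (simp add: S_def)
    ultimately have hy: "0 < h y" using tp[OF yF] by (smt (verit) zero_less_mult_pos)
    have "s * (w y x * v x) \<le> s * (\<Sum>y'\<in>F. w y y' * v y')"
      using s wn[OF yF] v xF F by (intro mult_left_mono member_le_sum) auto
    then have "s * (w y x * v x) \<le> ?t y * v y"
      using v(1)[OF yF] by (simp add: add_increasing)
    moreover have "0 < s * (w y x * v x)" using s wyx that by (simp add: S_def)
    ultimately have "0 < v y" using tp[OF yF] by (smt (verit) zero_less_mult_pos)
    with hy that show False by (simp add: S_def)
  qed
  have restr: "(\<Sum>y\<in>F. w x y * f y) = (\<Sum>y\<in>S. w x y * f y)" if "x \<in> S" for x and f :: "'v \<Rightarrow> real"
    using S F closed[OF that] by (intro sum.mono_neutral_right) auto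
  have "killed_network S w ?t ?b s u h v"
  proof
    fix x assume x: "x \<in> S"
    then have xF: "x \<in> F" using S by auto
    show "0 \<le> ?b x" "0 < ?t x" using bn tp xF by auto
    have "(\<Sum>y\<in>S. w x y) \<le> (\<Sum>y\<in>F. w x y)"
      using S F wn[OF xF] by (intro sum_mono2) auto
    then show "(\<Sum>y\<in>S. w x y) + ?b x \<le> ?t x" using tg[OF xF] by simp
    show "0 < h x" "0 < v x" using x by (auto simp: S_def)
    show "?t x * h x = s * ((\<Sum>y\<in>S. w x y * h y) + ?b x)"
      using h(1)[OF xF] restr[OF x] by (simp add: distrib_left)
    show "?t x * v x = (if x = u then 1 else 0) + s * (\<Sum>y\<in>S. w x y * v y)"
      using v(1)[OF xF] restr[OF x] by simp
    fix y assume "y \<in> S"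
    then show "0 \<le> w x y" "w x y = w y x"
      using wn weight_sym FV S xF by blast+
  qed (use S s in auto)
  then show ?thesis
    using hu h(3) v(3)[OF F(4)] S F by (intro exI[of _ S] exI[of _ h] exI[of _ v]) (auto simp: B_def)
qed

end

section \<open>Bounds for all admissible graphs\<close>

lemma admissibleD:
  assumes "(V, w, u, z) \<in> admissible C g n"
  shows "weighted_graph V w" "u \<in> V" "z \<subseteq> V"
    and "\<And>y k. y \<in> z \<Longrightarrow> (u, y) \<in> edges V w ^^ k \<Longrightarrow> n \<le> k"
    and "0 < n \<Longrightarrow> u \<notin> z"
    and "set_weight V w z \<le> ennreal (C * g ^ n) * ennreal (tot_weight V w u)"
proof -
  show G: "weighted_graph V w" and u: "u \<in> V" and z: "z \<subseteq> V"
    using assms by (auto simp: admissible_def)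
  show dist: "n \<le> k" if "y \<in> z" "(u, y) \<in> edges V w ^^ k" for y k
  proof -
    have "enat n \<le> graph_dist V w u z" using assms by (simp add: admissible_def)
    also have "\<dots> \<le> enat k"
      unfolding graph_dist_def by (rule INF_lower) (use that in auto)
    finally show ?thesis by simp
  qed
  show "u \<notin> z" if "0 < n"
    using dist[of u 0] that by auto
  let ?c = "vertex_weight V w u"
  have c: "?c \<noteq> 0" "?c \<noteq> \<infinity>"
    using G u by (auto simp: weighted_graph_def)
  have "set_weight V w z = set_weight V w z / ?c * ?c"
    using c by (metis ennreal_divide_self ennreal_times_divide infinity_ennreal_def mult.commute mult.right_neutral top.not_eq_extremum)
  also have "\<dots> \<le> ennreal (C * g ^ n) * ?c"
    using assms by (intro mult_right_mono) (auto simp: admissible_def)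
  finally show "set_weight V w z \<le> ennreal (C * g ^ n) * ennreal (tot_weight V w u)"
    using ennreal_tot_weight[OF G z u] by simp
qed

text \<open>The distance from \<open>u\<close> truncated at \<open>n\<close>, so that it is finite also at vertices that cannot be reached.\<close>

definition level :: "'v set \<Rightarrow> ('v \<Rightarrow> 'v \<Rightarrow> real) \<Rightarrow> nat \<Rightarrow> 'v \<Rightarrow> 'v \<Rightarrow> nat" where
  "level V w n u x = (LEAST k. k = n \<or> (u, x) \<in> edges V w ^^ k)"

lemma level_cases: "level V w n u x = n \<or> (u, x) \<in> edges V w ^^ level V w n u x"
  unfolding level_def by (rule LeastI[of _ n]) simp

lemma level_le: "level V w n u x \<le> n"
  unfolding level_def by (rule Least_le) simp

lemma level_le_path: "(u, x) \<in> edges V w ^^ k \<Longrightarrow> level V w n u x \<le> k"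
  unfolding level_def by (rule Least_le) simp

lemma level_step:
  assumes "(x, y) \<in> edges V w"
  shows "level V w n u y \<le> level V w n u x + 1"
proof (cases "level V w n u x = n")
  case True
  then show ?thesis using level_le[of V w n u y] by simp
next
  case False
  then have "(u, y) \<in> edges V w ^^ Suc (level V w n u x)"
    using level_cases[of V w n u x] assms by auto
  from level_le_path[OF this, of n] show ?thesis by simp
qed

lemma admissible_network:
  assumes adm: "(V, w, u, z) \<in> admissible C g n" and n: "0 < n" and s: "0 < s" "s < 1"
    and eta: "0 < \<eta>" "\<eta> < hit_gen s (walk_step V w) z m u" and C: "0 < C" "0 < g"
  obtains F h v where "killed_network F w (tot_weight V w) (weight_into V w z) s u h v"
    "hit_gen s (walk_step V w) z m u \<le> h u + \<eta>"
    "\<And>x. x \<in> F \<Longrightarrow> h x \<le> 1"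
    "v u \<le> 1 / ((1 - s) * tot_weight V w u)"
    "(\<Sum>x\<in>F. weight_into V w z x) \<le> C * g ^ n * tot_weight V w u"
    "\<And>x y. x \<in> F \<Longrightarrow> y \<in> F \<Longrightarrow> 0 < w x y \<Longrightarrow> \<bar>real (level V w n u y) - real (level V w n u x)\<bar> \<le> 1"
    "real (level V w n u u) = 0"
    "\<And>x. x \<in> F \<Longrightarrow> 0 < weight_into V w z x \<Longrightarrow> real n - 1 \<le> real (level V w n u x)"
proof -
  note A = admissibleD[OF adm]
  have uz: "u \<in> V - z" using A(2) A(5)[OF n] by simp
  obtain F h v where F: "killed_network F w (tot_weight V w) (weight_into V w z) s u h v" "F \<subseteq> V - z"
    "hit_gen s (walk_step V w) z m u \<le> h u + \<eta>" "\<forall>x\<in>F. h x \<le> 1" "v u \<le> 1 / ((1 - s) * tot_weight V w u)"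
    using killed_network_exists[OF A(1,3) uz s eta] by blast
  interpret killed_network F w "tot_weight V w" "weight_into V w z" s u h v by fact
  have "ennreal (\<Sum>x\<in>F. weight_into V w z x) \<le> set_weight V w z"
    using F(2) by (intro sum_weight_into_le_set_weight[OF A(1,3) finite_F]) auto
  also have "\<dots> \<le> ennreal (C * g ^ n * tot_weight V w u)"
    using A(6) C tot_pos[OF u_in] by (simp add: ennreal_mult)
  finally have W: "(\<Sum>x\<in>F. weight_into V w z x) \<le> C * g ^ n * tot_weight V w u"
    using C tot_pos[OF u_in] by (subst (asm) ennreal_le_iff) auto
  have lip: "\<bar>real (level V w n u y) - real (level V w n u x)\<bar> \<le> 1" if "x \<in> F" "y \<in> F" "0 < w x y" for x y
  proof -
    have "(x, y) \<in> edges V w" "(y, x) \<in> edges V w"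
      using that F(2) w_sym[of x y] by (auto simp: edges_def)
    from this[THEN level_step[of _ _ V w n u]] show ?thesis by linarith
  qed
  have start: "real (level V w n u u) = 0"
    using level_le_path[where x=u and u=u and k=0 and V=V and w=w and n=n] by simp
  have exit: "real n - 1 \<le> real (level V w n u x)" if x: "x \<in> F" "0 < weight_into V w z x" for x
  proof (cases "level V w n u x = n")
    case False
    have xV: "x \<in> V" using x F(2) by auto
    have "measure (walk_step V w x) z \<noteq> 0"
      using x(2) by (auto simp: weight_into_def)
    then obtain y where y: "y \<in> z" "y \<in> set_pmf (walk_step V w x)"
      by (auto simp: measure_pmf_zero_iff)
    then have "(x, y) \<in> edges V w"
      using xV set_pmf_walk_step[OF A(1,3) xV] by (auto simp: edges_def)
    moreover have "(u, x) \<in> edges V w ^^ level V w n u x"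
      using level_cases[of V w n u x] False by simp
    ultimately have "(u, y) \<in> edges V w ^^ Suc (level V w n u x)" by auto
    from A(4)[OF y(1) this] show ?thesis by simp
  qed simp
  show ?thesis
    by (rule that[OF F(1,3) _ F(5) W lip start exit]) (use F(4) in auto)
qed

text \<open>In \<open>laplace_bound\<close> the weight of the target enters as \<open>\<mu> n ln g\<close>, which cancels the second term on its left
  side.  Up to a constant and the factor \<open>s\<close>, what is left is \<open>- n\<close> times the logarithm of the generating
  function of the passage time of the biased walk to the right neighbour.\<close>

theorem hit_gen_upper_bound:
  fixes C g G :: real
  assumes "1 < g" "g < G" "1 < C"
  defines "s \<equiv> tilt_factor g G"
  shows "\<exists>K>0. \<forall>n (V :: 'v set) w u z m. (V, w, u, z) \<in> admissible C g n \<longrightarrow> 0 < n \<longrightarrow>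
    hit_gen s (walk_step V w) z m u \<le> K * exp (- (real n * ((ln G - ln g) / 2)))"
proof -
  define r where "r = tilt_skew g G"
  define a where "a = (s + r) / 2"
  define b where "b = (s - r) / 2"
  have s: "0 < s" "s < 1"
    unfolding s_def using tilt_factor_pos tilt_factor_less_1[OF assms(1,2)] by auto
  have r_le_s: "r \<le> s" unfolding r_def s_def by (rule tilt_skew_le_factor[OF assms(1,2)])
  have b: "0 \<le> b" using r_le_s by (simp add: b_def)
  define K where "K = exp (((s * ln G - r * ln g) / 2 + b * ln (C / (1 - s)) + s - a + a * ln a) / s)"
  have K_pos: "0 < K" by (simp add: K_def)
  have lnK: "s * ln K = (s * ln G - r * ln g) / 2 + b * ln (C / (1 - s)) + s - a + a * ln a"
    using s by (simp add: K_def)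
  have bound: "hit_gen s (walk_step V w) z m u \<le> K * exp (- (real n * ((ln G - ln g) / 2))) + \<eta>"
    if adm: "(V, w, u, z) \<in> admissible C g n" "0 < n" and eta: "0 < \<eta>"
    for n and V :: "'v set" and w u z m \<eta>
  proof (cases "\<eta> < hit_gen s (walk_step V w) z m u")
    case False
    have "0 < K * exp (- (real n * ((ln G - ln g) / 2)))" by (simp add: K_def)
    with False show ?thesis by linarith
  next
    case True
    have Cg: "0 < C" "0 < g" using assms by auto
    obtain F h v where N: "killed_network F w (tot_weight V w) (weight_into V w z) s u h v"
      and hu: "hit_gen s (walk_step V w) z m u \<le> h u + \<eta>"
      and vu: "v u \<le> 1 / ((1 - s) * tot_weight V w u)"
      and W: "(\<Sum>x\<in>F. weight_into V w z x) \<le> C * g ^ n * tot_weight V w u"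
      and lev: "\<And>x y. x \<in> F \<Longrightarrow> y \<in> F \<Longrightarrow> 0 < w x y \<Longrightarrow> \<bar>real (level V w n u y) - real (level V w n u x)\<bar> \<le> 1"
        "real (level V w n u u) = 0"
        "\<And>x. x \<in> F \<Longrightarrow> 0 < weight_into V w z x \<Longrightarrow> real n - 1 \<le> real (level V w n u x)"
      by (rule admissible_network[OF adm s eta True Cg]) blast
    interpret killed_network F w "tot_weight V w" "weight_into V w z" s u h v by fact
    let ?B = "\<Sum>x\<in>F. weight_into V w z x"
    have L: "s * (ln G - ln g) / 2 * real n + b * (real n * ln g) - (s * ln G - r * ln g) / 2
       - b * ln (v u * ?B) - s + a - a * ln a \<le> s * (- ln (h u))"
      unfolding a_def b_def r_def
      
      by (rule laplace_bound[where lev="\<lambda>x. real (level V w n u x)" and n="real n",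
          OF assms(1,2) s_def[THEN meta_eq_to_obj_eq] lev])
    have "ln (v u * ?B) \<le> ln (C / (1 - s)) + real n * ln g"
    proof -
      have "v u * ?B \<le> (1 / ((1 - s) * tot_weight V w u)) * (C * g ^ n * tot_weight V w u)"
        using vu W escape_weight_pos s tot_pos[OF u_in] v_pos[OF u_in] by (intro mult_mono) auto
      also have "\<dots> = C / (1 - s) * g ^ n"
        using s tot_pos[OF u_in] by (simp add: field_simps)
      finally have "ln (v u * ?B) \<le> ln (C / (1 - s) * g ^ n)"
        using v_pos[OF u_in] escape_weight_pos Cg s by (subst ln_le_cancel_iff) auto
      also have "\<dots> = ln (C / (1 - s)) + real n * ln g"
        using Cg s by (subst ln_mult) (simp_all add: ln_realpow)
      finally show ?thesis .
    qed
    then have "b * ln (v u * ?B) \<le> b * (ln (C / (1 - s)) + real n * ln g)"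
      using b by (rule mult_left_mono)
    then have "s * (ln (h u)) \<le> s * (ln K - real n * ((ln G - ln g) / 2))"
      unfolding right_diff_distrib lnK using L by (simp add: algebra_simps)
    then have "ln (h u) \<le> ln K - real n * ((ln G - ln g) / 2)"
      using s by simp
    then have "h u \<le> exp (ln K - real n * ((ln G - ln g) / 2))"
      using h_pos[OF u_in] by (metis exp_le_cancel_iff exp_ln)
    also have "\<dots> = K * exp (- (real n * ((ln G - ln g) / 2)))"
      using K_pos by (simp only: exp_diff exp_minus divide_inverse exp_ln)
    finally show ?thesis using hu by simp
  qed
  have "hit_gen s (walk_step V w) z m u \<le> K * exp (- (real n * ((ln G - ln g) / 2)))"
    if "(V, w, u, z) \<in> admissible C g n" "0 < n" for n and V :: "'v set" and w u z m
  proof (rule field_le_epsilon)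
    fix \<eta> :: real assume "0 < \<eta>"
    with that show "hit_gen s (walk_step V w) z m u \<le> K * exp (- (real n * ((ln G - ln g) / 2))) + \<eta>"
      by (rule bound)
  qed
  with K_pos show ?thesis
    by (intro exI[of _ K] conjI allI impI)
qed

lemma mean_limit:
  fixes t k :: real
  assumes "0 < t"
  shows "((\<lambda>e. (1 + 2 * k * e) * (- ln (1 - e * t - e\<^sup>2)) / e) \<longlongrightarrow> t) (at_right 0)"
  using assms by real_asymp

text \<open>A finite mean \<open>t\<close> forces \<open>h u \<ge> 1 - e t - e\<^sup>2\<close> for \<open>s = 1 - e\<close> in a suitable finite network.  Inserted in
  \<open>mean_bound\<close> and divided by \<open>e\<close>, this gives the claim as \<open>e\<close> tends to \<open>0\<close>.\<close>

theorem mean_lower_bound: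
  fixes C g :: real
  assumes "1 < g" "1 < C"
  shows "\<exists>K. \<forall>n (V :: 'v set) w u z t. (V, w, u, z) \<in> admissible C g n \<longrightarrow> 0 < n \<longrightarrow>
    (\<forall>m. (\<Sum>k<m. survival (walk_step V w) z k u) \<le> t) \<longrightarrow> biased_mean g * real n - K \<le> t"
proof -
  define k where "k = 2 * g / (g - 1)\<^sup>2"
  define A where "A = biased_mean g + k * ln g"
  define K where "K = 2 * A + 1 - k + k * ln k + k * ln C"
  have main: "biased_mean g * real n - K \<le> t"
    if adm: "(V, w, u, z) \<in> admissible C g n" "0 < n"
      and t: "\<And>m. (\<Sum>k<m. survival (walk_step V w) z k u) \<le> t"
    for n and V :: "'v set" and w u z t
  proof -
    have Cg: "0 < C" "0 < g" using assms by auto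
    have t1: "1 \<le> t" using t[of 1] by simp
    have step: "biased_mean g * real n - K \<le> (1 + 2 * k * e) * (- ln (1 - e * t - e\<^sup>2)) / e"
      if e: "0 < e" "e < 1" "0 < 1 - e * t - e\<^sup>2" for e
    proof -
      define s where "s = 1 - e"
      have s: "0 < s" "s < 1" using e by (auto simp: s_def)
      have e2: "0 < e\<^sup>2 / 2" using e by simp
      \<comment> \<open>Truncation in time and in space may each cost \<open>e\<^sup>2 / 2\<close>, which is of second order.\<close>
      obtain m where m: "s ^ m < e\<^sup>2 / 2"
        using real_arch_pow_inv[OF e2 s(2)] by blast
      have "1 - hit_gen s (walk_step V w) z m u \<le>
          (1 - s) * (\<Sum>k<m. survival (walk_step V w) z k u) + s ^ m * survival (walk_step V w) z m u"
        using s by (intro hit_gen_ge_mean) auto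
      also have "\<dots> \<le> e * t + s ^ m * 1"
        using e s t[of m] by (intro add_mono mult_mono survival_bounds) (auto simp: s_def intro!: sum_nonneg survival_bounds)
      finally have H: "1 - e * t - e\<^sup>2 / 2 < hit_gen s (walk_step V w) z m u"
        using m by simp
      then have eta: "e\<^sup>2 / 2 < hit_gen s (walk_step V w) z m u" using e by simp
      obtain F h v where N: "killed_network F w (tot_weight V w) (weight_into V w z) s u h v"
        and hu: "hit_gen s (walk_step V w) z m u \<le> h u + e\<^sup>2 / 2"
        and h1: "\<And>x. x \<in> F \<Longrightarrow> h x \<le> 1"
        and W: "(\<Sum>x\<in>F. weight_into V w z x) \<le> C * g ^ n * tot_weight V w u"
        and lev: "\<And>x y. x \<in> F \<Longrightarrow> y \<in> F \<Longrightarrow> 0 < w x y \<Longrightarrow> \<bar>real (level V w n u y) - real (level V w n u x)\<bar> \<le> 1"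
          "real (level V w n u u) = 0"
          "\<And>x. x \<in> F \<Longrightarrow> 0 < weight_into V w z x \<Longrightarrow> real n - 1 \<le> real (level V w n u x)"
        by (rule admissible_network[OF adm s e2 eta Cg]) blast
      interpret killed_network F w "tot_weight V w" "weight_into V w z" s u h v by fact
      have "(1 - s) * (A * (real n - 2) - 1 + k - k * ln k - k * ln (C * g ^ n)) \<le> (1 + 2 * k * (1 - s)) * (- ln (h u))"
        unfolding A_def k_def biased_mean_def 
        by (rule mean_bound[where lev="\<lambda>x. real (level V w n u x)" and n="real n" and W="C * g ^ n",
            OF assms(1) lev h1 W])
      moreover have "A * (real n - 2) - 1 + k - k * ln k - k * ln (C * g ^ n) = biased_mean g * real n - K"
        using Cg by (simp add: A_def K_def ln_mult ln_realpow algebra_simps)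
      ultimately have "e * (biased_mean g * real n - K) \<le> (1 + 2 * k * e) * (- ln (h u))"
        by (simp add: s_def)
      also have "\<dots> \<le> (1 + 2 * k * e) * (- ln (1 - e * t - e\<^sup>2))"
      proof (rule mult_left_mono)
        have "1 - e * t - e\<^sup>2 \<le> h u" using H hu by simp
        then show "- ln (h u) \<le> - ln (1 - e * t - e\<^sup>2)" using e by simp
        show "0 \<le> 1 + 2 * k * e" using e Cg by (simp add: k_def)
      qed
      finally show ?thesis using e(1) by (metis mult.commute pos_le_divide_eq)
    qed
    have "eventually (\<lambda>e. biased_mean g * real n - K \<le> (1 + 2 * k * e) * (- ln (1 - e * t - e\<^sup>2)) / e) (at_right 0)"
    proof -
      have "((\<lambda>e. 1 - e * t - e\<^sup>2) \<longlongrightarrow> 1 - 0 * t - 0\<^sup>2) (at_right 0)"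
        by (intro tendsto_intros)
      then have "eventually (\<lambda>e. 0 < 1 - e * t - e\<^sup>2) (at_right (0::real))"
        by (rule order_tendstoD) simp
      moreover have "eventually (\<lambda>e. 0 < e \<and> e < 1) (at_right (0::real))"
        using eventually_at_right_less[of "0::real"] eventually_at_right_field[of "\<lambda>e. e < 1" "0::real"]
        by (auto simp: eventually_at_right_field intro!: exI[of _ 1])
      ultimately show ?thesis
        by eventually_elim (rule step, auto)
    qed
    moreover have "((\<lambda>e. (1 + 2 * k * e) * (- ln (1 - e * t - e\<^sup>2)) / e) \<longlongrightarrow> t) (at_right 0)"
      using t1 by (intro mean_limit) simp
    ultimately show ?thesis
      by (intro tendsto_lowerbound[where F="at_right (0::real)"]) auto
  qed
  show ?thesis
    by (intro exI[of _ K] allI impI main) blast+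
qed

section \<open>The biased walk on a path\<close>

text \<open>The edge between \<open>k - 1\<close> and \<open>k\<close> has conductance \<open>g\<^sup>k\<close>, so inside the path the odds of a step to the right
  are \<open>g\<close>.\<close>

definition path_weight :: "real \<Rightarrow> nat \<Rightarrow> nat \<Rightarrow> real" where
  "path_weight g x y = (if y = Suc x \<or> x = Suc y then g ^ max x y else 0)"

context
  fixes g :: real and n :: nat
  assumes g: "1 < g" and n: "0 < n"
begin

lemma path_sum:
  assumes "x \<le> n"
  shows "(\<Sum>y\<in>{0..n}. path_weight g x y * f y) =
    (if 0 < x then g ^ x * f (x - 1) else 0) + (if x < n then g ^ Suc x * f (Suc x) else 0)"
proof -
  have "(\<Sum>y\<in>{0..n}. path_weight g x y * f y) =
     (\<Sum>y\<in>{0..n}. (if y = x - 1 \<and> 0 < x then g ^ x * f (x - 1) else 0) + (if y = Suc x then g ^ Suc x * f (Suc x) else 0))"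
    by (intro sum.cong refl) (auto simp: path_weight_def)
  also have "\<dots> = (if 0 < x then g ^ x * f (x - 1) else 0) + (if x < n then g ^ Suc x * f (Suc x) else 0)"
    using assms by (auto simp: sum.distrib)
  finally show ?thesis .
qed

lemma path_vertex_weight:
  assumes "x \<le> n"
  shows "vertex_weight {0..n} (path_weight g) x =
    ennreal ((if 0 < x then g ^ x else 0) + (if x < n then g ^ Suc x else 0))"
proof -
  have "vertex_weight {0..n} (path_weight g) x = (\<Sum>y\<in>{0..n}. ennreal (path_weight g x y))"
    unfolding vertex_weight_def by (rule infsum_finite) simp
  also have "\<dots> = ennreal (\<Sum>y\<in>{0..n}. path_weight g x y * 1)"
    using g by (subst sum_ennreal) (auto simp: path_weight_def)
  also have "\<dots> = ennreal ((if 0 < x then g ^ x else 0) + (if x < n then g ^ Suc x else 0))"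
    unfolding path_sum[OF assms, of "\<lambda>_. 1"] by simp
  finally show ?thesis .
qed

lemma path_weighted_graph: "weighted_graph {0..n} (path_weight g)"
proof -
  have "0 < (if 0 < x then g ^ x else 0) + (if x < n then g ^ Suc x else 0)" for x
    using g n by (auto intro: add_pos_pos simp del: power_Suc)
  then have "0 < vertex_weight {0..n} (path_weight g) x \<and> vertex_weight {0..n} (path_weight g) x < \<infinity>"
    if "x \<in> {0..n}" for x
    using that by (simp only: path_vertex_weight atLeastAtMost_iff ennreal_less_zero_iff
        infinity_ennreal_def ennreal_less_top simp_thms)
  then show ?thesis
    using g by (auto simp: weighted_graph_def path_weight_def max.commute)
qed

lemma path_expectation:
  assumes x: "x \<le> n"
  shows "measure_pmf.expectation (walk_step {0..n} (path_weight g) x) f =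
    ((if 0 < x then g ^ x * f (x - 1) else 0) + (if x < n then g ^ Suc x * f (Suc x) else 0)) /
    ((if 0 < x then g ^ x else 0) + (if x < n then g ^ Suc x else 0))"
proof -
  let ?p = "walk_step {0..n} (path_weight g) x"
  have t: "tot_weight {0..n} (path_weight g) x = (if 0 < x then g ^ x else 0) + (if x < n then g ^ Suc x else 0)"
    using g unfolding tot_weight_def path_vertex_weight[OF x] by (subst enn2real_ennreal) auto
  have "measure_pmf.expectation ?p f = (\<Sum>y\<in>{0..n}. f y * pmf ?p y)"
    using set_pmf_walk_step[OF path_weighted_graph order_refl, of x] x
    by (intro integral_measure_pmf_real) auto
  also have "\<dots> = (\<Sum>y\<in>{0..n}. path_weight g x y * f y / tot_weight {0..n} (path_weight g) x)"
    using x by (intro sum.cong refl) (simp add: pmf_walk_step[OF path_weighted_graph] tot_weight_def)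
  also have "\<dots> = (\<Sum>y\<in>{0..n}. path_weight g x y * f y) / tot_weight {0..n} (path_weight g) x"
    by (simp add: sum_divide_distrib)
  finally show ?thesis
    unfolding t path_sum[OF x] .
qed

lemma path_expectation_start:
  fixes f :: "nat \<Rightarrow> real"
  shows "measure_pmf.expectation (walk_step {0..n} (path_weight g) 0) f = f 1"
  using path_expectation[of 0 f] g n by simp

lemma path_expectation_inner:
  assumes x: "0 < x" "x < n"
  shows "measure_pmf.expectation (walk_step {0..n} (path_weight g) x) f = (f (x - 1) + g * f (Suc x)) / (1 + g)"
proof -
  have "(g ^ x * a + g ^ Suc x * b) / (g ^ x + g ^ Suc x) = (a + g * b) / (1 + g)" for a b
  proof -
    have "g ^ x * a + g ^ Suc x * b = g ^ x * (a + g * b)" "g ^ x + g ^ Suc x = g ^ x * (1 + g)"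
      by (simp_all add: algebra_simps)
    then show ?thesis using g by simp
  qed
  then show ?thesis using x by (subst path_expectation) auto
qed

lemma path_expectation_ge_step:
  assumes x: "x < n" and f: "\<And>y. 0 \<le> f y"
  shows "g / (1 + g) * f (Suc x) \<le> measure_pmf.expectation (walk_step {0..n} (path_weight g) x) f"
proof (cases "x = 0")
  case True
  have "g / (1 + g) * f 1 \<le> 1 * f 1"
    using g f by (intro mult_right_mono) auto
  then show ?thesis using True by (simp add: path_expectation_start)
next
  case False
  have "0 \<le> f (x - 1) / (1 + g)" using f g by simp
  then show ?thesis
    using False x by (simp add: path_expectation_inner add_divide_distrib)
qed

lemma path_admissible:
  assumes "1 < C"
  shows "({0..n}, path_weight g, 0, {n}) \<in> admissible C g n"
proof -
  have path: "y \<le> x + k" if "(x, y) \<in> edges {0..n} (path_weight g) ^^ k" for x y k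
    using that
  proof (induction k arbitrary: y)
    case (Suc k)
    then obtain y' where "(x, y') \<in> edges {0..n} (path_weight g) ^^ k" "(y', y) \<in> edges {0..n} (path_weight g)"
      by auto
    with Suc.IH[of y'] show ?case
      by (auto simp: edges_def path_weight_def split: if_splits)
  qed simp
  have "enat n \<le> graph_dist {0..n} (path_weight g) 0 {n}"
    unfolding graph_dist_def by (intro INF_greatest) (use path in fastforce)
  moreover have "set_weight {0..n} (path_weight g) {n} / vertex_weight {0..n} (path_weight g) 0 \<le> ennreal (C * g ^ n)"
  proof -
    have "set_weight {0..n} (path_weight g) {n} / vertex_weight {0..n} (path_weight g) 0 = ennreal (g ^ n / g)"
      using n g by (simp add: set_weight_def path_vertex_weight divide_ennreal)
    also have "g ^ n / g \<le> C * g ^ n"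
    proof -
      have "g ^ n / g \<le> g ^ n" using g by (simp add: divide_le_eq)
      also have "\<dots> \<le> C * g ^ n" using assms g by simp
      finally show ?thesis .
    qed
    finally show ?thesis using g by (simp add: ennreal_leI)
  qed
  ultimately show ?thesis
    using path_weighted_graph by (simp add: admissible_def)
qed

text \<open>The linear function on the right decreases by \<open>1\<close> on average in every step inside the path; at \<open>0\<close> it
  decreases by \<open>m\<^sub>g \<ge> 1\<close>.\<close>

lemma path_mean_le:
  assumes "x < n"
  shows "(\<Sum>k<m. survival (walk_step {0..n} (path_weight g)) {n} k x) \<le> biased_mean g * (real n - real x)"
  using assms
proof (induction m arbitrary: x)
  case 0
  then show ?case using g by (simp add: biased_mean_def)
next
  case (Suc m)
  let ?K = "walk_step {0..n} (path_weight g)"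
  let ?S = "\<lambda>y. if y = n then 0 else (\<Sum>k<m. survival ?K {n} k y)"
  let ?b = "\<lambda>y::nat. biased_mean g * (real n - real y)"
  have S: "?S y \<le> ?b y" if "y \<le> n" for y
    using Suc.IH[of y] that by (cases "y = n") auto
  have m1: "1 \<le> biased_mean g" using g by (simp add: biased_mean_def le_divide_eq)
  have "(\<Sum>k<Suc m. survival ?K {n} k x) = 1 + (\<Sum>k<m. survival ?K {n} (Suc k) x)"
    by (subst sum.lessThan_Suc_shift) simp
  also have "(\<Sum>k<m. survival ?K {n} (Suc k) x) = measure_pmf.expectation (?K x) (\<lambda>y. \<Sum>k<m. if y \<in> {n} then 0 else survival ?K {n} k y)"
    unfolding survival.simps by (intro Bochner_Integration.integral_sum[symmetric] integrable_survival)
  also have "(\<lambda>y. \<Sum>k<m. if y \<in> {n} then 0 else survival ?K {n} k y) = ?S"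
    by auto
  also have "1 + measure_pmf.expectation (?K x) ?S \<le> ?b x"
  proof (cases "x = 0")
    case True
    then show ?thesis
      using S[of 1] n m1 by (simp add: path_expectation_start algebra_simps)
  next
    case False
    then have x: "0 < x" "x < n" using Suc.prems by auto
    have "measure_pmf.expectation (?K x) ?S \<le> (?b (x - 1) + g * ?b (Suc x)) / (1 + g)"
      unfolding path_expectation_inner[OF x] using S[of "x - 1"] S[of "Suc x"] x g
      by (intro divide_right_mono add_mono mult_left_mono) auto
    also have "\<dots> = ?b x - 1"
    proof -
      have bg: "biased_mean g * (g - 1) = g + 1" using g by (simp add: biased_mean_def)
      have "?b (x - 1) + g * ?b (Suc x) = ?b x * (1 + g) - biased_mean g * (g - 1)"
        using x by (simp add: of_nat_diff algebra_simps)
      also have "\<dots> = (?b x - 1) * (1 + g)" unfolding bg by (simp add: algebra_simps)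
      finally show ?thesis using g by simp
    qed
    finally show ?thesis by simp
  qed
  finally show ?case .
qed

text \<open>The walk may go straight to \<open>n\<close>.\<close>

lemma path_hit_prob_pos:
  assumes "x < n" "n - x \<le> m"
  shows "(g / (1 + g)) ^ (n - x) \<le> 1 - survival (walk_step {0..n} (path_weight g)) {n} m x"
  using assms
proof (induction m arbitrary: x)
  case (Suc m)
  let ?K = "walk_step {0..n} (path_weight g)"
  let ?f = "\<lambda>y. 1 - (if y \<in> {n} then 0 else survival ?K {n} m y)"
  have "g / (1 + g) * ?f (Suc x) \<le> measure_pmf.expectation (?K x) ?f"
    using survival_bounds(2)[of ?K "{n}" m] by (intro path_expectation_ge_step[OF Suc.prems(1)]) simp
  also have "\<dots> = 1 - survival ?K {n} (Suc m) x"
    using integrable_survival[of "?K x" "{n}" ?K m]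
    by (subst Bochner_Integration.integral_diff) auto
  finally have step: "g / (1 + g) * ?f (Suc x) \<le> 1 - survival ?K {n} (Suc m) x" .
  have "(g / (1 + g)) ^ (n - Suc x) \<le> ?f (Suc x)"
    using Suc.IH[of "Suc x"] Suc.prems by (cases "Suc x = n") auto
  then have "g / (1 + g) * (g / (1 + g)) ^ (n - Suc x) \<le> g / (1 + g) * ?f (Suc x)"
    using g by (intro mult_left_mono) auto
  also have "g / (1 + g) * (g / (1 + g)) ^ (n - Suc x) = (g / (1 + g)) ^ (n - x)"
    using Suc.prems by (metis Suc_diff_Suc power_Suc)
  finally show ?case using step by linarith
qed simp

text \<open>The hypothesis on \<open>\<phi>\<close> is the equation, obtained from the first step, of the generating function of the passage
  time of the biased walk on the integers to the right neighbour.  It makes \<open>\<phi>\<^bsup>n-x\<^esup>\<close> harmonic for the discounted walk inside the path and subharmonic at the reflecting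
  end.  The term \<open>s\<^sup>m\<close> pays for the truncation.\<close>

lemma path_hit_gen_ge:
  fixes s \<phi> :: real
  assumes s: "0 < s" "s < 1" and phi: "0 < \<phi>" "\<phi> \<le> 1" "\<phi> * (1 + g) = s * (g + \<phi>\<^sup>2)"
    and "x < n"
  shows "\<phi> ^ (n - x) - s ^ m \<le> hit_gen s (walk_step {0..n} (path_weight g)) {n} m x"
  using \<open>x < n\<close>
proof (induction m arbitrary: x)
  case 0
  then show ?case using phi by (simp add: hit_gen_def power_le_one)
next
  case (Suc m)
  let ?K = "walk_step {0..n} (path_weight g)"
  let ?f = "\<lambda>y. if y \<in> {n} then 1 else hit_gen s ?K {n} m y"
  have f: "\<phi> ^ (n - y) - s ^ m \<le> ?f y" if "y \<le> n" for y
    using Suc.IH[of y] that s by (cases "y = n") auto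
  have "\<phi> ^ (n - x) - s * s ^ m \<le> s * measure_pmf.expectation (?K x) ?f"
  proof (cases "x = 0")
    case True
    have "\<phi> * (1 + g) \<le> s * (1 + g)"
      unfolding phi(3) using s phi by (intro mult_left_mono) (auto simp: power_le_one)
    then have "\<phi> \<le> s" using g by simp
    then have "\<phi> * \<phi> ^ (n - 1) \<le> s * \<phi> ^ (n - 1)"
      using phi by (intro mult_right_mono) auto
    then have "\<phi> ^ n - s * s ^ m \<le> s * (\<phi> ^ (n - 1) - s ^ m)"
      using n by (simp add: power_eq_if algebra_simps)
    also have "\<dots> \<le> s * ?f 1"
      using f[of 1] n s by (intro mult_left_mono) auto
    finally show ?thesis using True by (simp only: path_expectation_start diff_zero)
  next
    case False
    then have x: "0 < x" "x < n" using Suc.prems by auto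
    obtain j where j: "n - x = Suc j" using x by (metis Suc_diff_Suc)
    have nj: "n - Suc x = j" "n - (x - 1) = Suc (Suc j)" using j x by auto
    have "\<phi> ^ (n - x) * (1 + g) = s * (\<phi> ^ (n - (x - 1)) + g * \<phi> ^ (n - Suc x))"
    proof -
      have "\<phi> ^ (n - x) * (1 + g) = \<phi> ^ j * (\<phi> * (1 + g))" by (simp add: j)
      also have "\<dots> = \<phi> ^ j * (s * (g + \<phi>\<^sup>2))" unfolding phi(3) ..
      finally show ?thesis unfolding nj by (simp add: power2_eq_square algebra_simps)
    qed
    then have "\<phi> ^ (n - x) = s * ((\<phi> ^ (n - (x - 1)) + g * \<phi> ^ (n - Suc x)) / (1 + g))"
      using g by (simp add: eq_divide_eq)
    moreover have "((p - S) + g * (q - S)) / (1 + g) = (p + g * q) / (1 + g) - S" for p q S :: real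
    proof -
      have "(p - S) + g * (q - S) = (p + g * q) - S * (1 + g)" by (simp add: algebra_simps)
      from arg_cong[OF this, of "\<lambda>x. x / (1 + g)"] show ?thesis
        using g by (simp add: diff_divide_distrib)
    qed
    ultimately have "\<phi> ^ (n - x) - s * s ^ m =
        s * (((\<phi> ^ (n - (x - 1)) - s ^ m) + g * (\<phi> ^ (n - Suc x) - s ^ m)) / (1 + g))"
      by (simp only: right_diff_distrib)
    also have "\<dots> \<le> s * ((?f (x - 1) + g * ?f (Suc x)) / (1 + g))"
      using f[of "x - 1"] f[of "Suc x"] x g s
      by (intro mult_left_mono divide_right_mono add_mono) auto
    finally show ?thesis
      unfolding path_expectation_inner[OF x] .
  qed
  then show ?case
    unfolding hit_gen_Suc by simp
qed

end

section \<open>Exponential tilting and the rate function\<close>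

text \<open>The logarithm of \<open>s\<^bsup>-a\<^esup> \<phi>\<close>, the base of Chernoff's bound for \<open>T \<le> a n\<close>, where \<open>s\<close> is the tilt with odds \<open>G\<close>
  and \<open>\<phi> = (g/G)\<^bsup>1/2\<^esup>\<close>.\<close>

definition log_bound :: "real \<Rightarrow> real \<Rightarrow> real \<Rightarrow> real" where
  "log_bound g a G = - a * ln (tilt_factor g G) - (ln G - ln g) / 2"

lemma cosh_half_ln: "0 < x \<Longrightarrow> cosh (ln x / 2) = (x + 1) / (2 * sqrt x)" for x :: real
  using sinh_cosh_half_ln(2)[of x 1] by simp

lemma ln_tilt_factor:
  assumes "0 < g" "0 < G"
  shows "ln (tilt_factor g G) = ln (1 + g) - ln (1 + G) + (ln G - ln g) / 2"
  using assms by (simp add: tilt_factor_def cosh_half_ln ln_div ln_mult ln_sqrt add.commute diff_divide_distrib)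

lemma log_bound_eq:
  assumes "0 < g" "0 < G"
  shows "log_bound g a G = a * (ln (1 + G) - ln (1 + g)) - (a + 1) / 2 * (ln G - ln g)"
  unfolding log_bound_def ln_tilt_factor[OF assms] by (simp add: field_simps)

lemma log_bound_rate:
  assumes "1 < g" "1 < a"
  shows "log_bound g a ((a + 1) / (a - 1)) = - biased_rate g a"
proof -
  have e: "1 + (a + 1) / (a - 1) = 2 * a / (a - 1)" using assms by (simp add: field_simps)
  have a2: "a\<^sup>2 - 1 = (a + 1) * (a - 1)" by (simp add: power2_eq_square algebra_simps)
  have "log_bound g a ((a + 1) / (a - 1)) =
      a * (ln 2 + ln a - ln (a - 1) - ln (1 + g)) - (a + 1) / 2 * (ln (a + 1) - ln (a - 1) - ln g)"
    using assms by (subst log_bound_eq) (auto simp: e ln_div ln_mult)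
  moreover have "- biased_rate g a =
      ln g - ln (a + 1) + (a - 1) / 2 * (ln g - (ln (a + 1) + ln (a - 1))) + a * (ln 2 + ln a - ln (1 + g))"
    using assms unfolding biased_rate_def a2 by (simp add: ln_mult ln_div ln_powr add.commute)
  ultimately show ?thesis by (simp add: field_simps)
qed

text \<open>With \<open>x = G (a-1)/(a+1)\<close> the difference of the two sides is a multiple of
  \<open>ln (1 - \<beta> + \<beta> x) - \<beta> ln x\<close> for \<open>\<beta> = (a+1)/(2a)\<close>, which is positive by strict concavity of \<open>ln\<close>.\<close>

lemma log_bound_minimal:
  assumes "1 < g" "1 < a" "0 < G" "G \<noteq> (a + 1) / (a - 1)"
  shows "log_bound g a ((a + 1) / (a - 1)) < log_bound g a G"
proof -
  define H where "H = (a + 1) / (a - 1)"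
  define \<beta> where "\<beta> = (a + 1) / (2 * a)"
  define x where "x = G / H"
  define y where "y = (1 + G) / (1 + H)"
  have H: "0 < H" using assms by (simp add: H_def)
  have H1: "1 + H = 2 * a / (a - 1)" using assms by (simp add: H_def field_simps)
  have \<beta>: "0 < \<beta>" "\<beta> < 1" using assms by (simp_all add: \<beta>_def)
  have xy: "0 < x" "0 < y" "x \<noteq> 1" using assms H by (auto simp: x_def y_def H_def[symmetric])
  have y: "y = (1 - \<beta>) + \<beta> * x"
  proof -
    have "\<beta> = H / (1 + H)" unfolding H1 \<beta>_def using assms by (simp add: H_def field_simps)
    then have "\<beta> * (1 + H) = H" using H by simp
    then have "((1 - \<beta>) + \<beta> * x) * (1 + H) = 1 + G"
      unfolding x_def using H by (simp add: algebra_simps)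
    then show ?thesis using H by (simp add: y_def divide_eq_eq)
  qed
  have y1: "y \<noteq> 1" using xy \<beta> by (simp add: y algebra_simps)
  have lnlt: "ln t < t - 1" if "0 < t" "t \<noteq> 1" for t :: real
    using ln_le_minus_one[OF that(1)] ln_eq_minus_one[OF that(1)] that by fastforce
  have "(1 - \<beta>) * ln (1 / y) < (1 - \<beta>) * (1 / y - 1)"
    using \<beta> xy y1 by (intro mult_strict_left_mono lnlt) auto
  moreover have "\<beta> * ln (x / y) \<le> \<beta> * (x / y - 1)"
    using \<beta> xy by (intro mult_left_mono ln_le_minus_one) auto
  ultimately have "(1 - \<beta>) * ln (1 / y) + \<beta> * ln (x / y) < (1 - \<beta>) * (1 / y - 1) + \<beta> * (x / y - 1)"
    by simp
  also have "\<dots> = ((1 - \<beta>) + \<beta> * x) / y - 1"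
    using xy by (simp add: field_simps)
  also have "\<dots> = 0" using xy by (simp add: y[symmetric])
  finally have "\<beta> * ln x < ln y" using xy by (simp add: ln_div algebra_simps)
  then have "a * (\<beta> * ln x) < a * ln y" using assms by simp
  moreover have "a * (\<beta> * ln x) = (a + 1) / 2 * (ln G - ln H)"
    using assms H by (simp add: \<beta>_def x_def ln_div)
  moreover have "ln y = ln (1 + G) - ln (1 + H)"
    using assms H by (simp add: y_def ln_div)
  moreover have "log_bound g a G - log_bound g a H = a * (ln (1 + G) - ln (1 + H)) - (a + 1) / 2 * (ln G - ln H)"
    using assms H by (simp add: log_bound_eq field_simps)
  ultimately show ?thesis
    unfolding H_def[symmetric] by simp
qed

lemma path_hit_gen_ge_tilted:
  assumes "1 < g" "g < G" "0 < n"
  shows "exp (- (real n * ((ln G - ln g) / 2))) - tilt_factor g G ^ m \<le>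
    hit_gen (tilt_factor g G) (walk_step {0..n} (path_weight g)) {n} m 0"
proof -
  define \<phi> where "\<phi> = sqrt (g / G)"
  have pos: "0 < sqrt g" "0 < sqrt G" using assms by auto
  have sq: "sqrt g * sqrt g = g" "sqrt G * sqrt G = G" using assms by auto
  have \<phi>: "0 < \<phi>" "\<phi> \<le> 1" using assms by (simp_all add: \<phi>_def)
  have "\<phi> = exp (- ((ln G - ln g) / 2))"
  proof -
    have "ln \<phi> = - ((ln G - ln g) / 2)"
      using assms by (simp add: \<phi>_def ln_sqrt ln_div diff_divide_distrib)
    then show ?thesis using \<phi> by (metis exp_ln)
  qed
  then have e: "exp (- (real n * ((ln G - ln g) / 2))) = \<phi> ^ n"
    by (simp add: exp_of_nat_mult[symmetric])
  have s: "tilt_factor g G = (1 + g) * sqrt G / ((1 + G) * sqrt g)"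
    using assms by (simp add: tilt_factor_def cosh_half_ln add.commute)
  have "\<phi>\<^sup>2 = g / G" using assms by (simp add: \<phi>_def)
  then have "g + \<phi>\<^sup>2 = g * (1 + G) / G" using assms by (simp add: field_simps)
  then have "tilt_factor g G * (g + \<phi>\<^sup>2) = (1 + g) * sqrt G / ((1 + G) * sqrt g) * (g * (1 + G) / G)"
    by (simp only: s)
  also have "\<dots> = (1 + g) * (sqrt g / sqrt G)"
  proof -
    have "(1 + p * p) * q / ((1 + q * q) * p) * (p * p * (1 + q * q) / (q * q)) = (1 + p * p) * (p / q)"
      if "0 < p" "0 < q" for p q :: real
    proof -
      have "1 + q * q \<noteq> 0" using that by (smt (verit) mult_pos_pos)
      then show ?thesis using that by (simp add: divide_simps)
    qed
    from this[OF pos] show ?thesis unfolding sq .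
  qed
  also have "\<dots> = \<phi> * (1 + g)" by (simp add: \<phi>_def real_sqrt_divide)
  finally have eq: "\<phi> * (1 + g) = tilt_factor g G * (g + \<phi>\<^sup>2)" ..
  have "tilt_factor g G < 1"
    using tilt_factor_less_1 assms by simp
  from path_hit_gen_ge[OF assms(1,3) tilt_factor_pos this \<phi> eq assms(3), of m]
  show ?thesis unfolding e by simp
qed

text \<open>The times below \<open>A\<close>, between \<open>A\<close> and \<open>B\<close>, and above \<open>B\<close> are estimated separately: on the first \<open>s1\<close> is replaced by
  the smaller \<open>s3\<close>, on the last by the larger \<open>s2\<close>, and between them the power of \<open>s1\<close> is at most its value at \<open>A\<close>.\<close>

lemma hit_gen_tilt_le:
  fixes s1 s2 s3 A B :: real
  assumes s: "0 < s3" "s3 \<le> s1" "s1 \<le> s2" "s1 \<le> 1" and AB: "0 \<le> A" "0 \<le> B"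
  shows "hit_gen s1 K z m x \<le> (s1 / s3) powr A * hit_gen s3 K z m x +
    s1 powr A * (1 - survival K z (nat \<lfloor>B\<rfloor>) x) + (s1 / s2) powr B * hit_gen s2 K z m x"
proof -
  let ?p = "\<lambda>k. survival K z k x - survival K z (Suc k) x"
  have p: "0 \<le> ?p k" for k using survival_decreasing[of K z k x] by simp
  have pos: "0 < s1" "0 < s2" using s by auto
  let ?M = "nat \<lfloor>B\<rfloor>"
  have bound: "s1 ^ Suc k * ?p k \<le> (s1 / s3) powr A * (s3 ^ Suc k * ?p k) + s1 powr A * (if k < ?M then ?p k else 0)
      + (s1 / s2) powr B * (s2 ^ Suc k * ?p k)" for k
  proof -
    have nn: "0 \<le> (s1 / s3) powr A * (s3 ^ Suc k * ?p k)" "0 \<le> s1 powr A * (if k < ?M then ?p k else 0)"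
      "0 \<le> (s1 / s2) powr B * (s2 ^ Suc k * ?p k)"
      using p[of k] s pos by (simp_all del: survival.simps)
    consider "real (Suc k) \<le> A" | "B < real (Suc k)" | "A \<le> real (Suc k)" "real (Suc k) \<le> B" by linarith
    then show ?thesis
    proof cases
      case 1
      have "(s1 / s3) powr real (Suc k) \<le> (s1 / s3) powr A"
        using 1 s by (intro powr_mono) (auto simp: le_divide_eq)
      then have "(s1 / s3) ^ Suc k \<le> (s1 / s3) powr A"
        using s pos by (subst (asm) powr_realpow) auto
      then have "(s1 / s3) ^ Suc k * (s3 ^ Suc k * ?p k) \<le> (s1 / s3) powr A * (s3 ^ Suc k * ?p k)"
        using s p[of k] by (intro mult_right_mono) (simp_all del: survival.simps)
      moreover have "(s1 / s3) ^ Suc k * s3 ^ Suc k = s1 ^ Suc k"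
        using s by (simp add: power_mult_distrib[symmetric] del: power_Suc)
      ultimately show ?thesis using nn by (simp only: mult.assoc[symmetric])
    next
      case 2
      have "(s1 / s2) powr real (Suc k) \<le> (s1 / s2) powr B"
        using 2 s pos by (intro powr_mono') (auto simp: divide_le_eq)
      then have "(s1 / s2) ^ Suc k \<le> (s1 / s2) powr B"
        using s pos by (subst (asm) powr_realpow) auto
      then have "(s1 / s2) ^ Suc k * (s2 ^ Suc k * ?p k) \<le> (s1 / s2) powr B * (s2 ^ Suc k * ?p k)"
        using pos p[of k] by (intro mult_right_mono) (simp_all del: survival.simps)
      moreover have "(s1 / s2) ^ Suc k * s2 ^ Suc k = s1 ^ Suc k"
        using pos by (simp add: power_mult_distrib[symmetric] del: power_Suc)
      ultimately show ?thesis using nn by (simp only: mult.assoc[symmetric])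
    next
      case 3
      have "k < ?M" using 3(2) by linarith
      moreover have "s1 powr real (Suc k) \<le> s1 powr A"
        using 3 s pos by (intro powr_mono') auto
      then have "s1 ^ Suc k \<le> s1 powr A"
        using pos by (subst (asm) powr_realpow) auto
      then have "s1 ^ Suc k * ?p k \<le> s1 powr A * ?p k"
        using p[of k] by (intro mult_right_mono) (simp_all del: survival.simps)
      ultimately show ?thesis using nn by simp
    qed
  qed
  have mid: "(\<Sum>k<m. if k < ?M then ?p k else 0) \<le> 1 - survival K z ?M x"
  proof -
    have "(\<Sum>k<m. if k < ?M then ?p k else 0) = (\<Sum>k\<in>{..<m} \<inter> {k. k < ?M}. ?p k)"
      by (simp add: sum.If_cases del: survival.simps)
    also have "\<dots> \<le> (\<Sum>k<?M. ?p k)"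
      using p by (intro sum_mono2) auto
    also have "\<dots> = 1 - survival K z ?M x" by (rule sum_survival_differences)
    finally show ?thesis .
  qed
  have "hit_gen s1 K z m x \<le> (\<Sum>k<m. (s1 / s3) powr A * (s3 ^ Suc k * ?p k) + s1 powr A * (if k < ?M then ?p k else 0)
      + (s1 / s2) powr B * (s2 ^ Suc k * ?p k))"
    unfolding hit_gen_def by (intro sum_mono bound)
  also have "\<dots> = (s1 / s3) powr A * hit_gen s3 K z m x + s1 powr A * (\<Sum>k<m. if k < ?M then ?p k else 0) +
      (s1 / s2) powr B * hit_gen s2 K z m x"
    by (simp only: sum.distrib sum_distrib_left hit_gen_def)
  also have "\<dots> \<le> (s1 / s3) powr A * hit_gen s3 K z m x + s1 powr A * (1 - survival K z ?M x) +
      (s1 / s2) powr B * hit_gen s2 K z m x"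
    using mid by (intro add_mono mult_left_mono order_refl) auto
  finally show ?thesis .
qed

text \<open>The odds for which the biased walk has mean \<open>a\<close>.  The formula is that of \<open>biased_mean\<close> because that map is
  an involution.\<close>

definition dual_odds :: "real \<Rightarrow> real" where
  "dual_odds a = (a + 1) / (a - 1)"

lemma dual_odds_gt: "1 < g \<Longrightarrow> 1 < a \<Longrightarrow> a < biased_mean g \<Longrightarrow> g < dual_odds a"
  by (simp add: dual_odds_def biased_mean_def field_simps)

lemma dual_odds_decreasing: "1 < a \<Longrightarrow> a < b \<Longrightarrow> dual_odds b < dual_odds a"
  by (simp add: dual_odds_def field_simps)

lemma dual_odds_pos: "1 < a \<Longrightarrow> 0 < dual_odds a"
  by (simp add: dual_odds_def)

lemma log_bound_continuous:
  assumes "1 < g" "1 < a" "0 < \<eta>"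
  obtains b where "1 < b" "b < a" "log_bound g a (dual_odds a) - \<eta> < log_bound g b (dual_odds ((b + a) / 2))"
proof -
  let ?f = "\<lambda>x. x * (ln (1 + dual_odds ((x + a) / 2)) - ln (1 + g)) - (x + 1) / 2 * (ln (dual_odds ((x + a) / 2)) - ln g)"
  have D: "((\<lambda>x. dual_odds ((x + a) / 2)) \<longlongrightarrow> dual_odds ((a + a) / 2)) (at_left a)"
    unfolding dual_odds_def using assms by (intro tendsto_intros) auto
  have "(?f \<longlongrightarrow> ?f a) (at_left a)"
    using assms dual_odds_pos[of a] by (intro tendsto_intros D) auto
  moreover have "?f a = log_bound g a (dual_odds a)"
    using assms dual_odds_pos[of a] by (subst log_bound_eq) auto
  ultimately have "eventually (\<lambda>x. log_bound g a (dual_odds a) - \<eta> < ?f x) (at_left a)"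
    using assms by (intro order_tendstoD(1)[where y="log_bound g a (dual_odds a)"]) auto
  moreover have "eventually (\<lambda>x. 1 < x \<and> x < a) (at_left a)"
    using assms by (auto simp: eventually_at_left_field intro!: exI[of _ 1])
  ultimately have "eventually (\<lambda>x. 1 < x \<and> x < a \<and> log_bound g a (dual_odds a) - \<eta> < ?f x) (at_left a)"
    by eventually_elim auto
  then obtain b where b: "1 < b" "b < a" "log_bound g a (dual_odds a) - \<eta> < ?f b"
    using eventually_happens'[of "at_left a"] by auto
  moreover have "?f b = log_bound g b (dual_odds ((b + a) / 2))"
    using assms b dual_odds_pos[of "(b + a) / 2"] by (subst log_bound_eq) auto
  ultimately show ?thesis by (intro that[of b]) auto
qed

text \<open>Tilting by odds \<open>dual_odds c\<close> with \<open>b < c < a\<close> concentrates the hitting time between \<open>b n\<close> and \<open>a n\<close>: by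
  \<open>log_bound_minimal\<close>, the tilts that are optimal for \<open>b\<close> and for \<open>a\<close> show that the two tails are exponentially
  small compared with the total.  On the remaining event the tilting density is controlled, and the
  exponent tends to the rate as \<open>b\<close> tends to \<open>a\<close>.\<close>

lemma path_hit_prob_lower:
  fixes C g a \<eta> :: real
  assumes "1 < C" "1 < g" "1 < a" "a < biased_mean g" "0 < \<eta>"
  shows "\<forall>\<^sub>F n in sequentially. exp (real n * (- biased_rate g a - \<eta>)) \<le>
    1 - survival (walk_step {0..n} (path_weight g)) {n} (nat \<lfloor>a * real n\<rfloor>) 0"
proof -
  obtain b where b: "1 < b" "b < a"
    "log_bound g a (dual_odds a) - \<eta> / 2 < log_bound g b (dual_odds ((b + a) / 2))"
    using log_bound_continuous[of g a "\<eta> / 2"] assms by auto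
  define c where "c = (b + a) / 2"
  have c: "b < c" "c < a" "1 < c" using b by (simp_all add: c_def)
  define G1 where "G1 = dual_odds c"
  define G2 where "G2 = dual_odds a"
  define G3 where "G3 = dual_odds b"
  have G: "g < G2" "G2 < G1" "G1 < G3"
    unfolding G1_def G2_def G3_def using assms b c by (auto intro: dual_odds_gt dual_odds_decreasing)
  define s1 where "s1 = tilt_factor g G1"
  define s2 where "s2 = tilt_factor g G2"
  define s3 where "s3 = tilt_factor g G3"
  have s: "0 < s3" "s3 < s1" "s1 < s2" "s2 < 1" "0 < s1" "0 < s2"
    unfolding s1_def s2_def s3_def
    using tilt_factor_less_1[of g G2] tilt_factor_less[of g G2 G1] tilt_factor_less[of g G1 G3]
      tilt_factor_pos G assms by auto
  define ph where "ph G n = exp (- (real n * ((ln G - ln g) / 2)))" for G and n :: nat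
  obtain K2 where K2: "0 < K2" "\<And>n (V :: nat set) w u z m. (V, w, u, z) \<in> admissible C g n \<Longrightarrow> 0 < n \<Longrightarrow>
      hit_gen s2 (walk_step V w) z m u \<le> K2 * ph G2 n"
    using hit_gen_upper_bound[where 'v=nat, OF assms(2) G(1) assms(1)]
    unfolding s2_def ph_def by blast
  have gG3: "g < G3" using G by simp
  obtain K3 where K3: "0 < K3" "\<And>n (V :: nat set) w u z m. (V, w, u, z) \<in> admissible C g n \<Longrightarrow> 0 < n \<Longrightarrow>
      hit_gen s3 (walk_step V w) z m u \<le> K3 * ph G3 n"
    using hit_gen_upper_bound[where 'v=nat, OF assms(2) gG3 assms(1)]
    unfolding s3_def ph_def by blast
  define \<delta>2 where "\<delta>2 = log_bound g a G1 - log_bound g a G2"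
  define \<delta>3 where "\<delta>3 = log_bound g b G1 - log_bound g b G3"
  have \<delta>2: "0 < \<delta>2"
    using log_bound_minimal[of g a G1] assms G b unfolding \<delta>2_def G2_def dual_odds_def[of a, symmetric] by simp
  have \<delta>3: "0 < \<delta>3"
    using log_bound_minimal[of g b G1] assms G b unfolding \<delta>3_def G3_def dual_odds_def[of b, symmetric] by simp
  have lb: "log_bound g x G1 = - x * ln s1 - (ln G1 - ln g) / 2" "log_bound g x G2 = - x * ln s2 - (ln G2 - ln g) / 2"
    "log_bound g x G3 = - x * ln s3 - (ln G3 - ln g) / 2" for x
    by (simp_all add: log_bound_def s1_def s2_def s3_def)
  have lower: "exp (real n * log_bound g b G1) * (1 - K3 * exp (- (real n * \<delta>3)) - K2 * exp (- (real n * \<delta>2))) \<le>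
      1 - survival (walk_step {0..n} (path_weight g)) {n} (nat \<lfloor>a * real n\<rfloor>) 0" if n: "0 < n" for n
  proof -
    let ?S = "survival (walk_step {0..n} (path_weight g)) {n} (nat \<lfloor>a * real n\<rfloor>) 0"
    let ?R = "(s1 / s3) powr (b * real n) * (K3 * ph G3 n) + s1 powr (b * real n) * (1 - ?S)
        + (s1 / s2) powr (a * real n) * (K2 * ph G2 n)"
    have adm: "({0..n}, path_weight g, 0, {n}) \<in> admissible C g n"
      using path_admissible[OF assms(2) n assms(1)] .
    have gG1: "g < G1" using G by simp
    have "ph G1 n - s1 ^ m \<le> ?R" for m
    proof -
      have "ph G1 n - s1 ^ m \<le> hit_gen s1 (walk_step {0..n} (path_weight g)) {n} m 0"
        unfolding ph_def s1_def by (rule path_hit_gen_ge_tilted[OF assms(2) gG1 n])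
      also have "\<dots> \<le> (s1 / s3) powr (b * real n) * hit_gen s3 (walk_step {0..n} (path_weight g)) {n} m 0
          + s1 powr (b * real n) * (1 - ?S)
          + (s1 / s2) powr (a * real n) * hit_gen s2 (walk_step {0..n} (path_weight g)) {n} m 0"
        using s assms b by (intro hit_gen_tilt_le) auto
      also have "\<dots> \<le> ?R"
        by (intro add_mono mult_left_mono order_refl K2(2)[OF adm n] K3(2)[OF adm n] powr_ge_zero)
      finally show ?thesis .
    qed
    moreover have "(\<lambda>m. ph G1 n - s1 ^ m) \<longlonglongrightarrow> ph G1 n - 0"
      using s by (intro tendsto_intros LIMSEQ_realpow_zero) auto
    ultimately have "ph G1 n \<le> ?R"
      by (intro LIMSEQ_le_const2[where X="\<lambda>m. ph G1 n - s1 ^ m"]) auto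
    moreover have "(s1 / s3) powr (b * real n) * ph G3 n = ph G1 n * exp (- (real n * \<delta>3))"
    proof -
      have "(s1 / s3) powr (b * real n) = exp (b * real n * (ln s1 - ln s3))"
        using s by (simp add: powr_def ln_div)
      then have "(s1 / s3) powr (b * real n) * ph G3 n = exp (b * real n * (ln s1 - ln s3) - real n * ((ln G3 - ln g) / 2))"
        by (simp only: ph_def mult_exp_exp add_uminus_conv_diff)
      also have "b * real n * (ln s1 - ln s3) - real n * ((ln G3 - ln g) / 2) =
          - (real n * ((ln G1 - ln g) / 2)) + - (real n * \<delta>3)"
        unfolding \<delta>3_def lb by (simp add: algebra_simps)
      finally show ?thesis by (simp only: exp_add ph_def)
    qed
    moreover have "(s1 / s2) powr (a * real n) * ph G2 n = ph G1 n * exp (- (real n * \<delta>2))"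
    proof -
      have "(s1 / s2) powr (a * real n) = exp (a * real n * (ln s1 - ln s2))"
        using s by (simp add: powr_def ln_div)
      then have "(s1 / s2) powr (a * real n) * ph G2 n = exp (a * real n * (ln s1 - ln s2) - real n * ((ln G2 - ln g) / 2))"
        by (simp only: ph_def mult_exp_exp add_uminus_conv_diff)
      also have "a * real n * (ln s1 - ln s2) - real n * ((ln G2 - ln g) / 2) =
          - (real n * ((ln G1 - ln g) / 2)) + - (real n * \<delta>2)"
        unfolding \<delta>2_def lb by (simp add: algebra_simps)
      finally show ?thesis by (simp only: exp_add ph_def)
    qed
    ultimately have le: "ph G1 n * (1 - K3 * exp (- (real n * \<delta>3)) - K2 * exp (- (real n * \<delta>2)))
        \<le> s1 powr (b * real n) * (1 - ?S)"
      by (simp add: algebra_simps)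
    have "exp (real n * log_bound g b G1) = ph G1 n * s1 powr (- (b * real n))"
      using s unfolding lb ph_def powr_def by (simp add: exp_add[symmetric] algebra_simps)
    then have "exp (real n * log_bound g b G1) * (1 - K3 * exp (- (real n * \<delta>3)) - K2 * exp (- (real n * \<delta>2)))
       = s1 powr (- (b * real n)) * (ph G1 n * (1 - K3 * exp (- (real n * \<delta>3)) - K2 * exp (- (real n * \<delta>2))))"
      by (simp only: mult_ac)
    also have "\<dots> \<le> s1 powr (- (b * real n)) * (s1 powr (b * real n) * (1 - ?S))"
      by (rule mult_left_mono[OF le]) simp
    also have "\<dots> = 1 - ?S"
      using s by (simp add: powr_minus)
    finally show ?thesis .
  qed
  have tends: "((\<lambda>n. exp (- (real n * x))) \<longlongrightarrow> 0) sequentially" if "0 < x" for x :: real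
    using that by real_asymp
  have "((\<lambda>n. 1 - K3 * exp (- (real n * \<delta>3)) - K2 * exp (- (real n * \<delta>2))) \<longlongrightarrow> 1 - K3 * 0 - K2 * 0) sequentially"
    by (intro tendsto_intros tends \<delta>2 \<delta>3)
  then have "\<forall>\<^sub>F n in sequentially. 1 / 2 < 1 - K3 * exp (- (real n * \<delta>3)) - K2 * exp (- (real n * \<delta>2))"
    by (rule order_tendstoD) simp
  moreover have "\<forall>\<^sub>F n in sequentially. exp (- (real n * (\<eta> / 2))) < 1 / 2"
    using assms by (intro order_tendstoD(2)[OF tends]) auto
  moreover have "\<forall>\<^sub>F n in sequentially. 0 < n"
    by (rule eventually_gt_at_top)
  ultimately show ?thesis
  proof eventually_elim
    case (elim n)
    have I: "log_bound g a (dual_odds a) = - biased_rate g a"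
      using log_bound_rate[OF assms(2,3)] by (simp add: dual_odds_def)
    have "real n * (- biased_rate g a - \<eta>) \<le> real n * log_bound g b G1 + - (real n * (\<eta> / 2))"
      using mult_left_mono[OF less_imp_le[OF b(3)], of "real n"]
      unfolding I G1_def c_def by (simp add: algebra_simps)
    then have "exp (real n * (- biased_rate g a - \<eta>)) \<le> exp (real n * log_bound g b G1) * exp (- (real n * (\<eta> / 2)))"
      by (simp add: exp_add[symmetric])
    also have "\<dots> \<le> exp (real n * log_bound g b G1) * (1 - K3 * exp (- (real n * \<delta>3)) - K2 * exp (- (real n * \<delta>2)))"
      using elim by (intro mult_left_mono) auto
    also have "\<dots> \<le> 1 - survival (walk_step {0..n} (path_weight g)) {n} (nat \<lfloor>a * real n\<rfloor>) 0"
      by (rule lower[OF elim(3)])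
    finally show ?case .
  qed
qed

text \<open>Chernoff's bound with the optimal tilt.\<close>

lemma hit_prob_upper:
  fixes C g a :: real
  assumes "1 < C" "1 < g" "1 < a" "a < biased_mean g"
  shows "\<exists>K>0. \<forall>n (V :: 'v set) w u z. (V, w, u, z) \<in> admissible C g n \<longrightarrow> 0 < n \<longrightarrow>
    1 - survival (walk_step V w) z (nat \<lfloor>a * real n\<rfloor>) u \<le> K * exp (- biased_rate g a * real n)"
proof -
  define G where "G = dual_odds a"
  have G: "g < G" unfolding G_def using assms by (intro dual_odds_gt)
  define s where "s = tilt_factor g G"
  have s: "0 < s" "s < 1"
    using tilt_factor_pos tilt_factor_less_1[of g G] G assms by (auto simp: s_def)
  obtain K where K: "0 < K" "\<And>n (V :: 'v set) w u z m. (V, w, u, z) \<in> admissible C g n \<Longrightarrow> 0 < n \<Longrightarrow>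
      hit_gen s (walk_step V w) z m u \<le> K * exp (- (real n * ((ln G - ln g) / 2)))"
    using hit_gen_upper_bound[where 'v='v, OF assms(2) G assms(1)]
    unfolding s_def by blast
  have "1 - survival (walk_step V w) z (nat \<lfloor>a * real n\<rfloor>) u \<le> K * exp (- biased_rate g a * real n)"
    if adm: "(V, w, u, z) \<in> admissible C g n" "0 < n" for n and V :: "'v set" and w u z
  proof -
    let ?m = "nat \<lfloor>a * real n\<rfloor>"
    let ?q = "1 - survival (walk_step V w) z ?m u"
    have q: "0 \<le> ?q" using survival_bounds(2)[of "walk_step V w" z ?m u] by simp
    have "s powr (a * real n) \<le> s powr (real ?m)"
      using s assms by (intro powr_mono') auto
    also have "\<dots> = s ^ ?m" using s by (simp add: powr_realpow)
    finally have "s powr (a * real n) * ?q \<le> s ^ ?m * ?q"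
      using q by (rule mult_right_mono)
    also have "\<dots> \<le> hit_gen s (walk_step V w) z ?m u"
      using s by (intro hit_gen_ge_power) auto
    also have "\<dots> \<le> K * exp (- (real n * ((ln G - ln g) / 2)))"
      by (rule K(2)[OF adm])
    finally have le: "s powr (a * real n) * ?q \<le> K * exp (- (real n * ((ln G - ln g) / 2)))" .
    have "?q = s powr (- (a * real n)) * (s powr (a * real n) * ?q)"
      using s by (simp add: powr_minus)
    also have "\<dots> \<le> s powr (- (a * real n)) * (K * exp (- (real n * ((ln G - ln g) / 2))))"
      by (rule mult_left_mono[OF le]) simp
    also have "\<dots> = K * exp (real n * log_bound g a G)"
      using s by (simp add: powr_def log_bound_def s_def[symmetric] exp_add[symmetric] algebra_simps)
    also have "log_bound g a G = - biased_rate g a"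
      using log_bound_rate[OF assms(2,3)] by (simp add: G_def dual_odds_def)
    finally show ?thesis by (simp add: mult.commute)
  qed
  with K(1) show ?thesis by blast
qed

section \<open>Independence of the vertex type\<close>

text \<open>A vertex of finite weight has countably many neighbours.\<close>

lemma countable_component:
  assumes G: "weighted_graph V w"
  shows "countable {y. (u, y) \<in> (edges V w)\<^sup>*}"
proof -
  have nbr: "countable (edges V w `` {x})" for x
  proof (cases "x \<in> V")
    case True
    then have "edges V w `` {x} \<subseteq> set_pmf (walk_step V w x)"
      using set_pmf_walk_step[OF G order_refl, of x] by (auto simp: edges_def)
    then show ?thesis using countable_set_pmf countable_subset by blast
  next
    case False
    then have "edges V w `` {x} = {}" by (auto simp: edges_def)
    then show ?thesis by simp
  qed
  have "countable ((edges V w ^^ k) `` {u})" for k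
  proof (induction k)
    case (Suc k)
    have "(edges V w ^^ Suc k) `` {u} = (\<Union>x\<in>(edges V w ^^ k) `` {u}. edges V w `` {x})"
      by auto
    then show ?case using Suc nbr by simp
  qed simp
  then have "countable (\<Union>k. (edges V w ^^ k) `` {u})" by simp
  moreover have "{y. (u, y) \<in> (edges V w)\<^sup>*} = (\<Union>k. (edges V w ^^ k) `` {u})"
    by (auto simp: rtrancl_power)
  ultimately show ?thesis by simp
qed

text \<open>The graph is restricted to the component of \<open>u\<close> and its vertices are renamed.  The walk never leaves the
  component.  Discarding the rest of \<open>z\<close> does not increase its weight or decrease the distance, so
  the result is admissible.\<close>

lemma admissible_transfer:
  fixes V :: "'a set"
  assumes adm: "(V, w, u, z) \<in> admissible C g n" and inf: "infinite (UNIV :: 'b set)"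
  obtains V' :: "'b set" and w' u' z' where "(V', w', u', z') \<in> admissible C g n"
    "u' \<in> z' \<longleftrightarrow> u \<in> z"
    "\<And>m. survival (walk_step V' w') z' m u' = survival (walk_step V w) z m u"
proof -
  note A = admissibleD[OF adm]
  define U where "U = {y \<in> V. (u, y) \<in> (edges V w)\<^sup>*}"
  have uU: "u \<in> U" using A(2) by (simp add: U_def)
  have UV: "U \<subseteq> V" by (auto simp: U_def)
  have closed: "w x y = 0" if "x \<in> U" "y \<in> V - U" for x y
  proof (rule ccontr)
    assume "w x y \<noteq> 0"
    then have "(x, y) \<in> edges V w"
      using that UV weight_nonneg[OF A(1,3), of x y] by (auto simp: edges_def)
    then have "y \<in> U" using that by (auto simp: U_def intro: rtrancl_into_rtrancl)
    then show False using that by simp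
  qed
  have "countable U"
    using countable_component[OF A(1), of u] by (rule countable_subset[rotated]) (auto simp: U_def)
  obtain e :: "nat \<Rightarrow> 'b" where e: "inj e"
    using infinite_countable_subset[OF inf] by auto
  define f where "f = e \<circ> to_nat_on U"
  have f: "inj_on f U"
    unfolding f_def using \<open>countable U\<close> e by (intro comp_inj_on) (auto intro: inj_on_subset)
  define h where "h = inv_into U f"
  have hf: "h (f x) = x" if "x \<in> U" for x
    using that f by (simp add: h_def)
  define V' where "V' = f ` U"
  define w' where "w' x y = w (h x) (h y)" for x y
  define z' where "z' = f ` (z \<inter> U)"
  have vw: "vertex_weight V' w' (f x) = vertex_weight V w x" if x: "x \<in> U" for x
  proof -
    have "vertex_weight V' w' (f x) = infsum ((\<lambda>y. ennreal (w' (f x) y)) \<circ> f) U"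
      unfolding vertex_weight_def V'_def by (rule infsum_reindex[OF f])
    also have "\<dots> = infsum (\<lambda>y. ennreal (w x y)) U"
      using x by (intro infsum_cong) (simp add: w'_def hf)
    also have "\<dots> = infsum (\<lambda>y. ennreal (w x y)) V"
      using UV closed[OF x] by (intro infsum_cong_neutral) auto
    finally show ?thesis by (simp add: vertex_weight_def)
  qed
  have G': "weighted_graph V' w'"
  proof -
    have "0 \<le> w' (f x) (f y) \<and> w' (f x) (f y) = w' (f y) (f x)" if "x \<in> U" "y \<in> U" for x y
      using A(1) UV that by (auto simp: weighted_graph_def w'_def hf)
    moreover have "0 < vertex_weight V' w' (f x) \<and> vertex_weight V' w' (f x) < \<infinity>" if "x \<in> U" for x
      unfolding vw[OF that] using A(1) UV that by (auto simp: weighted_graph_def)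
    ultimately show ?thesis
      unfolding weighted_graph_def by (auto simp: V'_def[symmetric]) (auto simp: V'_def)
  qed
  have zf: "f x \<in> z' \<longleftrightarrow> x \<in> z" if "x \<in> U" for x
    using that f by (auto simp: z'_def inj_on_def)
  have path: "\<exists>y\<in>U. b = f y \<and> (u, y) \<in> edges V w ^^ k" if "(f u, b) \<in> edges V' w' ^^ k" for b k
    using that
  proof (induction k arbitrary: b)
    case 0
    then show ?case using uU by auto
  next
    case (Suc k)
    then obtain c where c: "(f u, c) \<in> edges V' w' ^^ k" "(c, b) \<in> edges V' w'" by auto
    from Suc.IH[OF c(1)] obtain x where x: "x \<in> U" "c = f x" "(u, x) \<in> edges V w ^^ k" by auto
    from c(2) obtain y where y: "y \<in> U" "b = f y" by (auto simp: edges_def V'_def)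
    have "(x, y) \<in> edges V w"
      using c(2) x y UV by (auto simp: edges_def w'_def hf)
    with x y show ?case by auto
  qed
  have dist: "enat n \<le> graph_dist V' w' (f u) z'"
    unfolding graph_dist_def
  proof (rule INF_greatest)
    fix k assume "k \<in> {k. \<exists>y\<in>z'. (f u, y) \<in> edges V' w' ^^ k}"
    then obtain b where b: "b \<in> z'" "(f u, b) \<in> edges V' w' ^^ k" by auto
    from path[OF b(2)] obtain y where y: "y \<in> U" "b = f y" "(u, y) \<in> edges V w ^^ k" by auto
    with b(1) zf have "y \<in> z" by simp
    from A(4)[OF this y(3)] show "enat n \<le> enat k" by simp
  qed
  have sw: "set_weight V' w' z' \<le> set_weight V w z"
  proof -
    have "set_weight V' w' z' = infsum (vertex_weight V' w' \<circ> f) (z \<inter> U)"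
      unfolding set_weight_def z'_def
      by (rule infsum_reindex) (rule inj_on_subset[OF f], simp)
    also have "\<dots> = infsum (vertex_weight V w) (z \<inter> U)"
      by (intro infsum_cong) (simp add: vw)
    also have "\<dots> \<le> infsum (vertex_weight V w) z"
      by (intro infsum_mono_neutral nonneg_summable_on_complete) auto
    finally show ?thesis by (simp add: set_weight_def)
  qed
  have adm': "(V', w', f u, z') \<in> admissible C g n"
  proof -
    have "set_weight V' w' z' / vertex_weight V' w' (f u) \<le> set_weight V w z / vertex_weight V w u"
      unfolding vw[OF uU] by (intro divide_right_mono_ennreal sw)
    also have "\<dots> \<le> ennreal (C * g ^ n)" using adm by (simp add: admissible_def)
    finally show ?thesis
      using G' dist uU by (auto simp: admissible_def V'_def z'_def)
  qed
  have step: "walk_step V' w' (f x) = map_pmf f (walk_step V w x)" if x: "x \<in> U" for x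
  proof (rule pmf_eqI)
    fix b
    have xV: "x \<in> V" using x UV by auto
    have setp: "set_pmf (walk_step V w x) \<subseteq> U"
      using closed[OF x] by (auto simp: set_pmf_walk_step[OF A(1,3) xV]) fastforce
    have injp: "inj_on f (set_pmf (walk_step V w x))" using f setp by (rule inj_on_subset)
    have fx: "f x \<in> V'" using x by (simp add: V'_def)
    show "pmf (walk_step V' w' (f x)) b = pmf (map_pmf f (walk_step V w x)) b"
    proof (cases "b \<in> V'")
      case True
      then obtain y where y: "y \<in> U" "b = f y" by (auto simp: V'_def)
      have "pmf (walk_step V' w' (f x)) b = pmf (walk_step V w x) y"
        using True y x UV by (auto simp: pmf_walk_step[OF G' fx] pmf_walk_step[OF A(1) xV] vw w'_def hf)
      also have "\<dots> = pmf (map_pmf f (walk_step V w x)) (f y)"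
      proof (cases "y \<in> set_pmf (walk_step V w x)")
        case True
        then show ?thesis using injp by (simp add: pmf_map_inj)
      next
        case False
        then have "f y \<notin> f ` set_pmf (walk_step V w x)"
          using f setp y by (auto simp: inj_on_def)
        with False show ?thesis by (simp add: pmf_map_outside set_pmf_iff)
      qed
      finally show ?thesis using y by simp
    next
      case False
      then have "b \<notin> f ` set_pmf (walk_step V w x)" using setp by (auto simp: V'_def)
      then show ?thesis using False by (simp add: pmf_map_outside pmf_walk_step[OF G' fx])
    qed
  qed
  have surv: "survival (walk_step V' w') z' m (f x) = survival (walk_step V w) z m x" if "x \<in> U" for m x
    using that
  proof (induction m arbitrary: x)
    case (Suc m)
    have xV: "x \<in> V" using Suc.prems UV by auto
    have setp: "y \<in> U" if "y \<in> set_pmf (walk_step V w x)" for y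
      using that closed[OF Suc.prems] by (auto simp: set_pmf_walk_step[OF A(1,3) xV]) fastforce
    show ?case
      unfolding survival.simps step[OF Suc.prems] integral_map_pmf
      by (rule integral_cong_AE) (auto simp: AE_measure_pmf_iff zf Suc.IH dest!: setp)
  qed simp
  show ?thesis
    by (rule that[OF adm' zf[OF uU] surv[OF uU]])
qed

lemma INF_mean_le:
  assumes inf: "infinite (UNIV :: 'b set)"
  shows "(INF (V :: 'b set, w, u, z) \<in> admissible C g n. mean_hitting_time V w u z) \<le>
    (INF (V :: 'a set, w, u, z) \<in> admissible C g n. mean_hitting_time V w u z)"
proof (rule INF_greatest, clarify)
  fix V :: "'a set" and w u z assume adm: "(V, w, u, z) \<in> admissible C g n"
  obtain V' :: "'b set" and w' u' z' where T: "(V', w', u', z') \<in> admissible C g n"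
    "u' \<in> z' \<longleftrightarrow> u \<in> z" "\<And>m. survival (walk_step V' w') z' m u' = survival (walk_step V w) z m u"
    by (rule admissible_transfer[OF adm inf]) blast
  have "mean_hitting_time V' w' u' z' = mean_hitting_time V w u z"
    by (simp add: mean_hitting_time_eq T)
  then show "(INF (V :: 'b set, w, u, z) \<in> admissible C g n. mean_hitting_time V w u z) \<le> mean_hitting_time V w u z"
    by (intro INF_lower2[OF T(1)]) simp
qed

lemma SUP_prob_le:
  assumes inf: "infinite (UNIV :: 'b set)" and t: "0 \<le> t"
  shows "(SUP (V :: 'a set, w, u, z) \<in> admissible C g n. prob_hit_by t V w u z) \<le>
    (SUP (V :: 'b set, w, u, z) \<in> admissible C g n. prob_hit_by t V w u z)"
proof (rule SUP_least, clarify)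
  fix V :: "'a set" and w u z assume adm: "(V, w, u, z) \<in> admissible C g n"
  obtain V' :: "'b set" and w' u' z' where T: "(V', w', u', z') \<in> admissible C g n"
    "u' \<in> z' \<longleftrightarrow> u \<in> z" "\<And>m. survival (walk_step V' w') z' m u' = survival (walk_step V w) z m u"
    by (rule admissible_transfer[OF adm inf]) blast
  have "prob_hit_by t V' w' u' z' = prob_hit_by t V w u z"
    by (simp add: prob_hit_by_eq[OF t] T)
  then show "prob_hit_by t V w u z \<le> (SUP (V :: 'b set, w, u, z) \<in> admissible C g n. prob_hit_by t V w u z)"
    by (intro SUP_upper2[OF T(1)]) simp
qed

section \<open>The extrema\<close>

lemma mean_hitting_time_path:
  assumes "1 < g" "0 < n"
  shows "mean_hitting_time {0..n} (path_weight g) 0 {n} \<le> ennreal (biased_mean g * real n)"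
proof -
  let ?S = "\<lambda>k. survival (walk_step {0..n} (path_weight g)) {n} k 0"
  have "(\<Sum>m. ennreal (?S m)) \<le> ennreal (biased_mean g * real n)"
    unfolding suminf_eq_SUP
  proof (rule SUP_least)
    fix m
    have "(\<Sum>k<m. ennreal (?S k)) = ennreal (\<Sum>k<m. ?S k)"
      by (rule sum_ennreal) (rule survival_bounds)
    also have "\<dots> \<le> ennreal (biased_mean g * real n)"
      using path_mean_le[OF assms assms(2), of m] by (intro ennreal_leI) simp
    finally show "(\<Sum>k<m. ennreal (?S k)) \<le> ennreal (biased_mean g * real n)" .
  qed
  then show ?thesis using assms by (simp add: mean_hitting_time_eq)
qed

text \<open>Turns bounds for real upper bounds of the partial sums into a bound for the extended mean, which may be
  infinite.\<close>

lemma mean_hitting_time_ge: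
  assumes K: "\<And>t. (\<And>m. (\<Sum>k<m. survival (walk_step V w) z k u) \<le> t) \<Longrightarrow> x \<le> t" and "u \<notin> z"
  shows "ennreal x \<le> mean_hitting_time V w u z"
proof (cases "mean_hitting_time V w u z")
  case (real t)
  have eq: "mean_hitting_time V w u z = (\<Sum>m. ennreal (survival (walk_step V w) z m u))"
    using assms by (simp add: mean_hitting_time_eq)
  have "x \<le> t"
  proof (rule K)
    fix m
    have "ennreal (\<Sum>k<m. survival (walk_step V w) z k u) = (\<Sum>k<m. ennreal (survival (walk_step V w) z k u))"
      by (rule sum_ennreal[symmetric]) (rule survival_bounds)
    also have "\<dots> \<le> mean_hitting_time V w u z"
      unfolding eq by (rule sum_le_suminf) auto
    finally show "(\<Sum>k<m. survival (walk_step V w) z k u) \<le> t"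
      using real by (simp add: ennreal_le_iff)
  qed
  then show ?thesis using real by (simp add: ennreal_leI)
qed simp

text \<open>For \<open>n = 0\<close> the start may lie in the target.  This graph then attains the
  extreme values \<open>0\<close> of the mean and \<open>1\<close> of the probability.\<close>

lemma start_in_target_admissible:
  assumes "1 < g" "1 < C"
  shows "({0..1}, path_weight g, 0, {0}) \<in> admissible C g 0"
proof -
  have G: "weighted_graph {0..1} (path_weight g)"
    by (rule path_weighted_graph) (use assms in auto)
  then have "vertex_weight {0..1} (path_weight g) 0 \<noteq> 0" "vertex_weight {0..1} (path_weight g) 0 \<noteq> \<infinity>"
    unfolding weighted_graph_def by force+
  then have "set_weight {0..1} (path_weight g) {0} / vertex_weight {0..1} (path_weight g) 0 \<le> ennreal (C * g ^ 0)"
    using assms by (simp add: set_weight_def ennreal_divide_self less_top)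
  then show ?thesis
    using G by (simp add: admissible_def zero_enat_def[symmetric])
qed

theorem corollary4:
  fixes C g a :: real
  assumes "C > 1" and "g > 1" and "1 < a" and "a < biased_mean g"
    and "infinite (UNIV :: 'v set)"
  shows "\<exists>e d :: nat \<Rightarrow> real. e \<in> O(\<lambda>_. 1) \<and> d \<in> o(\<lambda>n. real n) \<and>
    (\<forall>n.
      enn2ereal (INF (V :: 'v set, w, u, z) \<in> admissible C g n. mean_hitting_time V w u z)
        = ereal (biased_mean g * real n + e n) \<and>
      (SUP (V :: 'v set, w, u, z) \<in> admissible C g n. prob_hit_by (a * real n) V w u z)
        = ennreal (exp (- biased_rate g a * real n + d n)) \<and>
      enn2ereal (INF (V :: nat set, w, u, z) \<in> admissible C g n. mean_hitting_time V w u z)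
        = ereal (biased_mean g * real n + e n) \<and>
      (SUP (V :: nat set, w, u, z) \<in> admissible C g n. prob_hit_by (a * real n) V w u z)
        = ennreal (exp (- biased_rate g a * real n + d n)))"
proof -
  define I where "I n = (INF (V :: nat set, w, u, z) \<in> admissible C g n. mean_hitting_time V w u z)" for n
  define S where "S n = (SUP (V :: nat set, w, u, z) \<in> admissible C g n. prob_hit_by (a * real n) V w u z)" for n
  have an: "0 \<le> a * real n" for n using assms by simp
  have inf_nat: "infinite (UNIV :: nat set)" by simp
  have I_eq: "(INF (V :: 'v set, w, u, z) \<in> admissible C g n. mean_hitting_time V w u z) = I n" for n
    unfolding I_def by (intro antisym INF_mean_le assms(5) inf_nat)
  have S_eq: "(SUP (V :: 'v set, w, u, z) \<in> admissible C g n. prob_hit_by (a * real n) V w u z) = S n" for n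
    unfolding S_def by (intro antisym SUP_prob_le assms(5) inf_nat an)

  have I_le: "I n \<le> ennreal (biased_mean g * real n)" for n
  proof (cases "n = 0")
    case True
    have "I n \<le> mean_hitting_time {0..1} (path_weight g) 0 {0}"
      unfolding I_def True by (intro INF_lower2[OF start_in_target_admissible[OF assms(2,1)]]) simp
    then show ?thesis by (simp add: mean_hitting_time_eq)
  next
    case False
    then have n: "0 < n" by simp
    have "I n \<le> mean_hitting_time {0..n} (path_weight g) 0 {n}"
      unfolding I_def by (intro INF_lower2[OF path_admissible[OF assms(2) n assms(1)]]) simp
    also have "\<dots> \<le> ennreal (biased_mean g * real n)"
      by (rule mean_hitting_time_path[OF assms(2) n])
    finally show ?thesis .
  qed
  obtain K where K: "\<And>n (V :: nat set) w u z t. (V, w, u, z) \<in> admissible C g n \<Longrightarrow> 0 < n \<Longrightarrow>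
      (\<And>m. (\<Sum>k<m. survival (walk_step V w) z k u) \<le> t) \<Longrightarrow> biased_mean g * real n - K \<le> t"
    using mean_lower_bound[where 'v=nat, OF assms(2,1)] by blast
  have I_ge: "ennreal (biased_mean g * real n - K) \<le> I n" if n: "0 < n" for n
    unfolding I_def
  proof (rule INF_greatest, clarify)
    fix V :: "nat set" and w u z assume adm: "(V, w, u, z) \<in> admissible C g n"
    show "ennreal (biased_mean g * real n - K) \<le> mean_hitting_time V w u z"
      by (rule mean_hitting_time_ge[OF K[OF adm n] admissibleD(5)[OF adm n]])
  qed
  define e where "e n = enn2real (I n) - biased_mean g * real n" for n
  have I_fin: "ennreal (enn2real (I n)) = I n" for n
    using I_le[of n] by (simp add: le_less_trans[OF _ ennreal_less_top])
  have m0: "0 \<le> biased_mean g" using assms by (simp add: biased_mean_def)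
  have I_ereal: "enn2ereal (I n) = ereal (biased_mean g * real n + e n)" for n
  proof -
    have "enn2ereal (I n) = enn2ereal (ennreal (enn2real (I n)))" by (simp only: I_fin)
    also have "\<dots> = ereal (enn2real (I n))" by (rule enn2ereal_ennreal) simp
    finally show ?thesis by (simp add: e_def)
  qed
  have e_bound: "\<bar>e n\<bar> \<le> \<bar>K\<bar>" if n: "0 < n" for n
  proof -
    have "enn2real (I n) \<le> biased_mean g * real n"
      using enn2real_mono[OF I_le[of n]] m0 by simp
    moreover have "biased_mean g * real n - K \<le> enn2real (I n)"
    proof -
      have "ennreal (biased_mean g * real n - K) \<le> ennreal (enn2real (I n))"
        using I_ge[OF n] by (simp only: I_fin)
      then show ?thesis by (simp add: ennreal_le_iff)
    qed
    ultimately show ?thesis by (simp add: e_def)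
  qed
  have e_O: "e \<in> O(\<lambda>_. 1)"
    by (rule bigoI[where c="\<bar>K\<bar>"])
      (use eventually_gt_at_top[of "0::nat"] in \<open>eventually_elim, use e_bound in simp\<close>)

  define q where "q n = enn2real (S n)" for n
  have S_le_1: "S n \<le> 1" for n
    unfolding S_def
  proof (rule SUP_least, clarify)
    fix V :: "nat set" and w u z assume "(V, w, u, z) \<in> admissible C g n"
    show "prob_hit_by (a * real n) V w u z \<le> 1"
      using survival_bounds(1)[of "walk_step V w" z "nat \<lfloor>a * real n\<rfloor>" u] by (simp add: prob_hit_by_eq[OF an])
  qed
  have S_fin: "ennreal (q n) = S n" for n
    using S_le_1[of n] unfolding q_def by (simp add: le_less_trans[OF _ ennreal_one_less_top])
  have path_le: "1 - survival (walk_step {0..n} (path_weight g)) {n} (nat \<lfloor>a * real n\<rfloor>) 0 \<le> q n" if n: "0 < n" for n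
  proof -
    have "prob_hit_by (a * real n) {0..n} (path_weight g) 0 {n} \<le> S n"
      unfolding S_def by (intro SUP_upper2[OF path_admissible[OF assms(2) n assms(1)]]) simp
    then have "ennreal (1 - survival (walk_step {0..n} (path_weight g)) {n} (nat \<lfloor>a * real n\<rfloor>) 0) \<le> ennreal (q n)"
      using n by (simp add: prob_hit_by_eq[OF an] S_fin)
    then show ?thesis by (simp add: ennreal_le_iff q_def)
  qed
  have q_pos: "0 < q n" for n
  proof (cases "n = 0")
    case True
    have "prob_hit_by (a * real n) {0..1} (path_weight g) 0 {0} \<le> S n"
      unfolding S_def True by (intro SUP_upper2[OF start_in_target_admissible[OF assms(2,1)]]) simp
    then have "1 \<le> ennreal (q n)" by (simp add: prob_hit_by_eq[OF an] S_fin)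
    then show ?thesis by (cases "q n > 0") (auto simp: ennreal_neg)
  next
    case False
    then have n: "0 < n" by simp
    have "n \<le> nat \<lfloor>a * real n\<rfloor>"
    proof -
      have "1 * real n \<le> a * real n" using assms by (intro mult_right_mono) auto
      then show ?thesis by (simp add: le_nat_floor)
    qed
    then have "(g / (1 + g)) ^ n \<le> 1 - survival (walk_step {0..n} (path_weight g)) {n} (nat \<lfloor>a * real n\<rfloor>) 0"
      using path_hit_prob_pos[OF assms(2) n n] by simp
    moreover have "0 < (g / (1 + g)) ^ n" using assms by simp
    ultimately show ?thesis using path_le[OF n] by linarith
  qed
  define d where "d n = ln (q n) + biased_rate g a * real n" for n
  have S_exp: "S n = ennreal (exp (- biased_rate g a * real n + d n))" for n
    using q_pos[of n] by (simp add: d_def S_fin)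
  obtain L where L: "0 < L" "\<And>n (V :: nat set) w u z. (V, w, u, z) \<in> admissible C g n \<Longrightarrow> 0 < n \<Longrightarrow>
      1 - survival (walk_step V w) z (nat \<lfloor>a * real n\<rfloor>) u \<le> L * exp (- biased_rate g a * real n)"
    using hit_prob_upper[where 'v=nat, OF assms(1-4)] by blast
  have d_upper: "d n \<le> ln L" if n: "0 < n" for n
  proof -
    have "S n \<le> ennreal (L * exp (- biased_rate g a * real n))"
      unfolding S_def
    proof (rule SUP_least, clarify)
      fix V :: "nat set" and w u z assume adm: "(V, w, u, z) \<in> admissible C g n"
      show "prob_hit_by (a * real n) V w u z \<le> ennreal (L * exp (- biased_rate g a * real n))"
        using L(2)[OF adm n] admissibleD(5)[OF adm n] by (simp add: prob_hit_by_eq[OF an] ennreal_leI)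
    qed
    then have "q n \<le> L * exp (- biased_rate g a * real n)"
      using L(1) unfolding S_fin[symmetric] by (subst (asm) ennreal_le_iff) auto
    then have "ln (q n) \<le> ln (L * exp (- biased_rate g a * real n))"
      using q_pos[of n] L(1) by (subst ln_le_cancel_iff) auto
    then show ?thesis using L(1) by (simp add: d_def ln_mult)
  qed
  have d_o: "d \<in> o(\<lambda>n. real n)"
  proof (rule landau_o.smallI)
    fix c :: real assume c: "0 < c"
    have "\<forall>\<^sub>F n in sequentially. ln L \<le> c * real n"
      using c by real_asymp
    moreover have "\<forall>\<^sub>F n in sequentially. (0::nat) < n"
      by (rule eventually_gt_at_top)
    moreover note path_hit_prob_lower[OF assms(1-4) c]
    ultimately show "\<forall>\<^sub>F n in sequentially. norm (d n) \<le> c * norm (real n)"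
    proof eventually_elim
      case (elim n)
      have "exp (real n * (- biased_rate g a - c)) \<le> q n"
        using elim(3) path_le[OF elim(2)] by linarith
      then have "real n * (- biased_rate g a - c) \<le> ln (q n)"
        using q_pos[of n] by (simp add: ln_ge_iff)
      then have "- (c * real n) \<le> d n" by (simp add: d_def algebra_simps)
      moreover have "d n \<le> c * real n" using d_upper[OF elim(2)] elim(1) by simp
      ultimately show ?case by simp
    qed
  qed
  show ?thesis
    using e_O d_o I_ereal S_exp unfolding I_eq S_eq
    unfolding I_def[symmetric] S_def[symmetric] by blast
qed

end
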